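(* Let $V$ be a bounded real-valued periodic function on $(-\infty,\infty)$ and let $H_V$ be the operator $-\frac{d^2}{dx^2}+V(x)$ on $L^2(\mathbb{R})$. For $x>0$, define $W(x)=V(x+\sqrt{x})$ and let $H_W$ be the operator $-\frac{d^2}{dx^2}+W(x)$ on $L^2(0,\infty)$ with some selfadjoint boundary condition at zero. Then $$\sigma_{\mathrm{ess}}(H_W)=\sigma(H_V).$$
   Context: $\sigma(\cdot)$ denotes the spectrum and $\sigma_{\mathrm{ess}}(\cdot)$ the essential spectrum of a selfadjoint operator. Functions are (Lebesgue) measurable. *)

theory Defs
  imports "HOL-Analysis.Analysis"
begin

section \<open>Unbounded operators in L2\<close>

text \<open>
  Elements of the Hilbert space \<open>L\<^sup>2(M)\<close> are represented by square-integrable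
  functions; two functions represent the same element iff they agree almost everywhere,
  so every notion below is formulated modulo AE-equality.
\<close>

definition L2 :: "'a measure \<Rightarrow> ('a \<Rightarrow> complex) set" where
  "L2 M = {f \<in> borel_measurable M. integrable M (\<lambda>x. (cmod (f x))\<^sup>2)}"

definition L2_norm :: "'a measure \<Rightarrow> ('a \<Rightarrow> complex) \<Rightarrow> real" where
  "L2_norm M f = sqrt (\<integral>x. (cmod (f x))\<^sup>2 \<partial>M)"

text \<open>
  An operator is given by its graph: \<open>(f, g) \<in> A\<close> means that (the class of) \<open>f\<close> lies in the
  domain of \<open>A\<close> and that \<open>A f = g\<close>. Graphs contain all representatives of their elements.
\<close>

type_synonym 'a L2_op = "(('a \<Rightarrow> complex) \<times> ('a \<Rightarrow> complex)) set"

text \<open>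
  \<open>z\<close> is in the resolvent set iff \<open>A - z\<close> maps the domain of \<open>A\<close> bijectively onto \<open>L\<^sup>2(M)\<close>
  and the inverse is bounded. Injectivity follows from the norm bound.
\<close>

definition resolvent_set :: "'a measure \<Rightarrow> 'a L2_op \<Rightarrow> complex set" where
  "resolvent_set M A =
     {z. (\<forall>k\<in>L2 M. \<exists>(f, g)\<in>A. AE x in M. g x - z * f x = k x) \<and>
         (\<exists>C. \<forall>(f, g)\<in>A. L2_norm M f \<le> C * L2_norm M (\<lambda>x. g x - z * f x))}"

definition spectrum :: "'a measure \<Rightarrow> 'a L2_op \<Rightarrow> complex set" where
  "spectrum M A = - resolvent_set M A"

definition eigenspace :: "'a measure \<Rightarrow> 'a L2_op \<Rightarrow> complex \<Rightarrow> ('a \<Rightarrow> complex) set" where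
  "eigenspace M A z = {f. \<exists>g. (f, g) \<in> A \<and> (AE x in M. g x = z * f x)}"

definition eigenvalue :: "'a measure \<Rightarrow> 'a L2_op \<Rightarrow> complex \<Rightarrow> bool" where
  "eigenvalue M A z \<longleftrightarrow> (\<exists>f\<in>eigenspace M A z. \<not> (AE x in M. f x = 0))"

text \<open>Finite-dimensionality in the quotient space \<open>L\<^sup>2(M)\<close>.\<close>

definition L2_finite_dim :: "'a measure \<Rightarrow> ('a \<Rightarrow> complex) set \<Rightarrow> bool" where
  "L2_finite_dim M E \<longleftrightarrow>
     (\<exists>B. finite B \<and> B \<subseteq> L2 M \<and> (\<forall>f\<in>E. \<exists>c. AE x in M. f x = (\<Sum>b\<in>B. c b * b x)))"

definition discrete_spectrum :: "'a measure \<Rightarrow> 'a L2_op \<Rightarrow> complex set" where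
  "discrete_spectrum M A =
     {z. z isolated_in spectrum M A \<and> eigenvalue M A z \<and> L2_finite_dim M (eigenspace M A z)}"

text \<open>
  The essential spectrum of a selfadjoint operator (for non-selfadjoint operators there are
  several inequivalent notions).
\<close>

definition essential_spectrum :: "'a measure \<Rightarrow> 'a L2_op \<Rightarrow> complex set" where
  "essential_spectrum M A = spectrum M A - discrete_spectrum M A"


section \<open>Schroedinger operators on the line and on the half-line\<close>

text \<open>
  For an interval \<open>I\<close>, this says that \<open>u\<close> is locally absolutely continuous on \<open>I\<close> with
  derivative \<open>v\<close> almost everywhere, i.e. \<open>u\<close> is an indefinite Lebesgue integral of \<open>v\<close>.
\<close>

definition ac_deriv_on :: "real set \<Rightarrow> (real \<Rightarrow> complex) \<Rightarrow> (real \<Rightarrow> complex) \<Rightarrow> bool" where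
  "ac_deriv_on I u v \<longleftrightarrow>
     (\<forall>a\<in>I. \<forall>b\<in>I. a \<le> b \<longrightarrow>
        v absolutely_integrable_on {a..b} \<and> u b - u a = integral {a..b} v)"

text \<open>
  \<open>H2_on I u u1 u2\<close>: \<open>u\<close> is the continuously differentiable representative of an element of
  the Sobolev space \<open>H\<^sup>2(I)\<close> of the open interval \<open>I\<close>, with \<open>u1 = u'\<close> and \<open>u2 = u''\<close>.
  Using \<open>closure I\<close> makes \<open>u\<close> and \<open>u1\<close> continuous up to finite end points, so that their
  boundary values there are the values of the functions.
\<close>

definition H2_on ::
  "real set \<Rightarrow> (real \<Rightarrow> complex) \<Rightarrow> (real \<Rightarrow> complex) \<Rightarrow> (real \<Rightarrow> complex) \<Rightarrow> bool" where
  "H2_on I u u1 u2 \<longleftrightarrow>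
     ac_deriv_on (closure I) u u1 \<and> ac_deriv_on (closure I) u1 u2 \<and>
     u \<in> L2 (lebesgue_on I) \<and> u1 \<in> L2 (lebesgue_on I) \<and> u2 \<in> L2 (lebesgue_on I)"

text \<open>
  The operator \<open>- d\<^sup>2/dx\<^sup>2 + q\<close> on \<open>L\<^sup>2(I)\<close>, for \<open>q\<close> bounded on \<open>I\<close>, with those
  \<open>u\<close> in \<open>H\<^sup>2(I)\<close> as domain which satisfy the boundary condition \<open>bc u u'\<close>.
\<close>

definition schroedinger ::
  "real set \<Rightarrow> ((real \<Rightarrow> complex) \<Rightarrow> (real \<Rightarrow> complex) \<Rightarrow> bool) \<Rightarrow> (real \<Rightarrow> real) \<Rightarrow> real L2_op" where
  "schroedinger I bc q =
     {(f, g). f \<in> L2 (lebesgue_on I) \<and> g \<in> L2 (lebesgue_on I) \<and>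
        (\<exists>u u1 u2. H2_on I u u1 u2 \<and> bc u u1 \<and>
           (AE x in lebesgue_on I. f x = u x) \<and>
           (AE x in lebesgue_on I. g x = - u2 x + complex_of_real (q x) * u x))}"

definition schroedinger_line :: "(real \<Rightarrow> real) \<Rightarrow> real L2_op" where
  "schroedinger_line q = schroedinger UNIV (\<lambda>u u1. True) q"

text \<open>
  For bounded \<open>q\<close>, the selfadjoint boundary conditions at \<open>0\<close> are exactly
  \<open>cos \<theta> u(0) + sin \<theta> u'(0) = 0\<close> with real \<open>\<theta>\<close>
  (\<open>\<theta> = 0\<close>: Dirichlet, \<open>\<theta> = pi / 2\<close>: Neumann).
\<close>

definition schroedinger_half_line :: "real \<Rightarrow> (real \<Rightarrow> real) \<Rightarrow> real L2_op" where
  "schroedinger_half_line \<theta> q =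
     schroedinger {0<..}
       (\<lambda>u u1. complex_of_real (cos \<theta>) * u 0 + complex_of_real (sin \<theta>) * u1 0 = 0) q"

end

theory Submission
  imports Defs "HOL-Complex_Analysis.Great_Picard"
begin

text \<open>
  The substitution \<open>t = x + sqrt x\<close> carries \<open>H_W\<close> to \<open>H_V\<close> up to coefficients that tend to zero at
  infinity. If the real number \<open>l\<close> lies in \<open>\<sigma>(H_V)\<close>, approximate eigenfunctions of \<open>H_V\<close> can be cut
  off, translated far to the right by multiples of the period and pulled back to approximate
  eigenfunctions of \<open>H_W\<close> that escape to infinity. Were \<open>l\<close> not in the essential spectrum, they would
  have to be close to the eigenspace of \<open>l\<close>, which has dimension at most one; this is impossible.
  If \<open>l\<close> lies in the resolvent set of \<open>H_V\<close>, the resolvent bound controls functions supported far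
  out, hence \<open>u\<close> is bounded by \<open>(H_W - l) u\<close> and its restriction to a compact interval. By the
  Arzela-Ascoli theorem bounded approximate eigenfunctions of \<open>H_W\<close> then have convergent subsequences,
  so \<open>l\<close> is an isolated eigenvalue or in the resolvent set.
\<close>

section \<open>Square-integrable functions\<close>

text \<open>In the variable x the difference between \<open>W\<close> and a translate of
  \<open>V\<close> does not tend to zero in general, so \<open>H_W\<close> is no small perturbation
  of \<open>H_V\<close> there. After the substitution the potentials agree exactly. The discrepancy
  moves into the factors (dt/dx)^2 - 1 and d^2t/dx^2, of order x^(-1/2) and x^(-3/2), in front of
  second and first derivatives. Both directions therefore need norms of derivatives, hence the
  interpolation inequality for u'. The role of spectral calculus is taken by inequalities on
  operator graphs. If T = A - l and the spectrum of A has no other point within distance d of l,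
  then d |<T f, f>| <= ||T f||^2; the polarised form of this converts a small residual into a small
  distance from the kernel of T. The delicate case of the second direction is a point l at which the
  spectrum accumulates. Approximate eigenvectors at nearby spectral points t are taken with residual
  small compared with |t - l|; this makes them asymptotically orthogonal to eigenvectors at l, which
  contradicts compactness.\<close>

lemma L2_measurable [measurable_dest]: "f \<in> L2 M \<Longrightarrow> f \<in> borel_measurable M"
  by (simp add: L2_def)

lemma L2_integrable: "f \<in> L2 M \<Longrightarrow> integrable M (\<lambda>x. (cmod (f x))\<^sup>2)"
  by (simp add: L2_def)

lemma L2_bound:
  assumes "f \<in> borel_measurable M" "g \<in> L2 M" "AE x in M. cmod (f x) \<le> C * cmod (g x)"
  shows "f \<in> L2 M"
proof -
  have "integrable M (\<lambda>x. (cmod (f x))\<^sup>2)"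
  proof (rule Bochner_Integration.integrable_bound)
    show "integrable M (\<lambda>x. C\<^sup>2 * (cmod (g x))\<^sup>2)"
      using assms(2) by (simp add: L2_integrable)
    show "(\<lambda>x. (cmod (f x))\<^sup>2) \<in> borel_measurable M"
      using assms(1) by measurable
    show "AE x in M. norm ((cmod (f x))\<^sup>2) \<le> norm (C\<^sup>2 * (cmod (g x))\<^sup>2)"
      using assms(3)
    proof eventually_elim
      case (elim x)
      have "(cmod (f x))\<^sup>2 \<le> (C * cmod (g x))\<^sup>2"
        using elim by (intro power_mono) auto
      then show ?case by (simp add: power_mult_distrib)
    qed
  qed
  then show ?thesis using assms(1) by (simp add: L2_def)
qed

lemma L2_add [simp]: 
  assumes "f \<in> L2 M" "g \<in> L2 M" shows "(\<lambda>x. f x + g x) \<in> L2 M"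
proof -
  note [measurable] = L2_measurable[OF assms(1)] L2_measurable[OF assms(2)]
  have "integrable M (\<lambda>x. (cmod (f x + g x))\<^sup>2)"
  proof (rule Bochner_Integration.integrable_bound)
    show "integrable M (\<lambda>x. 2 * (cmod (f x))\<^sup>2 + 2 * (cmod (g x))\<^sup>2)"
      using assms by (simp add: L2_integrable)
    show "AE x in M. norm ((cmod (f x + g x))\<^sup>2) \<le> norm (2 * (cmod (f x))\<^sup>2 + 2 * (cmod (g x))\<^sup>2)"
    proof (rule AE_I2)
      fix x
      have "(cmod (f x + g x))\<^sup>2 \<le> (cmod (f x) + cmod (g x))\<^sup>2"
        by (intro power_mono norm_triangle_ineq) auto
      also have "\<dots> \<le> 2 * (cmod (f x))\<^sup>2 + 2 * (cmod (g x))\<^sup>2"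
        using sum_squares_bound[of "cmod (f x)" "cmod (g x)"] by (simp add: power2_sum)
      finally show "norm ((cmod (f x + g x))\<^sup>2) \<le> norm (2 * (cmod (f x))\<^sup>2 + 2 * (cmod (g x))\<^sup>2)"
        by simp
    qed
  qed simp
  then show ?thesis by (simp add: L2_def)
qed

lemma L2_mult_bounded:
  assumes "b \<in> borel_measurable M" "\<And>x. x \<in> space M \<Longrightarrow> cmod (b x) \<le> K" "f \<in> L2 M"
  shows "(\<lambda>x. b x * f x) \<in> L2 M"
proof (rule L2_bound[where C=K and g=f])
  show "(\<lambda>x. b x * f x) \<in> borel_measurable M" using assms(1) L2_measurable[OF assms(3)] by measurable
  show "AE x in M. cmod (b x * f x) \<le> K * cmod (f x)"
    using assms(2) by (intro AE_I2) (simp add: norm_mult mult_right_mono)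
qed (rule assms)

lemma L2_scale [simp]: "f \<in> L2 M \<Longrightarrow> (\<lambda>x. c * f x) \<in> L2 M"
  by (rule L2_mult_bounded[where K="cmod c"]) auto

lemma L2_minus [simp]: "f \<in> L2 M \<Longrightarrow> (\<lambda>x. - f x) \<in> L2 M"
  using L2_scale[of f M "-1"] by simp

lemma L2_diff [simp]: "f \<in> L2 M \<Longrightarrow> g \<in> L2 M \<Longrightarrow> (\<lambda>x. f x - g x) \<in> L2 M"
  using L2_add[of f M "\<lambda>x. - g x"] by simp

lemma L2_zero [simp]: "(\<lambda>x. 0) \<in> L2 M"
  by (simp add: L2_def)

lemma borel_measurable_cnj' [measurable]:
  "f \<in> borel_measurable M \<Longrightarrow> (\<lambda>x. cnj (f x)) \<in> borel_measurable M"
  by (rule measurable_compose[OF _ borel_measurable_continuous_onI]) (auto intro: continuous_intros)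

lemma L2_cnj [simp]: "f \<in> L2 M \<Longrightarrow> (\<lambda>x. cnj (f x)) \<in> L2 M"
  unfolding L2_def by (auto intro: borel_measurable_cnj')

lemma L2_norm_AE_cong:
  assumes "f \<in> borel_measurable M" "g \<in> borel_measurable M" "AE x in M. f x = g x"
  shows "L2_norm M f = L2_norm M g"
proof -
  note [measurable] = assms(1,2)
  have "(\<integral>x. (cmod (f x))\<^sup>2 \<partial>M) = (\<integral>x. (cmod (g x))\<^sup>2 \<partial>M)"
    by (rule integral_cong_AE) (use assms(3) in auto)
  then show ?thesis by (simp add: L2_norm_def)
qed

lemma L2_integrable_mult:
  assumes "f \<in> L2 M" "g \<in> L2 M" shows "integrable M (\<lambda>x. f x * g x)"
proof (rule Bochner_Integration.integrable_bound)
  show "integrable M (\<lambda>x. (cmod (f x))\<^sup>2 + (cmod (g x))\<^sup>2)"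
    using assms by (simp add: L2_integrable)
  show "(\<lambda>x. f x * g x) \<in> borel_measurable M"
    using L2_measurable[OF assms(1)] L2_measurable[OF assms(2)] by measurable
  show "AE x in M. norm (f x * g x) \<le> norm ((cmod (f x))\<^sup>2 + (cmod (g x))\<^sup>2)"
  proof (rule AE_I2)
    fix x
    have "cmod (f x) * cmod (g x) \<le> (cmod (f x))\<^sup>2 + (cmod (g x))\<^sup>2"
      using sum_squares_bound[of "cmod (f x)" "cmod (g x)"]
        mult_nonneg_nonneg[OF norm_ge_zero[of "f x"] norm_ge_zero[of "g x"]] by linarith
    then show "norm (f x * g x) \<le> norm ((cmod (f x))\<^sup>2 + (cmod (g x))\<^sup>2)"
      by (simp add: norm_mult)
  qed
qed

section \<open>The inner product, the norm and the Cauchy-Schwarz inequality\<close>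

definition ip :: "'a measure \<Rightarrow> ('a \<Rightarrow> complex) \<Rightarrow> ('a \<Rightarrow> complex) \<Rightarrow> complex" where
  "ip M f g = (\<integral>x. f x * cnj (g x) \<partial>M)"

lemma ip_integrable: "f \<in> L2 M \<Longrightarrow> g \<in> L2 M \<Longrightarrow> integrable M (\<lambda>x. f x * cnj (g x))"
  by (simp add: L2_integrable_mult)

lemma ip_add_left: "f \<in> L2 M \<Longrightarrow> g \<in> L2 M \<Longrightarrow> h \<in> L2 M \<Longrightarrow> ip M (\<lambda>x. f x + g x) h = ip M f h + ip M g h"
  unfolding ip_def by (simp add: ip_integrable distrib_right Bochner_Integration.integral_add)
lemma ip_diff_left: "f \<in> L2 M \<Longrightarrow> g \<in> L2 M \<Longrightarrow> h \<in> L2 M \<Longrightarrow> ip M (\<lambda>x. f x - g x) h = ip M f h - ip M g h"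
  unfolding ip_def by (simp add: ip_integrable left_diff_distrib Bochner_Integration.integral_diff)
lemma ip_scale_left: "ip M (\<lambda>x. c * f x) h = c * ip M f h"
  unfolding ip_def by (simp add: mult.assoc)
lemma ip_add_right: "f \<in> L2 M \<Longrightarrow> g \<in> L2 M \<Longrightarrow> h \<in> L2 M \<Longrightarrow> ip M h (\<lambda>x. f x + g x) = ip M h f + ip M h g"
  unfolding ip_def by (simp add: ip_integrable distrib_left Bochner_Integration.integral_add)
lemma ip_diff_right: "f \<in> L2 M \<Longrightarrow> g \<in> L2 M \<Longrightarrow> h \<in> L2 M \<Longrightarrow> ip M h (\<lambda>x. f x - g x) = ip M h f - ip M h g"
  unfolding ip_def by (simp add: ip_integrable right_diff_distrib Bochner_Integration.integral_diff)
lemma ip_scale_right: "ip M h (\<lambda>x. c * f x) = cnj c * ip M h f"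
  unfolding ip_def by (simp add: mult.left_commute)

lemmas ip_linear = ip_add_left ip_diff_left ip_scale_left ip_add_right ip_diff_right ip_scale_right

lemma ip_commute: "ip M g f = cnj (ip M f g)"
proof -
  have "cnj (ip M f g) = (\<integral>x. cnj (f x * cnj (g x)) \<partial>M)"
    unfolding ip_def by (rule Bochner_Integration.integral_cnj[symmetric])
  then show ?thesis by (simp add: ip_def mult.commute)
qed

lemma ip_cong_AE:
  assumes "f \<in> borel_measurable M" "f' \<in> borel_measurable M" "g \<in> borel_measurable M" "g' \<in> borel_measurable M"
    "AE x in M. f x = f' x" "AE x in M. g x = g' x"
  shows "ip M f g = ip M f' g'"
  unfolding ip_def using assms by (intro integral_cong_AE) auto

lemma L2_norm_nonneg [simp]: "0 \<le> L2_norm M f"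
  by (simp add: L2_norm_def)

lemma L2_norm_square: "(L2_norm M f)\<^sup>2 = (\<integral>x. (cmod (f x))\<^sup>2 \<partial>M)"
  by (simp add: L2_norm_def)

lemma ip_self: "ip M f f = of_real ((L2_norm M f)\<^sup>2)"
proof -
  have "ip M f f = (\<integral>x. of_real ((cmod (f x))\<^sup>2) \<partial>M)"
    unfolding ip_def by (simp only: complex_norm_square)
  then show ?thesis by (simp only: L2_norm_square integral_complex_of_real)
qed

lemma L2_norm_scale: "L2_norm M (\<lambda>x. c * f x) = cmod c * L2_norm M f"
  by (simp add: L2_norm_def norm_mult power_mult_distrib real_sqrt_mult)

lemma L2_norm_minus: "L2_norm M (\<lambda>x. - f x) = L2_norm M f"
  by (simp add: L2_norm_def)

lemma L2_norm_commute: "L2_norm M (\<lambda>x. f x - g x) = L2_norm M (\<lambda>x. g x - f x)"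
  by (simp add: L2_norm_def norm_minus_commute)

lemma L2_norm_zero [simp]: "L2_norm M (\<lambda>x. 0) = 0"
  by (simp add: L2_norm_def)

lemma L2_norm_eq_0_iff:
  assumes "f \<in> L2 M" shows "L2_norm M f = 0 \<longleftrightarrow> (AE x in M. f x = 0)"
  unfolding L2_norm_def using assms
  by (subst real_sqrt_eq_0_iff, subst integral_nonneg_eq_0_iff_AE) (auto simp: L2_integrable)

lemma L2_norm_mono:
  assumes "f \<in> borel_measurable M" "g \<in> L2 M" "AE x in M. cmod (f x) \<le> C * cmod (g x)" "0 \<le> C"
  shows "L2_norm M f \<le> C * L2_norm M g"
proof -
  have f: "f \<in> L2 M" using L2_bound assms by blast
  have "(\<integral>x. (cmod (f x))\<^sup>2 \<partial>M) \<le> (\<integral>x. (C * cmod (g x))\<^sup>2 \<partial>M)"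
  proof (rule integral_mono_AE)
    show "integrable M (\<lambda>x. (C * cmod (g x))\<^sup>2)"
      using L2_integrable[OF assms(2)] by (simp add: power_mult_distrib)
    show "AE x in M. (cmod (f x))\<^sup>2 \<le> (C * cmod (g x))\<^sup>2"
      using assms(3) by eventually_elim (simp add: power_mono)
  qed (rule L2_integrable[OF f])
  then have "(L2_norm M f)\<^sup>2 \<le> (C * L2_norm M g)\<^sup>2"
    by (simp add: L2_norm_square power_mult_distrib)
  then show ?thesis by (rule power2_le_imp_le) (simp add: assms(4))
qed

lemma ip_norm_le:
  assumes "f \<in> L2 M" "g \<in> L2 M"
  shows "cmod (ip M f g) \<le> L2_norm M f * L2_norm M g"
proof -
  have exp: "0 \<le> (L2_norm M f)\<^sup>2 * (L2_norm M g)\<^sup>2 * (L2_norm M g)\<^sup>2 - (cmod (ip M f g))\<^sup>2 * (L2_norm M g)\<^sup>2"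
  proof -
    let ?n = "complex_of_real ((L2_norm M g)\<^sup>2)"
    \<comment> \<open>Up to the factor ||g||^2 this is the component of \<open>f\<close> orthogonal
      to \<open>g\<close>, written without division. The factor is cancelled below once ||g|| is
      known to be nonzero.\<close>
    let ?h = "\<lambda>x. ?n * f x - ip M f g * g x"
    have "0 \<le> Re (ip M ?h ?h)" by (simp add: ip_self)
    also have "ip M ?h ?h = ?n * ?n * ip M f f - 2 * ?n * (ip M f g * cnj (ip M f g)) + (ip M f g * cnj (ip M f g)) * ip M g g"
      using assms by (simp add: ip_linear ip_commute[of M g f] right_diff_distrib left_diff_distrib)
    also have "\<dots> = ?n * ?n * ip M f f - ?n * (ip M f g * cnj (ip M f g))"
      by (simp only: ip_self[of M g]) (simp add: algebra_simps)
    also have "\<dots> = of_real ((L2_norm M g)\<^sup>2 * (L2_norm M g)\<^sup>2 * (L2_norm M f)\<^sup>2 - (cmod (ip M f g))\<^sup>2 * (L2_norm M g)\<^sup>2)"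
      by (simp add: ip_self complex_norm_square[symmetric])
    finally show ?thesis by (simp add: mult_ac)
  qed
  show ?thesis
  proof (cases "L2_norm M g = 0")
    case True
    then have "AE x in M. g x = 0" using assms by (simp add: L2_norm_eq_0_iff)
    then have "ip M f g = ip M f (\<lambda>x. 0)" using assms
      by (intro ip_cong_AE) (auto dest: L2_measurable)
    then show ?thesis by (simp add: ip_def)
  next
    case False
    then have "(cmod (ip M f g))\<^sup>2 \<le> (L2_norm M f * L2_norm M g)\<^sup>2"
      using exp by (simp add: power_mult_distrib mult_le_cancel_right)
    then show ?thesis by (rule power2_le_imp_le) simp
  qed
qed

lemma L2_norm_add_square:
  assumes "f \<in> L2 M" "g \<in> L2 M"
  shows "(L2_norm M (\<lambda>x. f x + g x))\<^sup>2 = (L2_norm M f)\<^sup>2 + 2 * Re (ip M f g) + (L2_norm M g)\<^sup>2"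
proof -
  have "ip M (\<lambda>x. f x + g x) (\<lambda>x. f x + g x) = ip M f f + (ip M f g + cnj (ip M f g)) + ip M g g"
    using assms by (simp add: ip_linear ip_commute[of M g f])
  from arg_cong[OF this, of Re] show ?thesis by (simp add: ip_self)
qed

lemma L2_norm_triangle:
  assumes "f \<in> L2 M" "g \<in> L2 M"
  shows "L2_norm M (\<lambda>x. f x + g x) \<le> L2_norm M f + L2_norm M g"
proof (rule power2_le_imp_le)
  have "Re (ip M f g) \<le> L2_norm M f * L2_norm M g"
    using ip_norm_le[OF assms] complex_Re_le_cmod order_trans by blast
  then show "(L2_norm M (\<lambda>x. f x + g x))\<^sup>2 \<le> (L2_norm M f + L2_norm M g)\<^sup>2"
    by (simp add: L2_norm_add_square assms power2_sum)
qed simp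

lemma L2_norm_diff_triangle:
  assumes "f \<in> L2 M" "g \<in> L2 M"
  shows "L2_norm M (\<lambda>x. f x - g x) \<le> L2_norm M f + L2_norm M g"
  using L2_norm_triangle[OF assms(1) L2_minus[OF assms(2)]] by (simp add: L2_norm_minus)

lemma L2_norm_triangle3:
  assumes "f \<in> L2 M" "g \<in> L2 M" "h \<in> L2 M"
  shows "L2_norm M (\<lambda>x. f x - h x) \<le> L2_norm M (\<lambda>x. f x - g x) + L2_norm M (\<lambda>x. g x - h x)"
  using L2_norm_triangle[of "\<lambda>x. f x - g x" M "\<lambda>x. g x - h x"] assms by simp

lemma L2_norm_reverse_triangle:
  assumes "f \<in> L2 M" "g \<in> L2 M"
  shows "\<bar>L2_norm M f - L2_norm M g\<bar> \<le> L2_norm M (\<lambda>x. f x - g x)"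
  using L2_norm_triangle[of "\<lambda>x. f x - g x" M g] L2_norm_triangle[of "\<lambda>x. g x - f x" M f] assms
    L2_norm_commute[of M f g] by simp

lemma L2_norm_mult_bounded:
  assumes "b \<in> borel_measurable M" "\<And>x. x \<in> space M \<Longrightarrow> cmod (b x) \<le> K" "f \<in> L2 M" "0 \<le> K"
  shows "L2_norm M (\<lambda>x. b x * f x) \<le> K * L2_norm M f"
proof (rule L2_norm_mono)
  show "(\<lambda>x. b x * f x) \<in> borel_measurable M" using assms(1) L2_measurable[OF assms(3)] by measurable
  show "AE x in M. cmod (b x * f x) \<le> K * cmod (f x)"
    using assms(2) by (intro AE_I2) (simp add: norm_mult mult_right_mono)
qed (use assms in auto)

lemma L2_nn_integral:
  assumes "f \<in> L2 M"
  shows "(\<integral>\<^sup>+x. ennreal ((cmod (f x))\<^sup>2) \<partial>M) = ennreal ((L2_norm M f)\<^sup>2)"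
  using assms by (subst nn_integral_eq_integral) (auto simp: L2_integrable L2_norm_square)

lemma L2I_nn_integral:
  assumes "f \<in> borel_measurable M" "(\<integral>\<^sup>+x. ennreal ((cmod (f x))\<^sup>2) \<partial>M) \<le> ennreal (C\<^sup>2)" "0 \<le> C"
  shows "f \<in> L2 M" "L2_norm M f \<le> C"
proof -
  have "integrable M (\<lambda>x. (cmod (f x))\<^sup>2)"
  proof (rule integrableI_bounded)
    have "(\<integral>\<^sup>+x. ennreal (norm ((cmod (f x))\<^sup>2)) \<partial>M) \<le> ennreal (C\<^sup>2)" using assms(2) by simp
    then show "(\<integral>\<^sup>+x. ennreal (norm ((cmod (f x))\<^sup>2)) \<partial>M) < \<infinity>" by (rule le_less_trans) simp
  qed (use assms(1) in measurable)
  then show f: "f \<in> L2 M" using assms(1) by (simp add: L2_def)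
  have "(L2_norm M f)\<^sup>2 \<le> C\<^sup>2"
    using assms(2) by (simp add: L2_nn_integral[OF f])
  then show "L2_norm M f \<le> C" using assms(3) by (rule power2_le_imp_le)
qed

section \<open>Completeness of L2\<close>

text \<open>The argument of Riesz and Fischer. The partial sums of |f (n+1) - f n| have norm at most
  2, so by monotone convergence the full sum is finite almost everywhere and \<open>f n x\<close>
  converges there. Fatou's lemma, applied in m for fixed n, carries the tail bound over to the
  limit.\<close>

lemma L2_complete_fast:
  assumes f: "\<And>n. f n \<in> L2 M"
    and fast: "\<And>n. L2_norm M (\<lambda>x. f (Suc n) x - f n x) \<le> (1/2) ^ n"
  shows "\<exists>F\<in>L2 M. (\<lambda>n. L2_norm M (\<lambda>x. f n x - F x)) \<longlonglongrightarrow> 0"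
proof -
  have [measurable]: "f n \<in> borel_measurable M" for n using f L2_measurable by blast
  define d where "d n x = cmod (f (Suc n) x - f n x)" for n x
  define S where "S N x = (\<Sum>n<N. d n x)" for N x
  have [measurable]: "d n \<in> borel_measurable M" "S n \<in> borel_measurable M" for n
    unfolding d_def S_def by measurable
  have dnn: "0 \<le> d n x" for n x by (simp add: d_def)
  have Snn: "0 \<le> S n x" for n x by (simp add: S_def dnn sum_nonneg)
  \<comment> \<open>\<open>L2_norm\<close> takes complex-valued functions, so the real sums
    \<open>d\<close> and \<open>S\<close> are embedded by \<open>complex_of_real\<close>.\<close>
  have dL2: "(\<lambda>x. complex_of_real (d n x)) \<in> L2 M" for n
    by (rule L2_bound[where C=1 and g="\<lambda>x. f (Suc n) x - f n x"]) (auto simp: f d_def)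
  have S_L2: "(\<lambda>x. complex_of_real (S N x)) \<in> L2 M \<and> L2_norm M (\<lambda>x. complex_of_real (S N x)) \<le> 2 - 2 * (1/2)^N" for N
  proof (induction N)
    case 0 then show ?case by (simp add: S_def)
  next
    case (Suc N)
    have "L2_norm M (\<lambda>x. complex_of_real (d N x)) \<le> (1/2)^N"
      using fast[of N] by (simp add: d_def L2_norm_def)
    moreover have "(\<lambda>x. complex_of_real (S (Suc N) x)) = (\<lambda>x. complex_of_real (S N x) + complex_of_real (d N x))"
      by (simp add: S_def)
    ultimately show ?case
      using Suc L2_norm_triangle[of "\<lambda>x. complex_of_real (S N x)" M "\<lambda>x. complex_of_real (d N x)"] dL2[of N]
      unfolding power_Suc by auto
  qed
  have bnd: "(\<integral>\<^sup>+x. ennreal ((S N x)\<^sup>2) \<partial>M) \<le> 4" for N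
  proof -
    have "L2_norm M (\<lambda>x. complex_of_real (S N x)) \<le> 2" 
      using conjunct2[OF S_L2[of N]] zero_le_power[of "1/2::real" N] by linarith
    then have "(L2_norm M (\<lambda>x. complex_of_real (S N x)))\<^sup>2 \<le> 2\<^sup>2" by (rule power_mono) simp
    with L2_nn_integral[of "\<lambda>x. complex_of_real (S N x)" M] S_L2[of N] show ?thesis 
      by (simp add: ennreal_le_iff flip: ennreal_numeral)
  qed
  have mono: "incseq (\<lambda>N x. ennreal ((S N x)\<^sup>2))"
  proof (intro incseq_SucI le_funI ennreal_leI power_mono Snn)
    show "S n x \<le> S (Suc n) x" for n x by (simp add: S_def dnn)
  qed
  have "(\<integral>\<^sup>+x. (SUP N. ennreal ((S N x)\<^sup>2)) \<partial>M) = (SUP N. \<integral>\<^sup>+x. ennreal ((S N x)\<^sup>2) \<partial>M)"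
    by (rule nn_integral_monotone_convergence_SUP[OF mono]) auto
  also have "\<dots> \<le> 4" by (rule SUP_least) (rule bnd)
  finally have "(\<integral>\<^sup>+x. (SUP N. ennreal ((S N x)\<^sup>2)) \<partial>M) \<noteq> \<infinity>"
    by (auto simp: top_unique)
  then have "AE x in M. (SUP N. ennreal ((S N x)\<^sup>2)) \<noteq> \<infinity>"
    by (intro nn_integral_PInf_AE) measurable
  then have conv: "AE x in M. convergent (\<lambda>n. f n x)"
  proof eventually_elim
    case (elim x)
    then obtain K where K: "(SUP N. ennreal ((S N x)\<^sup>2)) = ennreal K" "0 \<le> K"
      by (cases "(SUP N. ennreal ((S N x)\<^sup>2))") auto
    have "S N x \<le> sqrt K" for N
    proof -
      have "ennreal ((S N x)\<^sup>2) \<le> ennreal K" unfolding K(1)[symmetric] by (rule SUP_upper) simp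
      then show ?thesis using K(2) by (simp add: real_le_rsqrt)
    qed
    then have "summable (\<lambda>n. d n x)"
      by (intro summableI_nonneg_bounded[where x="sqrt K"]) (auto simp: dnn S_def)
    then have "summable (\<lambda>n. f (Suc n) x - f n x)"
      unfolding d_def by (rule summable_norm_cancel)
    then have "convergent (\<lambda>N. \<Sum>n<N. f (Suc n) x - f n x)"
      by (simp add: summable_iff_convergent)
    then have "convergent (\<lambda>N. f N x - f 0 x)"
      using sum_lessThan_telescope[of "\<lambda>n. f n x"] by simp
    then have "convergent (\<lambda>N. (f N x - f 0 x) + f 0 x)"
      by (intro convergent_add convergent_const)
    then show ?case by simp
  qed
  \<comment> \<open>On the null set where the sequence diverges \<open>lim\<close> takes some
    unspecified value; \<open>F\<close> is measurable all the same.\<close>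
  define F where "F x = lim (\<lambda>n. f n x)" for x
  have [measurable]: "F \<in> borel_measurable M" unfolding F_def by measurable
  have tail: "L2_norm M (\<lambda>x. f m x - f n x) \<le> 2 * (1/2)^n" if "n \<le> m" for m n
  proof -
    have "L2_norm M (\<lambda>x. f (n + k) x - f n x) \<le> 2 * (1/2)^n - 2 * (1/2)^(n+k)" for k
    proof (induction k)
      case (Suc k)
      have "L2_norm M (\<lambda>x. f (n + Suc k) x - f n x) 
         \<le> L2_norm M (\<lambda>x. f (n + Suc k) x - f (n+k) x) + L2_norm M (\<lambda>x. f (n + k) x - f n x)"
        by (rule L2_norm_triangle3) (auto simp: f)
      then show ?case using Suc fast[of "n+k"] unfolding power_Suc add_Suc_right by linarith
    qed simp
    from this[of "m - n"] that zero_le_power[of "1/2::real" m] show ?thesis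
      by (simp del: zero_le_power)
  qed
  have est: "(\<lambda>x. f n x - F x) \<in> L2 M \<and> L2_norm M (\<lambda>x. f n x - F x) \<le> 2 * (1/2)^n" for n
  proof -
    have "(\<integral>\<^sup>+x. ennreal ((cmod (f n x - F x))\<^sup>2) \<partial>M) = 
      (\<integral>\<^sup>+x. liminf (\<lambda>m. ennreal ((cmod (f n x - f m x))\<^sup>2)) \<partial>M)"
    proof (rule nn_integral_cong_AE, use conv in eventually_elim)
      case (elim x)
      then have "(\<lambda>m. f m x) \<longlonglongrightarrow> F x" by (simp add: F_def convergent_LIMSEQ_iff)
      then have "(\<lambda>m. ennreal ((cmod (f n x - f m x))\<^sup>2)) \<longlonglongrightarrow> ennreal ((cmod (f n x - F x))\<^sup>2)"
        by (intro tendsto_intros tendsto_ennrealI)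
      then show ?case by (intro lim_imp_Liminf[symmetric]) auto
    qed
    also have "\<dots> \<le> liminf (\<lambda>m. \<integral>\<^sup>+x. ennreal ((cmod (f n x - f m x))\<^sup>2) \<partial>M)"
      by (rule nn_integral_liminf) auto
    also have "\<dots> \<le> ennreal ((2 * (1/2)^n)\<^sup>2)"
    proof (rule Liminf_le)
      show "\<forall>\<^sub>F m in sequentially. (\<integral>\<^sup>+x. ennreal ((cmod (f n x - f m x))\<^sup>2) \<partial>M) \<le> ennreal ((2 * (1/2)^n)\<^sup>2)"
        using eventually_ge_at_top[of n]
      proof eventually_elim
        case (elim m)
        have "(\<integral>\<^sup>+x. ennreal ((cmod (f n x - f m x))\<^sup>2) \<partial>M) = ennreal ((L2_norm M (\<lambda>x. f n x - f m x))\<^sup>2)"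
          by (rule L2_nn_integral) (simp add: f)
        also have "\<dots> \<le> ennreal ((2 * (1/2)^n)\<^sup>2)"
          using tail[OF elim] L2_norm_commute[of M "f m" "f n"] by (intro ennreal_leI power_mono) auto
        finally show ?case .
      qed
    qed simp
    finally show ?thesis using L2I_nn_integral[of "\<lambda>x. f n x - F x" M "2 * (1/2)^n"] by simp
  qed
  have "(\<lambda>x. f 0 x - (f 0 x - F x)) \<in> L2 M" 
    using L2_diff[OF f[of 0] conjunct1[OF est[of 0]]] .
  then have "F \<in> L2 M" by simp
  moreover have "(\<lambda>n. L2_norm M (\<lambda>x. f n x - F x)) \<longlonglongrightarrow> 0"
  proof (rule tendsto_sandwich[OF _ _ tendsto_const])
    show "(\<lambda>n. 2 * (1/2::real)^n) \<longlonglongrightarrow> 0" by (intro tendsto_mult_right_zero LIMSEQ_power_zero) simp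
  qed (use est in auto)
  ultimately show ?thesis by blast
qed

lemma L2_complete:
  assumes f: "\<And>n. f n \<in> L2 M"
    and cauchy: "\<And>e. e > 0 \<Longrightarrow> \<exists>N. \<forall>m\<ge>N. \<forall>n\<ge>N. L2_norm M (\<lambda>x. f m x - f n x) < e"
  shows "\<exists>F\<in>L2 M. (\<lambda>n. L2_norm M (\<lambda>x. f n x - F x)) \<longlonglongrightarrow> 0"
proof -
  have "\<forall>k. \<exists>N. \<forall>m\<ge>N. \<forall>n\<ge>N. L2_norm M (\<lambda>x. f m x - f n x) < (1/2)^k"
    using cauchy by simp
  then obtain N where N: "\<And>k m n. m \<ge> N k \<Longrightarrow> n \<ge> N k \<Longrightarrow> L2_norm M (\<lambda>x. f m x - f n x) < (1/2)^k"
    by metis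
  \<comment> \<open>Summing the thresholds makes \<open>r\<close> monotone and at least
    \<open>N k\<close>; the added \<open>k\<close> forces \<open>r k\<close> to infinity, which is
    needed to compare the whole sequence with the subsequence.\<close>
  define r where "r k = (\<Sum>i\<le>k. N i) + k" for k
  have rN: "r k \<ge> N k" for k unfolding r_def by (simp add: member_le_sum trans_le_add1)
  have rmono: "r k \<le> r (Suc k)" for k unfolding r_def by simp
  have rk: "k \<le> r k" for k by (simp add: r_def)
  have "L2_norm M (\<lambda>x. f (r (Suc k)) x - f (r k) x) \<le> (1/2)^k" for k
    using N[of k "r (Suc k)" "r k"] rN[of k] rmono[of k] by simp
  then obtain F where F: "F \<in> L2 M" "(\<lambda>k. L2_norm M (\<lambda>x. f (r k) x - F x)) \<longlonglongrightarrow> 0"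
    using L2_complete_fast[of "\<lambda>k. f (r k)" M] f by blast
  have "(\<lambda>n. L2_norm M (\<lambda>x. f n x - F x)) \<longlonglongrightarrow> 0"
  proof (rule LIMSEQ_I)
    fix e :: real assume e: "0 < e"
    obtain N1 where N1: "\<forall>m\<ge>N1. \<forall>n\<ge>N1. L2_norm M (\<lambda>x. f m x - f n x) < e/2"
      using cauchy[of "e/2"] e by auto
    obtain N2 where N2: "\<forall>k\<ge>N2. norm (L2_norm M (\<lambda>x. f (r k) x - F x) - 0) < e/2"
      using LIMSEQ_D[OF F(2), of "e/2"] e by auto
    show "\<exists>no. \<forall>n\<ge>no. norm (L2_norm M (\<lambda>x. f n x - F x) - 0) < e"
    proof (intro exI allI impI)
      fix n assume n: "n \<ge> N1"
      define k where "k = max N1 N2"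
      have "L2_norm M (\<lambda>x. f n x - F x) \<le> L2_norm M (\<lambda>x. f n x - f (r k) x) + L2_norm M (\<lambda>x. f (r k) x - F x)"
        using f F by (intro L2_norm_triangle3)
      moreover have "L2_norm M (\<lambda>x. f n x - f (r k) x) < e/2"
        using N1 n rk[of k] by (auto simp: k_def)
      moreover have "L2_norm M (\<lambda>x. f (r k) x - F x) < e/2"
        using N2 by (auto simp: k_def)
      ultimately show "norm (L2_norm M (\<lambda>x. f n x - F x) - 0) < e" by simp
    qed
  qed
  with F show ?thesis by blast
qed

section \<open>Selfadjoint operators given by their graphs\<close>

text \<open>Banach's fixed point theorem carried out on representatives. Limits exist only modulo
  null sets, so the fixed point equation holds almost everywhere.\<close>

lemma L2_contraction:
  assumes T: "\<And>f. f \<in> L2 M \<Longrightarrow> T f \<in> L2 M"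
    and q: "0 \<le> q" "q < 1"
    and contr: "\<And>f g. f \<in> L2 M \<Longrightarrow> g \<in> L2 M \<Longrightarrow>
      L2_norm M (\<lambda>x. T f x - T g x) \<le> q * L2_norm M (\<lambda>x. f x - g x)"
  shows "\<exists>F\<in>L2 M. AE x in M. T F x = F x"
proof -
  define F where "F n = (T ^^ n) (\<lambda>x. 0)" for n
  have F_Suc: "F (Suc n) = T (F n)" for n by (simp add: F_def)
  have F: "F n \<in> L2 M" for n
    by (induction n) (auto simp: F_Suc T, auto simp: F_def)
  define D where "D = L2_norm M (\<lambda>x. F 1 x - F 0 x)"
  have step: "L2_norm M (\<lambda>x. F (Suc n) x - F n x) \<le> q ^ n * D" for n
  proof (induction n)
    case (Suc n)
    have "L2_norm M (\<lambda>x. F (Suc (Suc n)) x - F (Suc n) x) \<le> q * L2_norm M (\<lambda>x. F (Suc n) x - F n x)"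
      unfolding F_Suc[of "Suc n"] by (subst (2) F_Suc) (rule contr[OF F F])
    also have "\<dots> \<le> q * (q ^ n * D)" using Suc q by (intro mult_left_mono) auto
    finally show ?case by simp
  qed (simp add: D_def)
  \<comment> \<open>The sum of the geometric series \<open>q ^ n * D\<close>. With
    \<open>D = E * (1 - q)\<close> the bounds on successive steps telescope in the
    induction.\<close>
  define E where "E = D / (1 - q)"
  have DE: "D = E * (1 - q)" using q by (simp add: E_def)
  have E0: "0 \<le> E" using q by (simp add: E_def D_def)
  have dist: "L2_norm M (\<lambda>x. F (n + k) x - F n x) \<le> q ^ n * E - q ^ (n + k) * E" for n k
  proof (induction k)
    case (Suc k)
    have "L2_norm M (\<lambda>x. F (n + Suc k) x - F n x)
        \<le> L2_norm M (\<lambda>x. F (n + Suc k) x - F (n + k) x) + L2_norm M (\<lambda>x. F (n + k) x - F n x)"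
      by (rule L2_norm_triangle3) (auto simp: F)
    also have "\<dots> \<le> q ^ (n + k) * D + (q ^ n * E - q ^ (n + k) * E)"
      using Suc step[of "n + k"] by simp
    also have "\<dots> = q ^ n * E - q ^ (n + Suc k) * E" by (simp add: DE algebra_simps)
    finally show ?case .
  qed simp
  have dist': "L2_norm M (\<lambda>x. F m x - F n x) \<le> q ^ n * E" if "n \<le> m" for m n
  proof -
    have "0 \<le> q ^ m * E" using q E0 by simp
    then show ?thesis using dist[of n "m - n"] that by simp
  qed
  have lim0: "(\<lambda>n. q ^ n * E) \<longlonglongrightarrow> 0"
    using q by (intro tendsto_mult_left_zero LIMSEQ_power_zero) auto
  have "\<exists>G\<in>L2 M. (\<lambda>n. L2_norm M (\<lambda>x. F n x - G x)) \<longlonglongrightarrow> 0"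
  proof (rule L2_complete)
    fix e :: real assume "0 < e"
    then obtain N where N: "\<And>n. n \<ge> N \<Longrightarrow> norm (q ^ n * E - 0) < e"
      using LIMSEQ_D[OF lim0] by blast
    have "L2_norm M (\<lambda>x. F m x - F n x) < e" if "m \<ge> N" "n \<ge> N" for m n
    proof (cases "n \<le> m")
      case True
      then show ?thesis using dist'[of n m] N[of n] that by simp
    next
      case False
      then show ?thesis using dist'[of m n] N[of m] that L2_norm_commute[of M "F m" "F n"] by simp
    qed
    then show "\<exists>N. \<forall>m\<ge>N. \<forall>n\<ge>N. L2_norm M (\<lambda>x. F m x - F n x) < e" by blast
  qed (rule F)
  then obtain G where G: "G \<in> L2 M" and lim: "(\<lambda>n. L2_norm M (\<lambda>x. F n x - G x)) \<longlonglongrightarrow> 0" by blast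
  have "L2_norm M (\<lambda>x. T G x - G x) \<le> 0"
  proof (rule LIMSEQ_le_const)
    have "(\<lambda>n. q * L2_norm M (\<lambda>x. F n x - G x) + L2_norm M (\<lambda>x. F (Suc n) x - G x)) \<longlonglongrightarrow> q * 0 + 0"
      by (intro tendsto_add tendsto_mult tendsto_const lim LIMSEQ_Suc[OF lim])
    then show "(\<lambda>n. q * L2_norm M (\<lambda>x. F n x - G x) + L2_norm M (\<lambda>x. F (Suc n) x - G x)) \<longlonglongrightarrow> 0" by simp
    have "L2_norm M (\<lambda>x. T G x - G x) \<le> q * L2_norm M (\<lambda>x. F n x - G x) + L2_norm M (\<lambda>x. F (Suc n) x - G x)" for n
      using L2_norm_triangle3[of "T G" M "T (F n)" G] contr[OF G F[of n]] T G F
      by (simp add: F_Suc L2_norm_commute[of M G])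
    then show "\<exists>N. \<forall>n\<ge>N. L2_norm M (\<lambda>x. T G x - G x) \<le> q * L2_norm M (\<lambda>x. F n x - G x) + L2_norm M (\<lambda>x. F (Suc n) x - G x)"
      by blast
  qed
  then have "L2_norm M (\<lambda>x. T G x - G x) = 0" by (simp add: antisym)
  then have "AE x in M. T G x - G x = 0" using T G by (subst (asm) L2_norm_eq_0_iff) auto
  then show ?thesis using G by auto
qed

lemma ip_tendsto_left:
  assumes "\<And>n. F n \<in> L2 M" "G \<in> L2 M" "h \<in> L2 M" "(\<lambda>n. L2_norm M (\<lambda>x. F n x - G x)) \<longlonglongrightarrow> 0"
  shows "(\<lambda>n. ip M (F n) h) \<longlonglongrightarrow> ip M G h"
proof (rule Lim_transform2[OF tendsto_const])
  show "(\<lambda>n. ip M G h - ip M (F n) h) \<longlonglongrightarrow> 0"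
  proof (rule Lim_null_comparison)
    show "\<forall>\<^sub>F n in sequentially. norm (ip M G h - ip M (F n) h) \<le> L2_norm M (\<lambda>x. F n x - G x) * L2_norm M h"
      using ip_norm_le[of "\<lambda>x. F n x - G x" M h for n] assms(1-3)
      by (intro always_eventually allI) (simp add: ip_linear norm_minus_commute)
    show "(\<lambda>n. L2_norm M (\<lambda>x. F n x - G x) * L2_norm M h) \<longlonglongrightarrow> 0"
      by (intro tendsto_mult_left_zero assms)
  qed
qed

lemma ip_tendsto_right:
  assumes "\<And>n. F n \<in> L2 M" "G \<in> L2 M" "h \<in> L2 M" "(\<lambda>n. L2_norm M (\<lambda>x. F n x - G x)) \<longlonglongrightarrow> 0"
  shows "(\<lambda>n. ip M h (F n)) \<longlonglongrightarrow> ip M h G"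
  using tendsto_cnj[OF ip_tendsto_left[OF assms]] by (simp add: ip_commute[of M h])

lemma L2_norm_tendsto:
  assumes "\<And>n. F n \<in> L2 M" "G \<in> L2 M" "(\<lambda>n. L2_norm M (\<lambda>x. F n x - G x)) \<longlonglongrightarrow> 0"
  shows "(\<lambda>n. L2_norm M (F n)) \<longlonglongrightarrow> L2_norm M G"
proof (rule Lim_transform2[OF tendsto_const])
  show "(\<lambda>n. L2_norm M G - L2_norm M (F n)) \<longlonglongrightarrow> 0"
    using L2_norm_reverse_triangle[OF assms(1) assms(2)]
    by (intro Lim_null_comparison[OF always_eventually assms(3)]) (simp add: abs_minus_commute)
qed

lemma L2_norm_scale_add:
  assumes "f \<in> L2 M" "g \<in> L2 M"
  shows "(L2_norm M (\<lambda>x. f x + complex_of_real s * g x))\<^sup>2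
    = (L2_norm M f)\<^sup>2 + 2 * s * Re (ip M f g) + s\<^sup>2 * (L2_norm M g)\<^sup>2"
  using L2_norm_add_square[of f M "\<lambda>x. complex_of_real s * g x"] assms
  by (simp add: ip_linear L2_norm_scale power_mult_distrib)

section \<open>Symmetric operators and surjectivity of A - z\<close>

text \<open>\<open>graph_AE\<close> makes membership depend only on classes modulo null sets. Pairs
  may thus be replaced by convenient representatives such as \<open>k x + z * f x\<close> in the
  second component.\<close>

locale symmetric_op =
  fixes M :: "'a measure" and A :: "'a L2_op"
  assumes graph_L2: "(f, g) \<in> A \<Longrightarrow> f \<in> L2 M \<and> g \<in> L2 M"
    and graph_AE: "\<lbrakk>(f, g) \<in> A; f' \<in> L2 M; g' \<in> L2 M; AE x in M. f x = f' x; AE x in M. g x = g' x\<rbrakk> \<Longrightarrow> (f', g') \<in> A"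
    and graph_add: "(f, g) \<in> A \<Longrightarrow> (f', g') \<in> A \<Longrightarrow> (\<lambda>x. f x + f' x, \<lambda>x. g x + g' x) \<in> A"
    and graph_scale: "(f, g) \<in> A \<Longrightarrow> (\<lambda>x. c * f x, \<lambda>x. c * g x) \<in> A"
    and symmetric: "(f, g) \<in> A \<Longrightarrow> (f', g') \<in> A \<Longrightarrow> ip M g f' = ip M f g'"
begin

lemma graph_lincomb:
  "(f, g) \<in> A \<Longrightarrow> (f', g') \<in> A \<Longrightarrow> (\<lambda>x. f x + c * f' x, \<lambda>x. g x + c * g' x) \<in> A"
  using graph_add graph_scale by blast

lemma graph_diff:
  "(f, g) \<in> A \<Longrightarrow> (f', g') \<in> A \<Longrightarrow> (\<lambda>x. f x - f' x, \<lambda>x. g x - g' x) \<in> A"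
  using graph_lincomb[of f g f' g' "-1"] by simp

text \<open>The image is literally \<open>k + z f\<close> rather than almost everywhere equal to it.
  Saturation of the graph makes this equivalent to the range condition in
  \<open>resolvent_set\<close>, and it can be fed into other graph rules directly.\<close>

definition surj_at :: "complex \<Rightarrow> bool" where
  "surj_at z \<longleftrightarrow> (\<forall>k\<in>L2 M. \<exists>f. (f, \<lambda>x. k x + z * f x) \<in> A)"

lemma surj_at_iff: "surj_at z \<longleftrightarrow> (\<forall>k\<in>L2 M. \<exists>(f, g)\<in>A. AE x in M. g x - z * f x = k x)"
proof
  assume "surj_at z"
  then show "\<forall>k\<in>L2 M. \<exists>(f, g)\<in>A. AE x in M. g x - z * f x = k x"
    unfolding surj_at_def by (metis (mono_tags, lifting) AE_I2 add_diff_cancel_right' case_prodI)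
next
  assume *: "\<forall>k\<in>L2 M. \<exists>(f, g)\<in>A. AE x in M. g x - z * f x = k x"
  show "surj_at z"
    unfolding surj_at_def
  proof
    fix k assume k: "k \<in> L2 M"
    with * obtain f g where fg: "(f, g) \<in> A" "AE x in M. g x - z * f x = k x" by blast
    have "(f, \<lambda>x. k x + z * f x) \<in> A"
    proof (rule graph_AE[OF fg(1)])
      show "AE x in M. g x = k x + z * f x" using fg(2) by eventually_elim (simp add: algebra_simps)
    qed (use graph_L2[OF fg(1)] k in auto)
    then show "\<exists>f. (f, \<lambda>x. k x + z * f x) \<in> A" by blast
  qed
qed

text \<open>By symmetry <A f, f> is real, so in ||(A - z) f||^2 the imaginary part of z contributes
  only its square times ||f||^2. The lower bound by |Im z| and the comparison with Re z both follow
  by dropping one of the two terms.\<close>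

lemma norm_shift_square:
  assumes "(f, g) \<in> A"
  shows "(L2_norm M (\<lambda>x. g x - z * f x))\<^sup>2 = (L2_norm M (\<lambda>x. g x - complex_of_real (Re z) * f x))\<^sup>2 + (Im z)\<^sup>2 * (L2_norm M f)\<^sup>2"
proof -
  have fg: "f \<in> L2 M" "g \<in> L2 M" using graph_L2[OF assms] by auto
  define p where "p = Re (ip M g f)"
  have p: "ip M g f = of_real p" "ip M f g = of_real p"
    using symmetric[OF assms assms] ip_commute[of M g f] by (auto simp: p_def complex_eq_iff)
  have "ip M (\<lambda>x. g x - w * f x) (\<lambda>x. g x - w * f x) = ip M g g - (w + cnj w) * p + w * cnj w * ip M f f" for w
    using fg by (simp add: ip_linear p algebra_simps)
  then have "of_real ((L2_norm M (\<lambda>x. g x - w * f x))\<^sup>2) = of_real ((L2_norm M g)\<^sup>2) - (w + cnj w) * p + w * cnj w * of_real ((L2_norm M f)\<^sup>2)" for w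
    by (simp only: ip_self)
  then have "Re (of_real ((L2_norm M (\<lambda>x. g x - w * f x))\<^sup>2)) = Re (of_real ((L2_norm M g)\<^sup>2) - (w + cnj w) * p + w * cnj w * of_real ((L2_norm M f)\<^sup>2))" for w
    by (simp only:)
  then have *: "(L2_norm M (\<lambda>x. g x - w * f x))\<^sup>2 = (L2_norm M g)\<^sup>2 - 2 * Re w * p + ((Re w)\<^sup>2 + (Im w)\<^sup>2) * (L2_norm M f)\<^sup>2" for w
    by (simp add: power2_eq_square)
  show ?thesis unfolding * by (simp add: algebra_simps)
qed

lemma norm_shift_ge:
  assumes "(f, g) \<in> A"
  shows "\<bar>Im z\<bar> * L2_norm M f \<le> L2_norm M (\<lambda>x. g x - z * f x)"
proof (rule power2_le_imp_le)
  show "(\<bar>Im z\<bar> * L2_norm M f)\<^sup>2 \<le> (L2_norm M (\<lambda>x. g x - z * f x))\<^sup>2"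
    using norm_shift_square[OF assms, of z] by (simp add: power_mult_distrib)
qed simp

lemma norm_shift_ge_real:
  assumes "(f, g) \<in> A"
  shows "L2_norm M (\<lambda>x. g x - complex_of_real (Re z) * f x) \<le> L2_norm M (\<lambda>x. g x - z * f x)"
proof (rule power2_le_imp_le)
  show "(L2_norm M (\<lambda>x. g x - complex_of_real (Re z) * f x))\<^sup>2 \<le> (L2_norm M (\<lambda>x. g x - z * f x))\<^sup>2"
    using norm_shift_square[OF assms, of z] by simp
qed simp

text \<open>The equation (A - z + b) f = k is rewritten as f = R (k - b f) with R a right inverse of
  A - z, a contraction with factor C K. It serves two purposes: a constant b moves the spectral
  parameter, and b = q adds a potential to the free operator.\<close>

lemma surj_perturb:
  assumes surj: "surj_at z" and C: "\<And>f g. (f, g) \<in> A \<Longrightarrow> L2_norm M f \<le> C * L2_norm M (\<lambda>x. g x - z * f x)"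
    and b: "b \<in> borel_measurable M" "\<And>x. x \<in> space M \<Longrightarrow> cmod (b x) \<le> K" "0 \<le> K"
    and small: "0 \<le> C" "C * K < 1" and k: "k \<in> L2 M"
  shows "\<exists>f. (f, \<lambda>x. k x - b x * f x + z * f x) \<in> A"
proof -
  obtain R where R: "\<And>k. k \<in> L2 M \<Longrightarrow> (R k, \<lambda>x. k x + z * R k x) \<in> A"
    using surj unfolding surj_at_def by metis
  have RL: "R k \<in> L2 M" if "k \<in> L2 M" for k using graph_L2[OF R[OF that]] by blast
  \<comment> \<open>\<open>R\<close> is a mere choice function. The Lipschitz estimate for
    \<open>T\<close> comes from applying the bound \<open>C\<close> to differences of graph
    elements, not from linearity of \<open>R\<close>.\<close>
  define T where "T f = R (\<lambda>x. k x - b x * f x)" for f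
  have kb: "(\<lambda>x. k x - b x * f x) \<in> L2 M" if "f \<in> L2 M" for f
    using k L2_mult_bounded[OF b(1,2) that] by simp
  have "\<exists>F\<in>L2 M. AE x in M. T F x = F x"
  proof (rule L2_contraction)
    fix f g assume fg: "f \<in> L2 M" "g \<in> L2 M"
    have "L2_norm M (\<lambda>x. T f x - T g x) \<le> C * L2_norm M (\<lambda>x. b x * (g x - f x))"
      using C[OF graph_diff[OF R[OF kb[OF fg(1)]] R[OF kb[OF fg(2)]]]]
      by (simp add: T_def algebra_simps)
    also have "\<dots> \<le> C * (K * L2_norm M (\<lambda>x. g x - f x))"
      using fg b small by (intro mult_left_mono L2_norm_mult_bounded) auto
    finally show "L2_norm M (\<lambda>x. T f x - T g x) \<le> C * K * L2_norm M (\<lambda>x. f x - g x)"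
      by (simp add: L2_norm_commute[of M g f])
  qed (use small b kb RL in \<open>auto simp: T_def\<close>)
  then obtain F where F: "F \<in> L2 M" "AE x in M. T F x = F x" by blast
  have "(T F, \<lambda>x. k x - b x * T F x + z * T F x) \<in> A"
  proof (rule graph_AE[OF R[OF kb[OF F(1)]]])
    have TF: "T F \<in> L2 M" using RL kb F(1) by (simp add: T_def)
    then show "T F \<in> L2 M" "(\<lambda>x. k x - b x * T F x + z * T F x) \<in> L2 M"
      using kb by auto
    show "AE x in M. R (\<lambda>x. k x - b x * F x) x = T F x" by (simp add: T_def)
    show "AE x in M. k x - b x * F x + z * R (\<lambda>x. k x - b x * F x) x = k x - b x * T F x + z * T F x"
      using F(2) by eventually_elim (simp add: T_def)
  qed
  then show ?thesis by blast
qed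

lemma surj_step:
  assumes "surj_at z" "\<And>f g. (f, g) \<in> A \<Longrightarrow> L2_norm M f \<le> C * L2_norm M (\<lambda>x. g x - z * f x)"
    "0 \<le> C" "C * cmod (w - z) < 1"
  shows "surj_at w"
  unfolding surj_at_def
proof
  fix k assume k: "k \<in> L2 M"
  have "\<exists>f. (f, \<lambda>x. k x - (z - w) * f x + z * f x) \<in> A"
    by (rule surj_perturb[OF assms(1,2)]) (use assms(3,4) k in \<open>auto simp: norm_minus_commute\<close>)
  then show "\<exists>f. (f, \<lambda>x. k x + w * f x) \<in> A" by (simp add: algebra_simps)
qed

lemma surj_nonreal_step:
  assumes "surj_at z" "cmod (w - z) < \<bar>Im z\<bar>"
  shows "surj_at w"
proof (rule surj_step[OF assms(1)])
  have pos: "0 < \<bar>Im z\<bar>" using assms(2) norm_ge_zero order_le_less_trans by blast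
  show "L2_norm M f \<le> 1 / \<bar>Im z\<bar> * L2_norm M (\<lambda>x. g x - z * f x)" if "(f, g) \<in> A" for f g
    using norm_shift_ge[OF that, of z] pos by (simp add: field_simps)
  show "1 / \<bar>Im z\<bar> * cmod (w - z) < 1" using assms(2) pos by (simp add: field_simps)
qed simp

text \<open>The segment from z to w stays at distance at least \<open>m\<close> from the real axis,
  where \<open>m\<close> is the smaller of |Im z| and |Im w|. It is cut into N equal pieces shorter
  than \<open>m\<close>, and each piece is an admissible step for
  \<open>surj_nonreal_step\<close>.\<close>

lemma surj_half_plane:
  assumes surj: "surj_at z" and same: "0 < Im z * Im w"
  shows "surj_at w"
proof -
  define m where "m = min \<bar>Im z\<bar> \<bar>Im w\<bar>"
  have m: "0 < m" using same by (auto simp: m_def)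
  obtain N :: nat where N: "cmod (w - z) / m < real N" using reals_Archimedean2 by blast
  then have N0: "0 < real N" using m by (smt (verit) divide_nonneg_pos norm_ge_zero)
  define p where "p k = z + of_real (real k / real N) * (w - z)" for k
  have "surj_at (p k)" if "k \<le> N" for k
    using that
  proof (induction k)
    case 0 then show ?case using surj by (simp add: p_def)
  next
    case (Suc k)
    show ?case
    proof (rule surj_nonreal_step)
      show "surj_at (p k)" using Suc by simp
      define t where "t = real k / real N"
      have t: "0 \<le> t" "t \<le> 1" using Suc N0 by (auto simp: t_def)
      have Imp: "Im (p k) = (1 - t) * Im z + t * Im w" by (simp add: p_def t_def[symmetric] algebra_simps)
      have "m \<le> \<bar>Im (p k)\<bar>"
      proof (cases "0 < Im z")
        case True
        then have "0 < Im w" using same by (simp add: zero_less_mult_iff)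
        then have "(1 - t) * m + t * m \<le> (1 - t) * Im z + t * Im w"
          using t True by (intro add_mono mult_left_mono) (auto simp: m_def)
        then show ?thesis unfolding Imp by (simp add: algebra_simps)
      next
        case False
        then have "Im z < 0" "Im w < 0" using same by (auto simp: zero_less_mult_iff)
        then have "(1 - t) * m + t * m \<le> (1 - t) * (- Im z) + t * (- Im w)"
          using t by (intro add_mono mult_left_mono) (auto simp: m_def)
        then show ?thesis unfolding Imp by (simp add: algebra_simps)
      qed
      moreover have "p (Suc k) - p k = of_real (1 / real N) * (w - z)"
        by (simp add: p_def add_divide_distrib ring_distribs)
      then have "cmod (p (Suc k) - p k) = cmod (w - z) / real N"
        by (simp add: norm_mult norm_divide)
      moreover have "cmod (w - z) / real N < m" using N N0 m by (simp add: field_simps)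
      ultimately show "cmod (p (Suc k) - p k) < \<bar>Im (p k)\<bar>" by simp
    qed
  qed
  from this[of N] show ?thesis using N0 by (simp add: p_def)
qed

end

section \<open>Selfadjointness, resolvent set and approximate eigenvectors\<close>

text \<open>The range criterion for selfadjointness: A - z is onto for one z in each open
  half-plane. Density of the domain follows: if h is orthogonal to it and h = (A - z) f, then f is
  orthogonal to the range of A - cnj z, which is everything.\<close>

locale selfadjoint_op = symmetric_op +
  assumes surj_upper: "\<exists>z. 0 < Im z \<and> surj_at z" and surj_lower: "\<exists>z. Im z < 0 \<and> surj_at z"
begin

lemma surj_nonreal: "Im z \<noteq> 0 \<Longrightarrow> surj_at z"
  using surj_upper surj_lower surj_half_plane[of _ z] by (metis linorder_neqE_linordered_idom mult_neg_neg mult_pos_pos)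

text \<open>For real z the bound survives a move to w = z + i e, because ||(A - z) f|| <= ||(A - w)
  f||. At the nonreal point w surjectivity is known, and the step back to z has length e.\<close>

lemma surj_bounded_below:
  assumes C: "\<And>f g. (f, g) \<in> A \<Longrightarrow> L2_norm M f \<le> C * L2_norm M (\<lambda>x. g x - z * f x)"
  shows "surj_at z"
proof (cases "Im z = 0")
  case True
  \<comment> \<open>Small enough for \<open>\<bar>C\<bar> * e < 1\<close>, the contraction condition
    for the step from w to z.\<close>
  define e where "e = 1 / (2 * (\<bar>C\<bar> + 1))"
  define w where "w = z + \<i> * of_real e"
  have e: "0 < e" "\<bar>C\<bar> * e < 1" by (auto simp: e_def field_simps)
  have w: "Re w = Re z" "Im w = e" "complex_of_real (Re z) = z" "cmod (z - w) = e"
    using True e by (auto simp: w_def complex_eq_iff norm_mult)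
  show ?thesis
  proof (rule surj_step)
    show "surj_at w" using surj_nonreal[of w] w e by simp
    show "L2_norm M f \<le> \<bar>C\<bar> * L2_norm M (\<lambda>x. g x - w * f x)" if "(f, g) \<in> A" for f g
    proof -
      have "L2_norm M f \<le> C * L2_norm M (\<lambda>x. g x - z * f x)" by (rule C[OF that])
      also have "\<dots> \<le> \<bar>C\<bar> * L2_norm M (\<lambda>x. g x - z * f x)" by (intro mult_right_mono) auto
      also have "\<dots> \<le> \<bar>C\<bar> * L2_norm M (\<lambda>x. g x - w * f x)"
        using norm_shift_ge_real[OF that, of w] by (intro mult_left_mono) (auto simp: w)
      finally show ?thesis .
    qed
  qed (use w e in auto)
qed (rule surj_nonreal)

text \<open>For selfadjoint operators a lower bound for A - z already yields surjectivity. From here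
  on, spectral questions are questions about inequalities only.\<close>

lemma resolvent_set_iff:
  "z \<in> resolvent_set M A \<longleftrightarrow> (\<exists>C. \<forall>(f, g)\<in>A. L2_norm M f \<le> C * L2_norm M (\<lambda>x. g x - z * f x))"
  unfolding resolvent_set_def mem_Collect_eq surj_at_iff[symmetric]
  using surj_bounded_below[of _ z] by blast

lemma resolvent_surj: "z \<in> resolvent_set M A \<Longrightarrow> surj_at z"
  by (simp add: resolvent_set_def surj_at_iff)

lemma resolvent_bound:
  assumes "z \<in> resolvent_set M A"
  obtains C where "0 < C" "\<And>f g. (f, g) \<in> A \<Longrightarrow> L2_norm M f \<le> C * L2_norm M (\<lambda>x. g x - z * f x)"
proof -
  from assms obtain C where C: "\<And>f g. (f, g) \<in> A \<Longrightarrow> L2_norm M f \<le> C * L2_norm M (\<lambda>x. g x - z * f x)"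
    unfolding resolvent_set_iff by blast
  show thesis
  proof (rule that)
    show "0 < \<bar>C\<bar> + 1" by simp
    show "L2_norm M f \<le> (\<bar>C\<bar> + 1) * L2_norm M (\<lambda>x. g x - z * f x)" if "(f, g) \<in> A" for f g
      using C[OF that] by (rule order_trans) (intro mult_right_mono; simp)
  qed
qed

lemma spectrum_real:
  assumes "z \<in> spectrum M A" shows "Im z = 0"
proof (rule ccontr)
  assume *: "Im z \<noteq> 0"
  have "L2_norm M f \<le> 1 / \<bar>Im z\<bar> * L2_norm M (\<lambda>x. g x - z * f x)" if "(f, g) \<in> A" for f g
    using norm_shift_ge[OF that, of z] * by (simp add: field_simps)
  then have "z \<in> resolvent_set M A" unfolding resolvent_set_iff by blast
  then show False using assms by (simp add: spectrum_def)
qed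

lemma spectrum_approx:
  assumes "z \<in> spectrum M A" "0 < e"
  obtains f g where "(f, g) \<in> A" "L2_norm M f = 1" "L2_norm M (\<lambda>x. g x - z * f x) < e"
proof -
  from assms(1) have "\<not> (\<forall>(f, g)\<in>A. L2_norm M f \<le> 1 / e * L2_norm M (\<lambda>x. g x - z * f x))"
    unfolding spectrum_def resolvent_set_iff Compl_iff by blast
  then obtain f g where fg: "(f, g) \<in> A" "1 / e * L2_norm M (\<lambda>x. g x - z * f x) < L2_norm M f"
    unfolding not_le[symmetric] by blast
  define n where "n = L2_norm M f"
  have "0 \<le> 1 / e * L2_norm M (\<lambda>x. g x - z * f x)" using assms(2) by simp
  then have n: "0 < n" using fg(2) unfolding n_def by linarith
  let ?c = "complex_of_real (1 / n)"
  show thesis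
  proof (rule that)
    show "(\<lambda>x. ?c * f x, \<lambda>x. ?c * g x) \<in> A" by (rule graph_scale[OF fg(1)])
    show "L2_norm M (\<lambda>x. ?c * f x) = 1" using n by (simp only: L2_norm_scale norm_of_real) (simp add: n_def[symmetric])
    have "(\<lambda>x. ?c * g x - z * (?c * f x)) = (\<lambda>x. ?c * (g x - z * f x))" by (simp add: algebra_simps)
    then have "L2_norm M (\<lambda>x. ?c * g x - z * (?c * f x)) = L2_norm M (\<lambda>x. g x - z * f x) / n"
      using n by (simp only: L2_norm_scale norm_of_real) simp
    also have "\<dots> < e" using fg(2) n assms(2) by (simp add: n_def[symmetric] field_simps)
    finally show "L2_norm M (\<lambda>x. ?c * g x - z * (?c * f x)) < e" .
  qed
qed

lemma spectrumI:
  assumes "\<And>e. 0 < e \<Longrightarrow> \<exists>(f, g)\<in>A. L2_norm M f = 1 \<and> L2_norm M (\<lambda>x. g x - z * f x) < e"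
  shows "z \<in> spectrum M A"
proof (rule ccontr)
  assume "z \<notin> spectrum M A"
  then obtain C where C: "0 < C" "\<And>f g. (f, g) \<in> A \<Longrightarrow> L2_norm M f \<le> C * L2_norm M (\<lambda>x. g x - z * f x)"
    using resolvent_bound[of z] by (auto simp: spectrum_def)
  then obtain f g where "(f, g) \<in> A" "L2_norm M f = 1" "L2_norm M (\<lambda>x. g x - z * f x) < 1 / C"
    using assms[of "1 / C"] by auto
  with C show False by (fastforce simp: field_simps)
qed

text \<open>Surjectivity of A - i provides h with (A - i) h = g - i f. The bound for A - i gives F n
  -> h, so h = f almost everywhere and the pair (f, g) lies in the graph by saturation.\<close>

lemma graph_closed:
  assumes FG: "\<And>n. (F n, G n) \<in> A" and f: "f \<in> L2 M" "(\<lambda>n. L2_norm M (\<lambda>x. F n x - f x)) \<longlonglongrightarrow> 0"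
    and g: "g \<in> L2 M" "(\<lambda>n. L2_norm M (\<lambda>x. G n x - g x)) \<longlonglongrightarrow> 0"
  shows "(f, g) \<in> A"
proof -
  have L2: "F n \<in> L2 M" "G n \<in> L2 M" for n using graph_L2[OF FG] by auto
  let ?k = "\<lambda>x. g x - \<i> * f x"
  have k: "?k \<in> L2 M" using f g by simp
  have "surj_at \<i>" by (rule surj_nonreal) simp
  then obtain h where h: "(h, \<lambda>x. ?k x + \<i> * h x) \<in> A"
    using bspec[OF _ k] unfolding surj_at_def by blast
  have hL: "h \<in> L2 M" using graph_L2[OF h] by auto
  have est: "L2_norm M (\<lambda>x. F n x - h x) \<le> L2_norm M (\<lambda>x. G n x - g x) + L2_norm M (\<lambda>x. F n x - f x)" for n
  proof -
    have "L2_norm M (\<lambda>x. F n x - h x) \<le> L2_norm M (\<lambda>x. (G n x - (?k x + \<i> * h x)) - \<i> * (F n x - h x))"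
      using norm_shift_ge[OF graph_diff[OF FG[of n] h], where z="\<i>"] by simp
    also have "\<dots> = L2_norm M (\<lambda>x. (G n x - g x) - \<i> * (F n x - f x))" by (simp add: algebra_simps)
    also have "\<dots> \<le> L2_norm M (\<lambda>x. G n x - g x) + L2_norm M (\<lambda>x. \<i> * (F n x - f x))"
      using L2 f g by (intro L2_norm_diff_triangle) auto
    finally show ?thesis by (simp add: L2_norm_scale)
  qed
  have "L2_norm M (\<lambda>x. f x - h x) \<le> 0"
  proof (rule LIMSEQ_le_const)
    show "(\<lambda>n. L2_norm M (\<lambda>x. F n x - f x) + (L2_norm M (\<lambda>x. G n x - g x) + L2_norm M (\<lambda>x. F n x - f x))) \<longlonglongrightarrow> 0"
      using tendsto_add[OF f(2) tendsto_add[OF g(2) f(2)]] by simp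
    have "L2_norm M (\<lambda>x. f x - h x) \<le> L2_norm M (\<lambda>x. F n x - f x) + (L2_norm M (\<lambda>x. G n x - g x) + L2_norm M (\<lambda>x. F n x - f x))" for n
      using L2_norm_triangle3[OF f(1) L2(1)[of n] hL] est[of n] by (simp add: L2_norm_commute[of M f])
    then show "\<exists>N. \<forall>n\<ge>N. L2_norm M (\<lambda>x. f x - h x) \<le> L2_norm M (\<lambda>x. F n x - f x) + (L2_norm M (\<lambda>x. G n x - g x) + L2_norm M (\<lambda>x. F n x - f x))" by blast
  qed
  then have "L2_norm M (\<lambda>x. f x - h x) = 0" by (simp add: antisym)
  then have ae: "AE x in M. f x - h x = 0" using f hL by (subst (asm) L2_norm_eq_0_iff) auto
  show ?thesis
  proof (rule graph_AE[OF h f(1) g(1)])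
    show "AE x in M. h x = f x" using ae by eventually_elim simp
    show "AE x in M. ?k x + \<i> * h x = g x" using ae by eventually_elim simp
  qed
qed

end

section \<open>Inequalities from a gap in the spectrum\<close>

context selfadjoint_op
begin

text \<open>
  If \<open>B = (A - c)\<^sup>-\<^sup>1\<close> has norm \<open>\<beta>\<close> and \<open>w\<close> almost attains it, then \<open>(B\<^sup>2 - \<beta>\<^sup>2) w\<close> is small, so one of
  \<open>(B \<plusminus> \<beta>) B w\<close> is an approximate eigenvector of \<open>A\<close> for \<open>c \<plusminus> 1 / \<beta>\<close>.
\<close>

lemma resolvent_interval_bound:
  assumes r: "0 < r" and res: "\<And>t. \<bar>t - c\<bar> < r \<Longrightarrow> complex_of_real t \<in> resolvent_set M A"
    and fg: "(f, g) \<in> A"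
  shows "r * L2_norm M f \<le> L2_norm M (\<lambda>x. g x - complex_of_real c * f x)"
proof -
  let ?c = "complex_of_real c"
  obtain C where C: "0 < C" "\<And>f g. (f, g) \<in> A \<Longrightarrow> L2_norm M f \<le> C * L2_norm M (\<lambda>x. g x - ?c * f x)"
    using resolvent_bound[OF res[of c]] r by auto
  \<comment> \<open>The norms ||B k|| with ||k|| <= 1, where B = (A - c)^(-1), phrased through graph
    elements. Their supremum \<open>\<beta>\<close> is the operator norm of B.\<close>
  define S where "S = {L2_norm M f |f g. (f, g) \<in> A \<and> L2_norm M (\<lambda>x. g x - ?c * f x) \<le> 1}"
  define \<beta> where "\<beta> = Sup S"
  have bdd: "bdd_above S"
  proof (rule bdd_aboveI[where M=C])
    fix y assume "y \<in> S"
    then obtain f g where *: "(f, g) \<in> A" "L2_norm M (\<lambda>x. g x - ?c * f x) \<le> 1" "y = L2_norm M f" by (auto simp: S_def)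
    then show "y \<le> C" using C(2)[OF *(1)] mult_left_mono[OF *(2) less_imp_le[OF C(1)]] by simp
  qed
  have ne: "S \<noteq> {}"
    using graph_scale[OF fg, of 0] by (auto simp: S_def intro!: exI[of _ "\<lambda>x. 0"])
  have le: "L2_norm M f \<le> \<beta> * L2_norm M (\<lambda>x. g x - ?c * f x)" if "(f, g) \<in> A" for f g
  proof (cases "L2_norm M (\<lambda>x. g x - ?c * f x) = 0")
    case True then show ?thesis using C(2)[OF that] by simp
  next
    case False
    define n where "n = L2_norm M (\<lambda>x. g x - ?c * f x)"
    have n: "0 < n" using False by (simp add: n_def less_le)
    let ?s = "complex_of_real (1 / n)"
    have "(\<lambda>x. ?s * g x - ?c * (?s * f x)) = (\<lambda>x. ?s * (g x - ?c * f x))" by (simp add: algebra_simps)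
    then have "L2_norm M (\<lambda>x. ?s * g x - ?c * (?s * f x)) = 1"
      using n by (simp only: L2_norm_scale norm_of_real) (simp add: n_def[symmetric])
    then have "L2_norm M (\<lambda>x. ?s * f x) \<in> S"
      using graph_scale[OF that, of ?s] unfolding S_def by force
    then have "L2_norm M (\<lambda>x. ?s * f x) \<le> \<beta>" unfolding \<beta>_def by (rule cSup_upper[OF _ bdd])
    moreover have "L2_norm M (\<lambda>x. ?s * f x) = L2_norm M f / n"
      using n by (simp only: L2_norm_scale norm_of_real) simp
    ultimately have "L2_norm M f / n \<le> \<beta>" by (simp only:)
    then show ?thesis using n by (simp add: n_def[symmetric] field_simps)
  qed
  have "\<beta> \<le> 1 / r"
  proof (rule ccontr)
    assume "\<not> \<beta> \<le> 1 / r"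
    then have br: "1 / r < \<beta>" by simp
    then have b: "0 < \<beta>" using r by (smt (verit) divide_pos_pos)
    \<comment> \<open>Under the contrary assumption 1 / \<open>\<beta>\<close> is less than r, so
      both c + m and c - m lie in the resolvent set. One of them would have to be a spectral point;
      the bounds \<open>K1\<close> and \<open>K2\<close> there lead to the contradiction.\<close>
    define m where "m = 1 / \<beta>"
    have m: "0 < m" "m < r" "m * \<beta> = 1" using b br r by (auto simp: m_def field_simps)
    obtain K1 where K1: "0 < K1" "\<And>f g. (f, g) \<in> A \<Longrightarrow> L2_norm M f \<le> K1 * L2_norm M (\<lambda>x. g x - complex_of_real (c + m) * f x)"
      using resolvent_bound[OF res[of "c + m"]] m by auto
    obtain K2 where K2: "0 < K2" "\<And>f g. (f, g) \<in> A \<Longrightarrow> L2_norm M f \<le> K2 * L2_norm M (\<lambda>x. g x - complex_of_real (c - m) * f x)"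
      using resolvent_bound[OF res[of "c - m"]] m by auto
    define K where "K = K1 + K2"
    have K: "0 < K" using K1 K2 by (simp add: K_def)
    \<comment> \<open>Chosen so that 2 K m e is exactly the square of \<open>\<beta>\<close>. The
      choice of \<open>\<eta>\<close> then guarantees both \<open>\<delta> \<le> e\<close> and ||y||
      > \<open>\<beta>\<close> / 2.\<close>
    define e where "e = \<beta>\<^sup>2 / (2 * K * m)"
    have e: "0 < e" using b K m by (simp add: e_def)
    define \<eta> where "\<eta> = min (\<beta> / 2) (e\<^sup>2 / (4 * \<beta>^3))"
    have eta: "0 < \<eta>" "\<eta> \<le> \<beta> / 2" "\<eta> \<le> e\<^sup>2 / (4 * \<beta>^3)" using b e by (auto simp: \<eta>_def)
    have "\<exists>s\<in>S. \<beta> - \<eta> < s" using eta(1) less_cSup_iff[OF ne bdd, of "\<beta> - \<eta>"] by (simp add: \<beta>_def)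
    then obtain y gy where y: "(y, gy) \<in> A" "L2_norm M (\<lambda>x. gy x - ?c * y x) \<le> 1" "\<beta> - \<eta> < L2_norm M y"
      by (auto simp: S_def)
    define w where "w x = gy x - ?c * y x" for x
    have yL: "y \<in> L2 M" "gy \<in> L2 M" using graph_L2[OF y(1)] by auto
    have w: "w \<in> L2 M" "L2_norm M w \<le> 1" using y yL by (auto simp: w_def[abs_def])
    obtain x where x: "(x, \<lambda>t. y t + ?c * x t) \<in> A"
      using resolvent_surj[OF res[of c]] yL r by (auto simp: surj_at_def)
    have xL: "x \<in> L2 M" using graph_L2[OF x] by auto
    \<comment> \<open>Here y = B w and x = B y, so \<open>\<delta>\<close> is the defect ||(B^2 -
      \<open>\<beta>\<close>^2) w||. Its square is expanded with <x, w> = ||y||^2, which is the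
      symmetry of B.\<close>
    define \<delta> where "\<delta> = L2_norm M (\<lambda>t. x t - complex_of_real (\<beta>\<^sup>2) * w t)"
    have "\<delta>\<^sup>2 \<le> e\<^sup>2"
    proof -
      have "ip M (\<lambda>t. y t + ?c * x t) y = ip M x gy" by (rule symmetric[OF x y(1)])
      then have "ip M x w = ip M y y"
        using xL yL by (simp add: w_def[abs_def] ip_linear algebra_simps)
      then have ipxw: "Re (ip M x w) = (L2_norm M y)\<^sup>2" by (simp add: ip_self)
      have xy: "L2_norm M x \<le> \<beta> * L2_norm M y" using le[OF x] by simp
      have "\<delta>\<^sup>2 = (L2_norm M x)\<^sup>2 - 2 * \<beta>\<^sup>2 * (L2_norm M y)\<^sup>2 + \<beta>^4 * (L2_norm M w)\<^sup>2"
        using L2_norm_scale_add[OF xL w(1), of "- (\<beta>\<^sup>2)"] by (simp add: \<delta>_def ipxw)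
      also have "\<dots> \<le> (\<beta> * L2_norm M y)\<^sup>2 - 2 * \<beta>\<^sup>2 * (L2_norm M y)\<^sup>2 + \<beta>^4 * 1"
        using xy w(2) by (intro add_mono diff_mono mult_left_mono power_mono order_refl) (auto simp: power_le_one)
      also have "\<dots> = \<beta>\<^sup>2 * (\<beta>\<^sup>2 - (L2_norm M y)\<^sup>2)" by (simp add: algebra_simps power2_eq_square power4_eq_xxxx)
      also have "\<dots> \<le> \<beta>\<^sup>2 * (\<beta>\<^sup>2 - (\<beta> - \<eta>)\<^sup>2)"
        using y(3) eta b by (intro mult_left_mono diff_mono power_mono order_refl) auto
      also have "\<dots> \<le> \<beta>\<^sup>2 * (2 * \<beta> * \<eta>)" by (intro mult_left_mono) (auto simp: power2_eq_square algebra_simps)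
      also have "\<dots> \<le> \<beta>\<^sup>2 * (2 * \<beta> * (e\<^sup>2 / (4 * \<beta>^3)))" using eta b by (intro mult_left_mono) auto
      also have "\<dots> \<le> e\<^sup>2" using b e by (simp add: field_simps power2_eq_square power3_eq_cube)
      finally show ?thesis .
    qed
    then have de: "\<delta> \<le> e" using e power2_le_imp_le[of \<delta> e] by simp
    \<comment> \<open>For each sign s the vector x + s \<open>\<beta>\<close> y satisfies (A - (c +
      s m)) (x + s \<open>\<beta>\<close> y) = - s m (x - \<open>\<beta>\<close>^2 w). Its residual
      is m \<open>\<delta>\<close>, and the resolvent bounds make the vector itself small.\<close>
    have h: "L2_norm M (\<lambda>t. x t + complex_of_real (s * \<beta>) * y t) \<le> K * (m * \<delta>)" if s: "s = 1 \<or> s = -1" for s :: real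
    proof -
      have "(\<lambda>t. x t + complex_of_real (s * \<beta>) * y t, \<lambda>t. (y t + ?c * x t) + complex_of_real (s * \<beta>) * gy t) \<in> A"
        by (rule graph_lincomb[OF x y(1)])
      note * = this
      have eq: "(\<lambda>t. ((y t + ?c * x t) + complex_of_real (s * \<beta>) * gy t) - complex_of_real (c + s * m) * (x t + complex_of_real (s * \<beta>) * y t))
         = (\<lambda>t. - (of_real (s * m)) * (x t - complex_of_real (\<beta>\<^sup>2) * w t))"
      proof
        fix t
        define S B m' where "S = complex_of_real s" and "B = complex_of_real \<beta>" and "m' = complex_of_real m"
        have ss: "S * S = 1" using s by (auto simp: S_def)
        have mb: "m' * B = 1" using m(3) by (metis of_real_1 of_real_mult m'_def B_def)
        have "((y t + ?c * x t) + (S * B) * gy t) - (?c + S * m') * (x t + (S * B) * y t)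
          = y t + S * B * w t - S * m' * x t - (S * S) * (m' * B) * y t"
          by (simp add: w_def algebra_simps)
        also have "\<dots> = S * B * w t - S * m' * x t" by (simp add: ss mb)
        also have "\<dots> = S * (m' * B) * B * w t - S * m' * x t" by (simp add: mb)
        also have "\<dots> = - (S * m') * (x t - B\<^sup>2 * w t)" by (simp add: algebra_simps power2_eq_square)
        finally show "((y t + ?c * x t) + complex_of_real (s * \<beta>) * gy t) - complex_of_real (c + s * m) * (x t + complex_of_real (s * \<beta>) * y t)
          = - (of_real (s * m)) * (x t - complex_of_real (\<beta>\<^sup>2) * w t)"
          by (simp add: S_def B_def m'_def)
      qed
      have "L2_norm M (\<lambda>t. x t + complex_of_real (s * \<beta>) * y t) \<le> K * L2_norm M (\<lambda>t. - (of_real (s * m)) * (x t - complex_of_real (\<beta>\<^sup>2) * w t))"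
      proof (cases "s = 1")
        case True
        have "L2_norm M (\<lambda>t. x t + complex_of_real (s * \<beta>) * y t) \<le> K1 * L2_norm M (\<lambda>t. - (of_real (s * m)) * (x t - complex_of_real (\<beta>\<^sup>2) * w t))"
          using K1(2)[OF *] eq True by simp
        also have "\<dots> \<le> K * L2_norm M (\<lambda>t. - (of_real (s * m)) * (x t - complex_of_real (\<beta>\<^sup>2) * w t))"
          using K2(1) by (intro mult_right_mono) (auto simp: K_def)
        finally show ?thesis .
      next
        case False
        then have s1: "s = -1" using s by simp
        have "L2_norm M (\<lambda>t. x t + complex_of_real (s * \<beta>) * y t) \<le> K2 * L2_norm M (\<lambda>t. - (of_real (s * m)) * (x t - complex_of_real (\<beta>\<^sup>2) * w t))"
          using K2(2)[OF *] eq s1 by simp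
        also have "\<dots> \<le> K * L2_norm M (\<lambda>t. - (of_real (s * m)) * (x t - complex_of_real (\<beta>\<^sup>2) * w t))"
          using K1(1) by (intro mult_right_mono) (auto simp: K_def)
        finally show ?thesis .
      qed
      also have "L2_norm M (\<lambda>t. - (of_real (s * m)) * (x t - complex_of_real (\<beta>\<^sup>2) * w t)) = m * \<delta>"
        using m s by (simp only: L2_norm_scale \<delta>_def norm_minus_cancel norm_of_real) auto
      finally show ?thesis .
    qed
    \<comment> \<open>The two small vectors differ by 2 \<open>\<beta>\<close> y, which is not small
      because ||y|| > \<open>\<beta>\<close> / 2.\<close>
    have "2 * \<beta> * L2_norm M y = L2_norm M (\<lambda>t. complex_of_real (2 * \<beta>) * y t)"
      using b by (simp only: L2_norm_scale norm_of_real)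
    also have "(\<lambda>t. complex_of_real (2 * \<beta>) * y t) = (\<lambda>t. (x t + complex_of_real (1 * \<beta>) * y t) - (x t + complex_of_real (-1 * \<beta>) * y t))"
      by (auto simp: algebra_simps)
    also have "L2_norm M \<dots> \<le> L2_norm M (\<lambda>t. x t + complex_of_real (1 * \<beta>) * y t) + L2_norm M (\<lambda>t. x t + complex_of_real (-1 * \<beta>) * y t)"
      using xL yL by (intro L2_norm_diff_triangle L2_add L2_scale)
    also have "\<dots> \<le> K * (m * \<delta>) + K * (m * \<delta>)" using h[of 1] h[of "-1"] by (intro add_mono) auto
    also have "\<dots> \<le> K * (m * e) + K * (m * e)" using de K m by (intro add_mono mult_left_mono) auto
    also have "\<dots> = \<beta>\<^sup>2" using K m by (simp add: e_def field_simps)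
    finally have "2 * \<beta> * L2_norm M y \<le> \<beta>\<^sup>2" .
    moreover have "\<beta>\<^sup>2 < 2 * \<beta> * L2_norm M y"
    proof -
      have "\<beta> / 2 < L2_norm M y" using y(3) eta(2) by simp
      then have "2 * \<beta> * (\<beta> / 2) < 2 * \<beta> * L2_norm M y" using b by (intro mult_strict_left_mono) auto
      then show ?thesis by (simp add: power2_eq_square)
    qed
    ultimately show False by simp
  qed
  then have "L2_norm M f \<le> 1 / r * L2_norm M (\<lambda>x. g x - ?c * f x)"
    by (intro order_trans[OF le[OF fg]] mult_right_mono) auto
  then show ?thesis using r by (simp add: field_simps)
qed

end

context selfadjoint_op
begin

text \<open>The resolvent bound is applied at the midpoints l - d/2 and l + d/2 of the two gaps,
  with radius d/2. Expanding the square, the terms in ||f||^2 cancel. In spectral terms, every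
  spectral value t of A - l is 0 or has |t| >= d, so d |t| <= t^2.\<close>

lemma isolated_form_bound:
  assumes d: "0 < d" and res: "\<And>t. 0 < \<bar>t - l\<bar> \<Longrightarrow> \<bar>t - l\<bar> < d \<Longrightarrow> complex_of_real t \<in> resolvent_set M A"
    and fg: "(f, g) \<in> A"
  shows "d * \<bar>Re (ip M (\<lambda>x. g x - complex_of_real l * f x) f)\<bar> \<le> (L2_norm M (\<lambda>x. g x - complex_of_real l * f x))\<^sup>2"
proof -
  define T where "T x = g x - complex_of_real l * f x" for x
  have L2: "f \<in> L2 M" "g \<in> L2 M" "T \<in> L2 M" using graph_L2[OF fg] by (auto simp: T_def[abs_def])
  have "- s * d * Re (ip M T f) \<le> (L2_norm M T)\<^sup>2" if s: "s = 1 \<or> s = -1" for s :: real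
  proof -
    let ?c = "l - s * (d / 2)"
    have "d / 2 * L2_norm M f \<le> L2_norm M (\<lambda>x. g x - complex_of_real ?c * f x)"
    proof (rule resolvent_interval_bound[OF _ _ fg])
      fix t assume "\<bar>t - ?c\<bar> < d / 2"
      then show "complex_of_real t \<in> resolvent_set M A" using s d by (intro res) (auto simp: abs_real_def split: if_splits)
    qed (use d in simp)
    also have "(\<lambda>x. g x - complex_of_real ?c * f x) = (\<lambda>x. T x + complex_of_real (s * (d / 2)) * f x)"
      by (simp add: T_def algebra_simps)
    finally have "(d / 2 * L2_norm M f)\<^sup>2 \<le> (L2_norm M (\<lambda>x. T x + complex_of_real (s * (d / 2)) * f x))\<^sup>2"
      using d by (intro power_mono) auto
    also have "\<dots> = (L2_norm M T)\<^sup>2 + 2 * (s * (d / 2)) * Re (ip M T f) + (s * (d / 2))\<^sup>2 * (L2_norm M f)\<^sup>2"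
      by (rule L2_norm_scale_add[OF L2(3,1)])
    finally show ?thesis using s by (auto simp: power_mult_distrib power_divide)
  qed
  from this[of 1] this[of "-1"] d show ?thesis by (auto simp: T_def[symmetric] T_def[abs_def, symmetric] abs_real_def split: if_splits)
qed

text \<open>Polarisation of the form bound. It is applied to f + s f' and f - s f'; adding the two
  estimates removes the mixed term on the right, and the free scale s is optimised at the
  end.\<close>

lemma isolated_sesquilinear_bound:
  assumes d: "0 < d" and res: "\<And>t. 0 < \<bar>t - l\<bar> \<Longrightarrow> \<bar>t - l\<bar> < d \<Longrightarrow> complex_of_real t \<in> resolvent_set M A"
    and fg: "(f, g) \<in> A" and fg': "(f', g') \<in> A"
  shows "d * \<bar>Re (ip M f (\<lambda>x. g' x - complex_of_real l * f' x))\<bar>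
    \<le> L2_norm M (\<lambda>x. g x - complex_of_real l * f x) * L2_norm M (\<lambda>x. g' x - complex_of_real l * f' x)"
proof -
  define T where "T x = g x - complex_of_real l * f x" for x
  define T' where "T' x = g' x - complex_of_real l * f' x" for x
  define b where "b = Re (ip M f T')"
  have L2: "f \<in> L2 M" "g \<in> L2 M" "f' \<in> L2 M" "g' \<in> L2 M" using graph_L2[OF fg] graph_L2[OF fg'] by auto
  have TL: "T \<in> L2 M" "T' \<in> L2 M" using L2 by (auto simp: T_def[abs_def] T'_def[abs_def])
  have sym: "ip M T f' = ip M f T'"
    using symmetric[OF fg fg'] L2 by (simp add: T_def[abs_def] T'_def[abs_def] ip_linear)
  then have b': "b = Re (ip M T f')" by (simp add: b_def)
  have b'': "b = Re (ip M T' f)" by (simp add: b_def ip_commute[of M T'])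
  have sq: "d * \<bar>Re (ip M (\<lambda>x. T x + complex_of_real s * T' x) (\<lambda>x. f x + complex_of_real s * f' x))\<bar>
      \<le> (L2_norm M (\<lambda>x. T x + complex_of_real s * T' x))\<^sup>2" for s
  proof -
    have "(\<lambda>x. g x + complex_of_real s * g' x - complex_of_real l * (f x + complex_of_real s * f' x)) = (\<lambda>x. T x + complex_of_real s * T' x)"
      by (simp add: T_def T'_def algebra_simps)
    then show ?thesis using isolated_form_bound[where l=l, OF d res graph_lincomb[OF fg fg', of "complex_of_real s"]] by simp
  qed
  have form: "Re (ip M (\<lambda>x. T x + complex_of_real s * T' x) (\<lambda>x. f x + complex_of_real s * f' x))
      = Re (ip M T f) + 2 * s * b + s\<^sup>2 * Re (ip M T' f')" for s
    using L2 TL by (simp add: ip_linear b'[symmetric] b''[symmetric] power2_eq_square algebra_simps)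
  have key: "2 * d * \<bar>s * b\<bar> \<le> (L2_norm M T)\<^sup>2 + s\<^sup>2 * (L2_norm M T')\<^sup>2" for s
  proof -
    have plus: "d * \<bar>Re (ip M T f) + 2 * s * b + s\<^sup>2 * Re (ip M T' f')\<bar> 
        \<le> (L2_norm M T)\<^sup>2 + 2 * s * Re (ip M T T') + s\<^sup>2 * (L2_norm M T')\<^sup>2"
      using sq[of s] unfolding form L2_norm_scale_add[OF TL] .
    have minus: "d * \<bar>Re (ip M T f) - 2 * s * b + s\<^sup>2 * Re (ip M T' f')\<bar> 
        \<le> (L2_norm M T)\<^sup>2 - 2 * s * Re (ip M T T') + s\<^sup>2 * (L2_norm M T')\<^sup>2"
      using sq[of "-s"] unfolding form L2_norm_scale_add[OF TL] by simp
    define P where "P = Re (ip M T f) + s\<^sup>2 * Re (ip M T' f')"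
    \<comment> \<open>Isolates the mixed term on the left: the diagonal part \<open>P\<close> enters
      both estimates with the same sign and drops out by the triangle inequality.\<close>
    have "4 * \<bar>s * b\<bar> \<le> \<bar>P + 2 * (s * b)\<bar> + \<bar>P - 2 * (s * b)\<bar>" by arith
    then have "d * (4 * \<bar>s * b\<bar>) \<le> d * \<bar>P + 2 * (s * b)\<bar> + d * \<bar>P - 2 * (s * b)\<bar>"
      using d by (simp flip: distrib_left)
    moreover have "d * \<bar>P + 2 * (s * b)\<bar> = d * \<bar>Re (ip M T f) + 2 * s * b + s\<^sup>2 * Re (ip M T' f')\<bar>"
      "d * \<bar>P - 2 * (s * b)\<bar> = d * \<bar>Re (ip M T f) - 2 * s * b + s\<^sup>2 * Re (ip M T' f')\<bar>"
      by (simp_all add: P_def algebra_simps)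
    ultimately show ?thesis using plus minus by simp
  qed
  show ?thesis
  proof (cases "L2_norm M T = 0 \<or> L2_norm M T' = 0")
    case True
    then have "b = 0"
    proof
      assume *: "L2_norm M T = 0"
      have "\<bar>b\<bar> \<le> cmod (ip M T f')" unfolding b' by (rule abs_Re_le_cmod)
      also have "\<dots> \<le> 0" using ip_norm_le[OF TL(1) L2(3)] * by simp
      finally show ?thesis by simp
    next
      assume *: "L2_norm M T' = 0"
      have "\<bar>b\<bar> \<le> cmod (ip M f T')" unfolding b_def by (rule abs_Re_le_cmod)
      also have "\<dots> \<le> 0" using ip_norm_le[OF L2(1) TL(2)] * by simp
      finally show ?thesis by simp
    qed
    then have "Re (ip M f (\<lambda>x. g' x - complex_of_real l * f' x)) = 0" by (simp add: b_def T'_def[abs_def])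
    then show ?thesis by simp
  next
    case False
    define t where "t = L2_norm M T"
    define t' where "t' = L2_norm M T'"
    have t: "0 < t" "0 < t'" using False by (auto simp: t_def t'_def less_le)
    \<comment> \<open>The value s = t / t' makes the two terms on the right equal, so their sum
      becomes twice the product t t' after division by s.\<close>
    have "2 * d * (t / t' * \<bar>b\<bar>) \<le> t\<^sup>2 + (t / t')\<^sup>2 * t'\<^sup>2"
      using key[of "t / t'"] t by (simp add: t_def[symmetric] t'_def[symmetric] abs_mult)
    then have "d * \<bar>b\<bar> \<le> t * t'" using t by (simp add: power_divide field_simps power2_eq_square)
    then show ?thesis by (simp add: b_def t_def t'_def T_def[abs_def] T'_def[abs_def])
  qed
qed

text \<open>
  The projection of \<open>u\<close> onto the kernel of \<open>A - l\<close> is obtained as the limit of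
  \<open>- i \<epsilon> (A - l - i \<epsilon>)\<^sup>-\<^sup>1 u\<close>; isolatedness makes this family Cauchy.
\<close>

lemma isolated_dist_eigenspace:
  assumes d: "0 < d" and res: "\<And>t. 0 < \<bar>t - l\<bar> \<Longrightarrow> \<bar>t - l\<bar> < d \<Longrightarrow> complex_of_real t \<in> resolvent_set M A"
    and ug: "(u, gu) \<in> A"
  shows "\<exists>h\<in>eigenspace M A (complex_of_real l). h \<in> L2 M \<and>
    d * L2_norm M (\<lambda>x. u x - h x) \<le> L2_norm M (\<lambda>x. gu x - complex_of_real l * u x)"
proof -
  let ?l = "complex_of_real l"
  have uL: "u \<in> L2 M" "gu \<in> L2 M" using graph_L2[OF ug] by auto
  define \<epsilon> where "\<epsilon> n = 1 / real (Suc n)" for n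
  have e: "0 < \<epsilon> n" for n by (simp add: \<epsilon>_def)
  have elim: "\<epsilon> \<longlonglongrightarrow> 0" unfolding \<epsilon>_def by (rule LIMSEQ_Suc[OF lim_1_over_n])
  define z where "z n = ?l + \<i> * complex_of_real (\<epsilon> n)" for n
  have z: "Re (z n) = l" "Im (z n) = \<epsilon> n" for n by (auto simp: z_def)
  have "\<forall>n. \<exists>f. (f, \<lambda>x. u x + z n * f x) \<in> A"
    using surj_nonreal uL e unfolding surj_at_def by (metis z(2) less_irrefl)
  then obtain f where f: "\<And>n. (f n, \<lambda>x. u x + z n * f n x) \<in> A" by metis
  have fL: "f n \<in> L2 M" for n using graph_L2[OF f] by auto
  \<comment> \<open>On the kernel of A - l the operator i \<open>\<epsilon>\<close> (A - l - i
    \<open>\<epsilon>\<close>)^(-1) acts as -1, so \<open>G n\<close> approximates minus the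
    projection of u onto that kernel.\<close>
  define G where "G n x = \<i> * complex_of_real (\<epsilon> n) * f n x" for n x
  have GL: "G n \<in> L2 M" for n by (simp add: G_def[abs_def] fL)
  have Tf: "(\<lambda>x. u x + z n * f n x - ?l * f n x) = (\<lambda>x. u x + G n x)" for n
    by (simp add: z_def G_def algebra_simps)
  have uG: "(\<lambda>x. u x + G n x) \<in> L2 M" for n using uL GL by simp
  have uG_le: "L2_norm M (\<lambda>x. u x + G n x) \<le> L2_norm M u" for n
    using norm_shift_ge_real[OF f[of n], where z="z n"] by (simp add: z Tf)
  have GA: "(G n, \<lambda>x. \<i> * complex_of_real (\<epsilon> n) * (u x + z n * f n x)) \<in> A" for n
    unfolding G_def by (rule graph_scale[OF f])
  have TG: "(\<lambda>x. \<i> * complex_of_real (\<epsilon> n) * (u x + z n * f n x) - ?l * G n x) = (\<lambda>x. \<i> * complex_of_real (\<epsilon> n) * (u x + G n x))" for n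
    by (simp add: z_def G_def algebra_simps)
  define U where "U = (L2_norm M u)\<^sup>2"
  \<comment> \<open>With T = A - l, u + G k equals T (f k), and T (G n - G m) is of order
    \<open>\<epsilon> n + \<epsilon> m\<close>. The sesquilinear bound therefore makes the product
    small without any control of ||f k||, which may blow up.\<close>
  have pair: "d * \<bar>Re (ip M (\<lambda>x. G n x - G m x) (\<lambda>x. u x + G k x))\<bar> \<le> (\<epsilon> n + \<epsilon> m) * U" for n m k
  proof -
    have "(\<lambda>x. \<i> * complex_of_real (\<epsilon> n) * (u x + z n * f n x) - \<i> * complex_of_real (\<epsilon> m) * (u x + z m * f m x) - ?l * (G n x - G m x))
      = (\<lambda>x. \<i> * complex_of_real (\<epsilon> n) * (u x + G n x) - \<i> * complex_of_real (\<epsilon> m) * (u x + G m x))"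
      using fun_cong[OF TG[of n]] fun_cong[OF TG[of m]] by (auto simp: fun_eq_iff algebra_simps)
    then have "d * \<bar>Re (ip M (\<lambda>x. G n x - G m x) (\<lambda>x. u x + G k x))\<bar>
      \<le> L2_norm M (\<lambda>x. \<i> * complex_of_real (\<epsilon> n) * (u x + G n x) - \<i> * complex_of_real (\<epsilon> m) * (u x + G m x)) * L2_norm M (\<lambda>x. u x + G k x)"
      using isolated_sesquilinear_bound[where l=l, OF d res graph_diff[OF GA[of n] GA[of m]] f[of k]] by (simp add: Tf)
    also have "\<dots> \<le> ((\<epsilon> n + \<epsilon> m) * L2_norm M u) * L2_norm M u"
    proof (rule mult_mono[OF _ uG_le])
      have "L2_norm M (\<lambda>x. \<i> * complex_of_real (\<epsilon> n) * (u x + G n x) - \<i> * complex_of_real (\<epsilon> m) * (u x + G m x))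
        \<le> L2_norm M (\<lambda>x. \<i> * complex_of_real (\<epsilon> n) * (u x + G n x)) + L2_norm M (\<lambda>x. \<i> * complex_of_real (\<epsilon> m) * (u x + G m x))"
        by (intro L2_norm_diff_triangle L2_scale uG)
      also have "\<dots> = \<epsilon> n * L2_norm M (\<lambda>x. u x + G n x) + \<epsilon> m * L2_norm M (\<lambda>x. u x + G m x)"
        using e[of n] e[of m] by (simp add: L2_norm_scale norm_mult)
      also have "\<dots> \<le> \<epsilon> n * L2_norm M u + \<epsilon> m * L2_norm M u"
        using e[of n] e[of m] uG_le by (intro add_mono mult_left_mono) auto
      finally show "L2_norm M (\<lambda>x. \<i> * complex_of_real (\<epsilon> n) * (u x + G n x) - \<i> * complex_of_real (\<epsilon> m) * (u x + G m x)) \<le> (\<epsilon> n + \<epsilon> m) * L2_norm M u"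
        by (simp add: distrib_right)
    qed (use e[of n] e[of m] in auto)
    finally show ?thesis by (simp add: U_def power2_eq_square mult.assoc)
  qed
  have cau: "d * (L2_norm M (\<lambda>x. G n x - G m x))\<^sup>2 \<le> 2 * ((\<epsilon> n + \<epsilon> m) * U)" for n m
  proof -
    let ?D = "\<lambda>x. G n x - G m x"
    \<comment> \<open>G n - G m is itself the difference of u + G n and u + G m, both in the range
      of T, so its squared norm reduces to two products of the form just estimated.\<close>
    have "ip M ?D ?D = ip M ?D (\<lambda>x. u x + G n x) - ip M ?D (\<lambda>x. u x + G m x)"
      using uL GL by (simp add: ip_linear)
    then have "(L2_norm M ?D)\<^sup>2 = Re (ip M ?D (\<lambda>x. u x + G n x)) - Re (ip M ?D (\<lambda>x. u x + G m x))"
      by (metis ip_self Re_complex_of_real minus_complex.simps(1))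
    then have "(L2_norm M ?D)\<^sup>2 \<le> \<bar>Re (ip M ?D (\<lambda>x. u x + G n x))\<bar> + \<bar>Re (ip M ?D (\<lambda>x. u x + G m x))\<bar>" by simp
    then have "d * (L2_norm M ?D)\<^sup>2 \<le> d * \<bar>Re (ip M ?D (\<lambda>x. u x + G n x))\<bar> + d * \<bar>Re (ip M ?D (\<lambda>x. u x + G m x))\<bar>"
      using d by (simp flip: distrib_left)
    then show ?thesis using pair[of n m n] pair[of n m m] by simp
  qed
  have "\<exists>G'\<in>L2 M. (\<lambda>n. L2_norm M (\<lambda>x. G n x - G' x)) \<longlonglongrightarrow> 0"
  proof (rule L2_complete[OF GL])
    fix \<eta> :: real assume eta: "0 < \<eta>"
    have lim: "(\<lambda>n. 4 * (\<epsilon> n * U)) \<longlonglongrightarrow> 0" using tendsto_mult_right_zero[OF tendsto_mult_left_zero[OF elim]] .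
    have "0 < d * \<eta>\<^sup>2" using d eta by simp
    from LIMSEQ_D[OF lim this] obtain N where N: "\<And>n. n \<ge> N \<Longrightarrow> norm (4 * (\<epsilon> n * U) - 0) < d * \<eta>\<^sup>2" by blast
    have "L2_norm M (\<lambda>x. G m x - G n x) < \<eta>" if "m \<ge> N" "n \<ge> N" for m n
    proof -
      have "d * (L2_norm M (\<lambda>x. G m x - G n x))\<^sup>2 \<le> 2 * (\<epsilon> m * U) + 2 * (\<epsilon> n * U)"
        using cau[of m n] by (simp add: distrib_right)
      also have "\<dots> < d * \<eta>\<^sup>2" using N[OF that(1)] N[OF that(2)] by simp
      finally have "(L2_norm M (\<lambda>x. G m x - G n x))\<^sup>2 < \<eta>\<^sup>2" using d by simp
      then show ?thesis using eta by (simp add: power2_less_imp_less)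
    qed
    then show "\<exists>N. \<forall>m\<ge>N. \<forall>n\<ge>N. L2_norm M (\<lambda>x. G m x - G n x) < \<eta>" by blast
  qed
  then obtain G' where G': "G' \<in> L2 M" and lim: "(\<lambda>n. L2_norm M (\<lambda>x. G n x - G' x)) \<longlonglongrightarrow> 0" by blast
  have G'A: "(G', \<lambda>x. ?l * G' x) \<in> A"
  proof (rule graph_closed[OF GA G' lim])
    show "(\<lambda>x. ?l * G' x) \<in> L2 M" using G' by simp
    show "(\<lambda>n. L2_norm M (\<lambda>x. \<i> * complex_of_real (\<epsilon> n) * (u x + z n * f n x) - ?l * G' x)) \<longlonglongrightarrow> 0"
    proof (rule Lim_null_comparison[OF always_eventually])
      show "\<forall>n. norm (L2_norm M (\<lambda>x. \<i> * complex_of_real (\<epsilon> n) * (u x + z n * f n x) - ?l * G' x))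
        \<le> \<epsilon> n * L2_norm M u + \<bar>l\<bar> * L2_norm M (\<lambda>x. G n x - G' x)"
      proof
        fix n
        have "(\<lambda>x. \<i> * complex_of_real (\<epsilon> n) * (u x + z n * f n x) - ?l * G' x) = (\<lambda>x. \<i> * complex_of_real (\<epsilon> n) * (u x + G n x) + ?l * (G n x - G' x))"
          using fun_cong[OF TG[of n]] by (auto simp: fun_eq_iff algebra_simps)
        then have "L2_norm M (\<lambda>x. \<i> * complex_of_real (\<epsilon> n) * (u x + z n * f n x) - ?l * G' x)
          \<le> L2_norm M (\<lambda>x. \<i> * complex_of_real (\<epsilon> n) * (u x + G n x)) + L2_norm M (\<lambda>x. ?l * (G n x - G' x))"
          using uG GL G' by (simp only:) (intro L2_norm_triangle L2_scale L2_diff)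
        also have "\<dots> = \<epsilon> n * L2_norm M (\<lambda>x. u x + G n x) + \<bar>l\<bar> * L2_norm M (\<lambda>x. G n x - G' x)"
          using e[of n] by (simp add: L2_norm_scale norm_mult)
        also have "\<dots> \<le> \<epsilon> n * L2_norm M u + \<bar>l\<bar> * L2_norm M (\<lambda>x. G n x - G' x)"
          using e[of n] uG_le by simp
        finally show "norm (L2_norm M (\<lambda>x. \<i> * complex_of_real (\<epsilon> n) * (u x + z n * f n x) - ?l * G' x))
        \<le> \<epsilon> n * L2_norm M u + \<bar>l\<bar> * L2_norm M (\<lambda>x. G n x - G' x)" by simp
      qed
      show "(\<lambda>n. \<epsilon> n * L2_norm M u + \<bar>l\<bar> * L2_norm M (\<lambda>x. G n x - G' x)) \<longlonglongrightarrow> 0"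
        using tendsto_add[OF tendsto_mult_left_zero[OF elim] tendsto_mult_right_zero[OF lim]] by simp
    qed
  qed
  \<comment> \<open>G' lies in the kernel of T and u + G n in the range of T, and these are
    orthogonal by symmetry.\<close>
  have orth: "ip M G' (\<lambda>x. u x + G n x) = 0" for n
  proof -
    have "ip M (\<lambda>x. ?l * G' x) (f n) = ip M G' (\<lambda>x. u x + z n * f n x)" by (rule symmetric[OF G'A f])
    also have "(\<lambda>x. u x + z n * f n x) = (\<lambda>x. (u x + G n x) + ?l * f n x)"
      using fun_cong[OF Tf[of n]] by (auto simp: fun_eq_iff algebra_simps)
    finally show ?thesis using G' fL uG by (simp add: ip_linear del: L2_add)
  qed
  define v where "v x = u x + G' x" for x
  have vL: "v \<in> L2 M" using uL G' by (simp add: v_def[abs_def])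
  have vlim: "(\<lambda>n. L2_norm M (\<lambda>x. (u x + G n x) - v x)) \<longlonglongrightarrow> 0" using lim by (simp add: v_def)
  have "(\<lambda>n. ip M G' (\<lambda>x. u x + G n x)) \<longlonglongrightarrow> ip M G' v" by (rule ip_tendsto_right[OF uG vL G' vlim])
  then have G'v: "ip M G' v = 0" unfolding orth by (simp add: LIMSEQ_const_iff)
  \<comment> \<open>Limit of the sesquilinear bound for u and f n, where T (f n) = u + G n tends to
    v. Since v is orthogonal to G', the left side is d ||v||^2, and v = u + G' is the difference of
    u and its projection.\<close>
  have "d * \<bar>Re (ip M u v)\<bar> \<le> L2_norm M (\<lambda>x. gu x - ?l * u x) * L2_norm M v"
  proof (rule LIMSEQ_le)
    show "(\<lambda>n. d * \<bar>Re (ip M u (\<lambda>x. u x + G n x))\<bar>) \<longlonglongrightarrow> d * \<bar>Re (ip M u v)\<bar>"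
      by (intro tendsto_mult tendsto_const tendsto_rabs tendsto_Re ip_tendsto_right[OF uG vL uL(1) vlim])
    show "(\<lambda>n. L2_norm M (\<lambda>x. gu x - ?l * u x) * L2_norm M (\<lambda>x. u x + G n x)) \<longlonglongrightarrow> L2_norm M (\<lambda>x. gu x - ?l * u x) * L2_norm M v"
      by (intro tendsto_mult tendsto_const L2_norm_tendsto[OF uG vL vlim])
    show "\<exists>N. \<forall>n\<ge>N. d * \<bar>Re (ip M u (\<lambda>x. u x + G n x))\<bar> \<le> L2_norm M (\<lambda>x. gu x - ?l * u x) * L2_norm M (\<lambda>x. u x + G n x)"
      using isolated_sesquilinear_bound[where l=l, OF d res ug f] by (simp add: Tf)
  qed
  moreover have "ip M u v = ip M v v"
    using uL G' G'v vL by (subst (2) v_def[abs_def]) (simp add: ip_linear)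
  then have "Re (ip M u v) = (L2_norm M v)\<^sup>2" by (simp add: ip_self)
  ultimately have "d * L2_norm M v * L2_norm M v \<le> L2_norm M (\<lambda>x. gu x - ?l * u x) * L2_norm M v"
    by (simp add: power2_eq_square mult.assoc)
  then have "d * L2_norm M v \<le> L2_norm M (\<lambda>x. gu x - ?l * u x)"
    by (cases "L2_norm M v = 0") (auto simp: less_le mult_le_cancel_right)
  \<comment> \<open>The sign is due to \<open>G n\<close> approximating minus the
    projection.\<close>
  moreover have "(\<lambda>x. - G' x) \<in> eigenspace M A ?l"
    using graph_scale[OF G'A, of "-1"] by (auto simp: eigenspace_def intro!: exI[of _ "\<lambda>x. - (?l * G' x)"])
  ultimately show ?thesis
    using G' by (intro bexI[of _ "\<lambda>x. - G' x"]) (auto simp: v_def[abs_def])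
qed

section \<open>Criteria for belonging to the essential spectrum\<close>

lemma not_isolated_imp_accumulates:
  assumes "\<not> complex_of_real l isolated_in spectrum M A" "complex_of_real l \<in> spectrum M A" "0 < e"
  obtains t where "complex_of_real t \<in> spectrum M A" "0 < \<bar>t - l\<bar>" "\<bar>t - l\<bar> < e"
proof -
  from assms obtain y where y: "y \<in> spectrum M A" "dist (complex_of_real l) y < e" "y \<noteq> complex_of_real l"
    unfolding isolated_in_dist_Ex_iff by blast
  define t where "t = Re y"
  have yt: "y = complex_of_real t" using spectrum_real[OF y(1)] by (simp add: t_def complex_eq_iff)
  have "dist (complex_of_real l) y = \<bar>t - l\<bar>"
    unfolding yt dist_norm by (metis norm_of_real of_real_diff abs_minus_commute)
  then show thesis using that[of t] y yt by auto
qed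

lemma isolated_gap:
  assumes "complex_of_real l isolated_in spectrum M A"
  shows "\<exists>d>0. \<forall>t. 0 < \<bar>t - l\<bar> \<longrightarrow> \<bar>t - l\<bar> < d \<longrightarrow> complex_of_real t \<in> resolvent_set M A"
proof -
  from assms obtain d where d: "0 < d" "\<And>y. y \<in> spectrum M A \<Longrightarrow> dist (complex_of_real l) y < d \<Longrightarrow> y = complex_of_real l"
    unfolding isolated_in_dist_Ex_iff by blast
  show ?thesis
  proof (intro exI[of _ d] conjI d(1) allI impI)
    fix t assume t: "0 < \<bar>t - l\<bar>" "\<bar>t - l\<bar> < d"
    have "dist (complex_of_real l) (complex_of_real t) = \<bar>t - l\<bar>"
      unfolding dist_norm by (metis norm_of_real of_real_diff abs_minus_commute)
    with t d(2)[of "complex_of_real t"] show "complex_of_real t \<in> resolvent_set M A"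
      by (auto simp: spectrum_def)
  qed
qed

text \<open>If l were isolated, one approximate eigenvector would produce an eigenvector h, and a
  second one, almost orthogonal to h, would be close to some eigenvector k. One-dimensionality makes
  k a multiple of h, so the second vector would be almost orthogonal to itself. Hence orthogonality
  to a single prescribed h is enough in \<open>approx\<close>.\<close>

lemma essential_spectrumI:
  assumes one_dim: "\<And>f g. f \<in> eigenspace M A (complex_of_real l) \<Longrightarrow> g \<in> eigenspace M A (complex_of_real l) \<Longrightarrow>
      \<exists>a b. (a \<noteq> 0 \<or> b \<noteq> 0) \<and> (AE x in M. a * f x + b * g x = 0)"
    and approx: "\<And>e h. 0 < e \<Longrightarrow> h \<in> L2 M \<Longrightarrow>
      \<exists>(f, g)\<in>A. L2_norm M f = 1 \<and> L2_norm M (\<lambda>x. g x - complex_of_real l * f x) < e \<and> cmod (ip M f h) < e"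
  shows "complex_of_real l \<in> essential_spectrum M A"
proof -
  let ?l = "complex_of_real l"
  have spec: "?l \<in> spectrum M A"
    using approx[OF _ L2_zero] by (intro spectrumI) fast
  have "\<not> ?l isolated_in spectrum M A"
  proof
    assume iso: "?l isolated_in spectrum M A"
    obtain d where d: "0 < d" "\<And>t. 0 < \<bar>t - l\<bar> \<Longrightarrow> \<bar>t - l\<bar> < d \<Longrightarrow> complex_of_real t \<in> resolvent_set M A"
      using isolated_gap[OF iso] by blast
    obtain f0 g0 where f0: "(f0, g0) \<in> A" "L2_norm M f0 = 1" "L2_norm M (\<lambda>x. g0 x - ?l * f0 x) < d / 4"
      using spectrum_approx[OF spec, of "d / 4"] d(1) by auto
    obtain h where h: "h \<in> eigenspace M A ?l" "h \<in> L2 M" "d * L2_norm M (\<lambda>x. f0 x - h x) \<le> L2_norm M (\<lambda>x. g0 x - ?l * f0 x)"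
      using isolated_dist_eigenspace[where l=l, OF d f0(1)] by blast
    have "d * L2_norm M (\<lambda>x. f0 x - h x) < d * (1 / 4)" using h(3) f0(3) by simp
    then have "L2_norm M (\<lambda>x. f0 x - h x) < 1 / 4" using d(1) by simp
    then have hn: "3 / 4 < L2_norm M h"
      using L2_norm_reverse_triangle[of f0 M h] f0(2) h(2) graph_L2[OF f0(1)] by auto
    \<comment> \<open>The second approximate eigenvector is chosen after h; the bound d/4 on its
      residual puts it within 1/4 of the eigenspace.\<close>
    obtain f g where f: "(f, g) \<in> A" "L2_norm M f = 1" "L2_norm M (\<lambda>x. g x - ?l * f x) < min (d / 4) (1 / 4)" "cmod (ip M f h) < min (d / 4) (1 / 4)"
      using approx[OF _ h(2), of "min (d / 4) (1 / 4)"] d(1) by auto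
    have fL: "f \<in> L2 M" using graph_L2[OF f(1)] by auto
    obtain k where k: "k \<in> eigenspace M A ?l" "k \<in> L2 M" "d * L2_norm M (\<lambda>x. f x - k x) \<le> L2_norm M (\<lambda>x. g x - ?l * f x)"
      using isolated_dist_eigenspace[where l=l, OF d f(1)] by blast
    have "d * L2_norm M (\<lambda>x. f x - k x) < d * (1 / 4)" using k(3) f(3) by simp
    then have fk: "L2_norm M (\<lambda>x. f x - k x) < 1 / 4" using d(1) by simp
    obtain a b where ab: "a \<noteq> 0 \<or> b \<noteq> 0" "AE x in M. a * h x + b * k x = 0" using one_dim[OF h(1) k(1)] by blast
    have "b \<noteq> 0"
    proof
      assume b: "b = 0"
      with ab have "a \<noteq> 0" by simp
      have "AE x in M. h x = 0" using ab(2) by eventually_elim (use b \<open>a \<noteq> 0\<close> in simp)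
      then show False using hn h(2) by (simp flip: L2_norm_eq_0_iff)
    qed
    define c where "c = - a / b"
    have kc: "AE x in M. k x = c * h x"
      using ab(2) by eventually_elim (use \<open>b \<noteq> 0\<close> in \<open>simp add: c_def field_simps add_eq_0_iff2\<close>)
    have "L2_norm M k = L2_norm M (\<lambda>x. c * h x)"
      using k h kc by (intro L2_norm_AE_cong L2_measurable L2_scale)
    then have kn: "L2_norm M k = cmod c * L2_norm M h" by (simp add: L2_norm_scale)
    have "ip M f k = ip M f (\<lambda>x. c * h x)"
      using k h kc fL by (intro ip_cong_AE L2_measurable L2_scale) auto
    then have fk': "ip M f k = cnj c * ip M f h" by (simp add: ip_scale_right)
    have "L2_norm M k \<le> L2_norm M f + L2_norm M (\<lambda>x. f x - k x)"
      using L2_norm_reverse_triangle[OF fL k(2)] by linarith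
    then have "cmod c * L2_norm M h < 5 / 4" using fk f(2) kn by simp
    moreover have "cmod c * (3 / 4) \<le> cmod c * L2_norm M h" using hn by (intro mult_left_mono) auto
    ultimately have c: "cmod c < 5 / 3" by simp
    have "ip M f f = ip M f (\<lambda>x. f x - k x) + ip M f k" using fL k by (simp add: ip_linear)
    then have "complex_of_real 1 = ip M f (\<lambda>x. f x - k x) + cnj c * ip M f h" by (simp add: ip_self f(2) fk')
    then have "1 \<le> cmod (ip M f (\<lambda>x. f x - k x)) + cmod (cnj c * ip M f h)"
      by (metis norm_of_real abs_one norm_triangle_ineq)
    \<comment> \<open>The numbers close: ||k|| < 5/4 and ||h|| > 3/4 give |c| < 5/3, so the right
      side is below 1/4 + 5/12 < 1.\<close>
    also have "\<dots> \<le> L2_norm M f * L2_norm M (\<lambda>x. f x - k x) + cmod c * (1 / 4)"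
      unfolding norm_mult complex_mod_cnj
      using f(4) fL k by (intro add_mono ip_norm_le mult_left_mono) auto
    also have "\<dots> < 1" using fk c f(2) by simp
    finally show False by simp
  qed
  then show ?thesis using spec by (auto simp: essential_spectrum_def discrete_spectrum_def)
qed

text \<open>\<open>cpt\<close> is applied twice. For approximate eigenvectors at l it produces an
  eigenvector, so an essential l could only be an accumulation point of the spectrum. For
  approximate eigenvectors at spectral points t n -> l it produces a limit which is a normalised
  eigenvector at l, yet orthogonal to itself.\<close>

lemma not_essential_spectrumI:
  assumes fd: "L2_finite_dim M (eigenspace M A (complex_of_real l))"
    and cpt: "\<And>F G. \<lbrakk>\<And>n. (F n, G n) \<in> A; \<And>n. L2_norm M (F n) = 1;
        (\<lambda>n. L2_norm M (\<lambda>x. G n x - complex_of_real l * F n x)) \<longlonglongrightarrow> 0\<rbrakk> \<Longrightarrow>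
      \<exists>r :: nat \<Rightarrow> nat. strict_mono r \<and> (\<forall>e>0. \<exists>N. \<forall>m\<ge>N. \<forall>n\<ge>N. L2_norm M (\<lambda>x. F (r m) x - F (r n) x) < e)"
  shows "complex_of_real l \<notin> essential_spectrum M A"
proof
  let ?l = "complex_of_real l"
  assume ess: "?l \<in> essential_spectrum M A"
  then have spec: "?l \<in> spectrum M A" by (simp add: essential_spectrum_def)
  \<comment> \<open>Closedness of the graph turns the limit of a convergent subsequence into an
    eigenvector; the norm 1 survives, so it is not zero.\<close>
  have limit: "\<exists>f r. (f, \<lambda>x. ?l * f x) \<in> A \<and> L2_norm M f = 1 \<and> strict_mono (r :: nat \<Rightarrow> nat) \<and> (\<lambda>n. L2_norm M (\<lambda>x. F (r n) x - f x)) \<longlonglongrightarrow> 0"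
    if FG: "\<And>n. (F n, G n) \<in> A" and F1: "\<And>n. L2_norm M (F n) = 1"
      and lim: "(\<lambda>n. L2_norm M (\<lambda>x. G n x - ?l * F n x)) \<longlonglongrightarrow> 0" for F G
  proof -
    obtain r :: "nat \<Rightarrow> nat" where r: "strict_mono r" "\<And>e. e > 0 \<Longrightarrow> \<exists>N. \<forall>m\<ge>N. \<forall>n\<ge>N. L2_norm M (\<lambda>x. F (r m) x - F (r n) x) < e"
      using cpt[OF FG F1 lim] by blast
    have FL: "F n \<in> L2 M" "G n \<in> L2 M" for n using graph_L2[OF FG] by auto
    obtain f where f: "f \<in> L2 M" "(\<lambda>n. L2_norm M (\<lambda>x. F (r n) x - f x)) \<longlonglongrightarrow> 0"
      using L2_complete[of "\<lambda>n. F (r n)", OF FL(1) r(2)] by blast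
    have "(\<lambda>n. L2_norm M (F (r n))) \<longlonglongrightarrow> L2_norm M f" by (rule L2_norm_tendsto[OF FL(1) f])
    then have "L2_norm M f = 1" by (simp add: F1 LIMSEQ_const_iff)
    moreover have "(f, \<lambda>x. ?l * f x) \<in> A"
    proof (rule graph_closed[OF FG f])
      show "(\<lambda>x. ?l * f x) \<in> L2 M" using f by simp
      show "(\<lambda>n. L2_norm M (\<lambda>x. G (r n) x - ?l * f x)) \<longlonglongrightarrow> 0"
      proof (rule Lim_null_comparison[OF always_eventually])
        show "\<forall>n. norm (L2_norm M (\<lambda>x. G (r n) x - ?l * f x)) \<le> L2_norm M (\<lambda>x. G (r n) x - ?l * F (r n) x) + \<bar>l\<bar> * L2_norm M (\<lambda>x. F (r n) x - f x)"
        proof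
          fix n
          have "L2_norm M (\<lambda>x. ?l * F (r n) x - ?l * f x) = L2_norm M (\<lambda>x. ?l * (F (r n) x - f x))" by (simp add: algebra_simps)
          then have "L2_norm M (\<lambda>x. ?l * F (r n) x - ?l * f x) = \<bar>l\<bar> * L2_norm M (\<lambda>x. F (r n) x - f x)" by (simp only: L2_norm_scale norm_of_real)
          then show "norm (L2_norm M (\<lambda>x. G (r n) x - ?l * f x)) \<le> L2_norm M (\<lambda>x. G (r n) x - ?l * F (r n) x) + \<bar>l\<bar> * L2_norm M (\<lambda>x. F (r n) x - f x)"
            using L2_norm_triangle3[of "G (r n)" M "\<lambda>x. ?l * F (r n) x" "\<lambda>x. ?l * f x"] FL f by simp
        qed
        show "(\<lambda>n. L2_norm M (\<lambda>x. G (r n) x - ?l * F (r n) x) + \<bar>l\<bar> * L2_norm M (\<lambda>x. F (r n) x - f x)) \<longlonglongrightarrow> 0"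
          using tendsto_add[OF LIMSEQ_subseq_LIMSEQ[OF lim r(1)] tendsto_mult_right_zero[OF f(2)]] by (simp add: o_def)
      qed
    qed
    ultimately show ?thesis using r f by blast
  qed
  have "\<forall>n. \<exists>f g. (f, g) \<in> A \<and> L2_norm M f = 1 \<and> L2_norm M (\<lambda>x. g x - ?l * f x) < 1 / real (Suc n)"
    using spectrum_approx[OF spec] by (metis of_nat_0_less_iff zero_less_Suc zero_less_divide_1_iff)
  then obtain F G where FG: "\<And>n. (F n, G n) \<in> A" "\<And>n. L2_norm M (F n) = 1" "\<And>n. L2_norm M (\<lambda>x. G n x - ?l * F n x) < 1 / real (Suc n)"
    by metis
  have "(\<lambda>n. L2_norm M (\<lambda>x. G n x - ?l * F n x)) \<longlonglongrightarrow> 0"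
  proof (rule Lim_null_comparison[OF always_eventually])
    show "\<forall>n. norm (L2_norm M (\<lambda>x. G n x - ?l * F n x)) \<le> 1 / real (Suc n)" using FG(3) by (auto intro: less_imp_le)
    show "(\<lambda>n. 1 / real (Suc n)) \<longlonglongrightarrow> 0" by (rule LIMSEQ_Suc[OF lim_1_over_n])
  qed
  from limit[OF FG(1,2) this] obtain f where f: "(f, \<lambda>x. ?l * f x) \<in> A" "L2_norm M f = 1" by blast
  have ev: "eigenvalue M A ?l"
    unfolding eigenvalue_def
  proof (rule bexI)
    show "f \<in> eigenspace M A ?l" using f by (auto simp: eigenspace_def)
    show "\<not> (AE x in M. f x = 0)" using f graph_L2[OF f(1)] by (simp flip: L2_norm_eq_0_iff)
  qed
  have "\<not> ?l isolated_in spectrum M A" using ess ev fd by (auto simp: essential_spectrum_def discrete_spectrum_def)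
  from not_isolated_imp_accumulates[OF this spec]
  have "\<forall>n. \<exists>t. complex_of_real t \<in> spectrum M A \<and> 0 < \<bar>t - l\<bar> \<and> \<bar>t - l\<bar> < 1 / real (Suc n)"
    by (metis of_nat_0_less_iff zero_less_Suc zero_less_divide_1_iff)
  then obtain t where t: "\<And>n. complex_of_real (t n) \<in> spectrum M A" "\<And>n. 0 < \<bar>t n - l\<bar>" "\<And>n. \<bar>t n - l\<bar> < 1 / real (Suc n)"
    by metis
  \<comment> \<open>The residual is made small relative to |t n - l|, not just small: the
    orthogonality estimate below divides by this distance.\<close>
  have "\<exists>f g. (f, g) \<in> A \<and> L2_norm M f = 1 \<and> L2_norm M (\<lambda>x. g x - complex_of_real (t n) * f x) < \<bar>t n - l\<bar> / real (Suc n)" for n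
  proof -
    have "0 < \<bar>t n - l\<bar> / real (Suc n)" using t(2)[of n] by simp
    from spectrum_approx[OF t(1)[of n] this] show ?thesis by blast
  qed
  then obtain F G where FG: "\<And>n. (F n, G n) \<in> A" "\<And>n. L2_norm M (F n) = 1"
    "\<And>n. L2_norm M (\<lambda>x. G n x - complex_of_real (t n) * F n x) < \<bar>t n - l\<bar> / real (Suc n)"
    by metis
  have FL: "F n \<in> L2 M" "G n \<in> L2 M" for n using graph_L2[OF FG(1)] by auto
  have inv: "(\<lambda>n. 1 / real (Suc n)) \<longlonglongrightarrow> 0" by (rule LIMSEQ_Suc[OF lim_1_over_n])
  have "(\<lambda>n. L2_norm M (\<lambda>x. G n x - ?l * F n x)) \<longlonglongrightarrow> 0"
  proof (rule Lim_null_comparison[OF always_eventually])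
    show "\<forall>n. norm (L2_norm M (\<lambda>x. G n x - ?l * F n x)) \<le> 1 / real (Suc n) + 1 / real (Suc n)"
    proof
      fix n
      have "(\<lambda>x. G n x - ?l * F n x) = (\<lambda>x. (G n x - complex_of_real (t n) * F n x) + complex_of_real (t n - l) * F n x)"
        by (simp add: algebra_simps)
      then have "L2_norm M (\<lambda>x. G n x - ?l * F n x) \<le> L2_norm M (\<lambda>x. G n x - complex_of_real (t n) * F n x) + L2_norm M (\<lambda>x. complex_of_real (t n - l) * F n x)"
        using FL by (simp only:) (intro L2_norm_triangle L2_scale L2_diff)
      also have "L2_norm M (\<lambda>x. complex_of_real (t n - l) * F n x) = \<bar>t n - l\<bar>" using FG(2) by (simp only: L2_norm_scale norm_of_real) simp
      also have "L2_norm M (\<lambda>x. G n x - complex_of_real (t n) * F n x) \<le> \<bar>t n - l\<bar>"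
      proof -
        have "\<bar>t n - l\<bar> / real (Suc n) \<le> \<bar>t n - l\<bar>" 
            by (simp add: divide_le_eq mult_le_cancel_left1)
        then show ?thesis using FG(3)[of n] by simp
      qed
      finally show "norm (L2_norm M (\<lambda>x. G n x - ?l * F n x)) \<le> 1 / real (Suc n) + 1 / real (Suc n)"
        using t(3)[of n] by simp
    qed
    show "(\<lambda>n. 1 / real (Suc n) + 1 / real (Suc n)) \<longlonglongrightarrow> 0" using tendsto_add[OF inv inv] by simp
  qed
  from limit[OF FG(1,2) this] obtain f r where f: "(f, \<lambda>x. ?l * f x) \<in> A" "L2_norm M f = 1" and r: "strict_mono (r :: nat \<Rightarrow> nat)"
    and lim: "(\<lambda>n. L2_norm M (\<lambda>x. F (r n) x - f x)) \<longlonglongrightarrow> 0" by blast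
  have fL: "f \<in> L2 M" using graph_L2[OF f(1)] by auto
  \<comment> \<open>Approximate orthogonality of eigenvectors to different values: by symmetry (l -
    t n) <F n, f> equals the product of the residual at t n with f.\<close>
  have small: "cmod (ip M (F n) f) \<le> 1 / real (Suc n)" for n
  proof -
    have "ip M (G n) f = ip M (F n) (\<lambda>x. ?l * f x)" by (rule symmetric[OF FG(1) f(1)])
    then have "ip M (\<lambda>x. G n x - complex_of_real (t n) * F n x) f = complex_of_real (l - t n) * ip M (F n) f"
      using FL fL by (simp add: ip_linear left_diff_distrib)
    then have "cmod (complex_of_real (l - t n) * ip M (F n) f) = cmod (ip M (\<lambda>x. G n x - complex_of_real (t n) * F n x) f)" by simp
    also have "\<dots> \<le> L2_norm M (\<lambda>x. G n x - complex_of_real (t n) * F n x) * L2_norm M f"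
      using FL fL by (intro ip_norm_le) auto
    also have "\<dots> \<le> \<bar>t n - l\<bar> / real (Suc n)" using FG(3)[of n] f(2) by simp
    finally have "\<bar>t n - l\<bar> * cmod (ip M (F n) f) \<le> \<bar>t n - l\<bar> * (1 / real (Suc n))"
      by (simp only: norm_mult norm_of_real) (simp add: abs_minus_commute)
    then show ?thesis using t(2)[of n] by (simp only: mult_le_cancel_left_pos)
  qed
  have "(\<lambda>n. ip M (F (r n)) f) \<longlonglongrightarrow> ip M f f" by (rule ip_tendsto_left[OF FL(1) fL fL lim])
  moreover have "(\<lambda>n. ip M (F (r n)) f) \<longlonglongrightarrow> 0"
  proof (rule Lim_null_comparison[OF always_eventually])
    show "\<forall>n. cmod (ip M (F (r n)) f) \<le> 1 / real (Suc (r n))" using small by auto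
    show "(\<lambda>n. 1 / real (Suc (r n))) \<longlonglongrightarrow> 0" using LIMSEQ_subseq_LIMSEQ[OF inv r] by (simp add: o_def)
  qed
  ultimately have "ip M f f = 0" by (rule LIMSEQ_unique)
  then show False using f(2) by (simp add: ip_self)
qed

end

section \<open>Locally absolutely continuous functions\<close>

lemma bounded_mult_absolutely_integrable:
  fixes f g :: "real \<Rightarrow> complex"
  assumes "continuous_on {a..b} f" "g absolutely_integrable_on {a..b}"
  shows "(\<lambda>x. f x * g x) absolutely_integrable_on {a..b}"
proof (rule absolutely_integrable_bounded_measurable_product[where h="(*)", OF _ _ _ _ assms(2)])
  show "bilinear ((*) :: complex \<Rightarrow> complex \<Rightarrow> complex)"
    by (simp add: bilinear_conv_bounded_bilinear bounded_bilinear_mult)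
  show "f \<in> borel_measurable (lebesgue_on {a..b})"
    using assms(1) by (intro continuous_imp_measurable_on_sets_lebesgue) auto
  show "bounded (f ` {a..b})" using assms(1) by (intro compact_imp_bounded compact_continuous_image) auto
qed auto

lemma ac_deriv_on_subset: "ac_deriv_on J u v \<Longrightarrow> I \<subseteq> J \<Longrightarrow> ac_deriv_on I u v"
  unfolding ac_deriv_on_def by blast

lemma ac_deriv_on_Icc:
  assumes "ac_deriv_on I u v" "a \<in> I" "b \<in> I" "a \<le> b" "is_interval I"
  shows "ac_deriv_on {a..b} u v"
proof (rule ac_deriv_on_subset[OF assms(1)])
  show "{a..b} \<subseteq> I" using assms by (auto intro: mem_is_interval_1_I[of I a b])
qed

lemma ac_deriv_onD:
  assumes "ac_deriv_on I u v" "a \<in> I" "b \<in> I" "a \<le> b"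
  shows "v absolutely_integrable_on {a..b}" "v integrable_on {a..b}" "u b - u a = integral {a..b} v" "u b = u a + integral {a..b} v"
proof -
  show a: "v absolutely_integrable_on {a..b}" and i: "u b - u a = integral {a..b} v"
    using assms unfolding ac_deriv_on_def by auto
  show "v integrable_on {a..b}" using a by (simp add: absolutely_integrable_on_def)
  show "u b = u a + integral {a..b} v" by (simp flip: i)
qed

lemma ac_deriv_on_IccD:
  assumes "ac_deriv_on {a..b} u v" "a \<le> b"
  shows "v absolutely_integrable_on {a..b}" "v integrable_on {a..b}" "u b - u a = integral {a..b} v"
  using ac_deriv_onD[OF assms(1), of a b] assms(2) by auto

lemma ac_deriv_on_continuous_Icc:
  assumes "ac_deriv_on {a..b} u v" shows "continuous_on {a..b} u"
proof (cases "a \<le> b")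
  case True
  have "continuous_on {a..b} (\<lambda>x. u a + integral {a..x} v)"
    using ac_deriv_onD(2)[OF assms, of a b] True
    by (intro continuous_intros indefinite_integral_continuous_1) auto
  then show ?thesis
  proof (rule continuous_on_eq)
    fix x assume "x \<in> {a..b}"
    then show "u a + integral {a..x} v = u x" using ac_deriv_onD(4)[OF assms, of a x] by simp
  qed
qed simp

lemma ac_deriv_on_continuous:
  assumes "ac_deriv_on I u v" "is_interval I" shows "continuous_on I u"
  unfolding continuous_on_eq_continuous_within
proof
  fix x assume x: "x \<in> I"
  show "continuous (at x within I) u"
  proof (cases "\<exists>a\<in>I. a < x")
    case True
    then obtain a where a: "a \<in> I" "a < x" by blast
    show ?thesis
    proof (cases "\<exists>b\<in>I. x < b")
      case True
      then obtain b where b: "b \<in> I" "x < b" by blast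
      have "continuous_on {a..b} u" using ac_deriv_on_Icc[OF assms(1) a(1) b(1) _ assms(2)] a b ac_deriv_on_continuous_Icc by force
      then have "continuous (at x) u" using a b by (intro continuous_on_interior[of "{a..b}"]) auto
      then show ?thesis by (rule continuous_at_imp_continuous_at_within)
    next
      case False
      have "continuous_on {a..x} u" using ac_deriv_on_Icc[OF assms(1) a(1) x _ assms(2)] a ac_deriv_on_continuous_Icc by force
      then have "continuous (at x within {a..x}) u" using a by (simp add: continuous_on_eq_continuous_within)
      moreover have "at x within I = at x within {a..x}"
      proof (rule at_within_nhd)
        show "I \<inter> {a<..} - {x} = {a..x} \<inter> {a<..} - {x}"
          using False a mem_is_interval_1_I[OF assms(2) a(1) x] by force
      qed (use a in auto)
      ultimately show ?thesis by simp
    qed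
  next
    case no: False
    show ?thesis
    proof (cases "\<exists>b\<in>I. x < b")
      case True
      then obtain b where b: "b \<in> I" "x < b" by blast
      have "continuous_on {x..b} u" using ac_deriv_on_Icc[OF assms(1) x b(1) _ assms(2)] b ac_deriv_on_continuous_Icc by force
      then have "continuous (at x within {x..b}) u" using b by (simp add: continuous_on_eq_continuous_within)
      moreover have "at x within I = at x within {x..b}"
      proof (rule at_within_nhd)
        show "I \<inter> {..<b} - {x} = {x..b} \<inter> {..<b} - {x}"
          using no b mem_is_interval_1_I[OF assms(2) x b(1)] by force
      qed (use b in auto)
      ultimately show ?thesis by simp
    next
      case False
      then have "I = {x}" using no x by (auto simp: not_less intro: antisym)
      then show ?thesis using continuous_on_sing[of x u] by (simp add: continuous_on_eq_continuous_within)
    qed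
  qed
qed

section \<open>Product rule, gluing and substitution\<close>

lemma ac_deriv_on_mult_increment:
  assumes u: "ac_deriv_on {a..b} u u1" and v: "ac_deriv_on {a..b} v v1"
    and cd: "a \<le> c" "c \<le> d" "d \<le> b"
    and osc: "\<And>s t. s \<in> {c..d} \<Longrightarrow> t \<in> {c..d} \<Longrightarrow> cmod (u s - u t) \<le> e"
      "\<And>s t. s \<in> {c..d} \<Longrightarrow> t \<in> {c..d} \<Longrightarrow> cmod (v s - v t) \<le> e"
  shows "cmod (u d * v d - u c * v c - integral {c..d} (\<lambda>t. u1 t * v t + u t * v1 t))
    \<le> integral {c..d} (\<lambda>t. e * (cmod (u1 t) + cmod (v1 t)))"
proof -
  have U: "ac_deriv_on {c..d} u u1" and V: "ac_deriv_on {c..d} v v1"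
    using u v cd by (auto elim!: ac_deriv_on_subset)
  note Ui = ac_deriv_on_IccD[OF U cd(2)] and Vi = ac_deriv_on_IccD[OF V cd(2)]
  have cont: "continuous_on {c..d} u" "continuous_on {c..d} v" using U V ac_deriv_on_continuous_Icc by auto
  have i1: "(\<lambda>t. v t * u1 t) integrable_on {c..d}" "(\<lambda>t. u t * v1 t) integrable_on {c..d}"
    using set_lebesgue_integral_eq_integral(1)[OF bounded_mult_absolutely_integrable[OF cont(2) Ui(1)]]
      set_lebesgue_integral_eq_integral(1)[OF bounded_mult_absolutely_integrable[OF cont(1) Vi(1)]] by auto
  have i1': "(\<lambda>t. u1 t * v t) integrable_on {c..d}" using i1(1) by (simp add: mult.commute)
  have i2: "(\<lambda>t. u1 t * v d) integrable_on {c..d}" "(\<lambda>t. u c * v1 t) integrable_on {c..d}"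
    using Ui(2) Vi(2) cd(2) by (auto intro: integrable_on_mult_left integrable_on_mult_right)
  have n1: "(\<lambda>t. cmod (u1 t)) integrable_on {c..d}" "(\<lambda>t. cmod (v1 t)) integrable_on {c..d}"
    using Ui(1) Vi(1) cd(2) by (auto simp: absolutely_integrable_on_def)
  have "u d * v d - u c * v c = (u d - u c) * v d + u c * (v d - v c)" by (simp add: algebra_simps)
  also have "\<dots> = integral {c..d} (\<lambda>t. u1 t * v d) + integral {c..d} (\<lambda>t. u c * v1 t)"
    using Ui Vi cd(2) by (simp add: integral_mult_left integral_mult_right)
  finally have "u d * v d - u c * v c - integral {c..d} (\<lambda>t. u1 t * v t + u t * v1 t)
     = integral {c..d} (\<lambda>t. (u1 t * v d + u c * v1 t) - (u1 t * v t + u t * v1 t))"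
    using i1 i1' i2 by (simp add: Henstock_Kurzweil_Integration.integral_add Henstock_Kurzweil_Integration.integral_diff integrable_add)
  also have "cmod \<dots> \<le> integral {c..d} (\<lambda>t. e * (cmod (u1 t) + cmod (v1 t)))"
  proof (rule integral_norm_bound_integral)
    show "(\<lambda>t. (u1 t * v d + u c * v1 t) - (u1 t * v t + u t * v1 t)) integrable_on {c..d}"
      using i1 i1' i2 by (intro integrable_diff integrable_add)
    show "(\<lambda>t. e * (cmod (u1 t) + cmod (v1 t))) integrable_on {c..d}"
      using n1 by (intro integrable_on_mult_right integrable_add)
    fix t assume t: "t \<in> {c..d}"
    have "(u1 t * v d + u c * v1 t) - (u1 t * v t + u t * v1 t) = u1 t * (v d - v t) + (u c - u t) * v1 t"
      by (simp add: algebra_simps)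
    then have "cmod ((u1 t * v d + u c * v1 t) - (u1 t * v t + u t * v1 t)) \<le> cmod (u1 t) * cmod (v d - v t) + cmod (u c - u t) * cmod (v1 t)"
      by (metis norm_mult norm_triangle_ineq)
    also have "\<dots> \<le> cmod (u1 t) * e + e * cmod (v1 t)"
      using osc t cd(2) by (intro add_mono mult_left_mono mult_right_mono) auto
    finally show "cmod ((u1 t * v d + u c * v1 t) - (u1 t * v t + u t * v1 t)) \<le> e * (cmod (u1 t) + cmod (v1 t))"
      by (simp add: algebra_simps)
  qed
  finally show ?thesis .
qed

text \<open>The product rule is obtained from the integral formulation alone, without pointwise
  derivatives: over a fine partition the errors of the single increments add up to e times the
  integral of |u1| + |v1|, and e is arbitrary.\<close>

lemma ac_deriv_on_mult_Icc:
  assumes u: "ac_deriv_on {a..b} u u1" and v: "ac_deriv_on {a..b} v v1" and ab: "a \<le> b"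
  shows "u b * v b - u a * v a = integral {a..b} (\<lambda>t. u1 t * v t + u t * v1 t)"
    and "(\<lambda>t. u1 t * v t + u t * v1 t) absolutely_integrable_on {a..b}"
proof -
  have cont: "continuous_on {a..b} u" "continuous_on {a..b} v" using u v ac_deriv_on_continuous_Icc by auto
  define w where "w t = u1 t * v t + u t * v1 t" for t
  define n where "n t = cmod (u1 t) + cmod (v1 t)" for t
  note Ui = ac_deriv_on_IccD[OF u ab] and Vi = ac_deriv_on_IccD[OF v ab]
  have "(\<lambda>t. v t * u1 t + u t * v1 t) absolutely_integrable_on {a..b}"
    using Ui Vi ab cont by (intro set_integral_add bounded_mult_absolutely_integrable) auto
  then show wi: "(\<lambda>t. u1 t * v t + u t * v1 t) absolutely_integrable_on {a..b}" by (simp add: mult.commute)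
  have wI: "w integrable_on {c..d}" if "a \<le> c" "d \<le> b" for c d
    unfolding w_def[abs_def] using that by (intro integrable_subinterval_real[OF set_lebesgue_integral_eq_integral(1)[OF wi]]) auto
  have nI: "n integrable_on {c..d}" if "a \<le> c" "d \<le> b" for c d
  proof (rule integrable_subinterval_real[where a=a and b=b])
    show "n integrable_on {a..b}" unfolding n_def[abs_def]
      using Ui(1) Vi(1) ab by (intro integrable_add) (auto simp: absolutely_integrable_on_def)
  qed (use that in auto)
  have "cmod (u b * v b - u a * v a - integral {a..b} w) \<le> e * integral {a..b} n" if e: "0 < e" for e
  proof -
    have "uniformly_continuous_on {a..b} u" "uniformly_continuous_on {a..b} v"
      using cont by (auto intro: compact_uniformly_continuous)
    note uc = this
    obtain d1 where d1': "0 < d1" and d1: "\<And>s t. s \<in> {a..b} \<Longrightarrow> t \<in> {a..b} \<Longrightarrow> dist s t < d1 \<Longrightarrow> dist (u s) (u t) < e"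
      using uniformly_continuous_onE[OF uc(1) e] by (metis dist_commute)
    obtain d2 where d2': "0 < d2" and d2: "\<And>s t. s \<in> {a..b} \<Longrightarrow> t \<in> {a..b} \<Longrightarrow> dist s t < d2 \<Longrightarrow> dist (v s) (v t) < e"
      using uniformly_continuous_onE[OF uc(2) e] by (metis dist_commute)
    note d = d1' d2'
    \<comment> \<open>The mesh (b - a) / N falls below both moduli of continuity, so u and v
      oscillate by less than e on each cell.\<close>
    obtain N :: nat where N: "(b - a) / min d1 d2 < real N" using reals_Archimedean2 by blast
    have "0 \<le> (b - a) / min d1 d2" using ab d by simp
    then have N0: "0 < real N" using N by linarith
    define w0 where "w0 = (b - a) / N"
    define x where "x k = a + real k * w0" for k
    have "(b - a) / N < min d1 d2" using N N0 d by (simp add: field_simps del: min_less_iff_conj)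
    then have h: "0 \<le> w0" "w0 < d1" "w0 < d2"
      using ab by (auto simp: w0_def)
    have Nw: "real N * w0 = b - a" using N0 by (simp add: w0_def)
    have "cmod (u (x k) * v (x k) - u a * v a - integral {a..x k} w) \<le> integral {a..x k} (\<lambda>t. e * n t)" if "k \<le> N" for k
      using that
    proof (induction k)
      case 0 then show ?case by (simp add: x_def)
    next
      case (Suc k)
      have xk: "a \<le> x k" using h by (simp add: x_def)
      have len: "x (Suc k) = x k + w0" by (simp add: x_def algebra_simps)
      have xk': "x k \<le> x (Suc k)" using h by (simp add: len)
      have "real (Suc k) * w0 \<le> real N * w0" using Suc h by (intro mult_right_mono) auto
      then have xb: "x (Suc k) \<le> b" using Nw by (simp add: x_def)
      have step: "cmod (u (x (Suc k)) * v (x (Suc k)) - u (x k) * v (x k) - integral {x k..x (Suc k)} w) \<le> integral {x k..x (Suc k)} (\<lambda>t. e * n t)"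
        unfolding w_def[abs_def] n_def
      proof (rule ac_deriv_on_mult_increment[OF u v xk xk' xb])
        fix s t assume st: "s \<in> {x k..x (Suc k)}" "t \<in> {x k..x (Suc k)}"
        then have "dist s t \<le> w0" unfolding len by (auto simp: dist_real_def abs_if)
        then have "dist s t < d1" "dist s t < d2" using h by auto
        moreover have "s \<in> {a..b}" "t \<in> {a..b}" using st xk xb by auto
        ultimately have "dist (u s) (u t) < e" "dist (v s) (v t) < e" using d1 d2 by auto
        then show "cmod (u s - u t) \<le> e" "cmod (v s - v t) \<le> e" by (auto simp: dist_norm)
      qed
      have c1: "integral {a..x (Suc k)} w = integral {a..x k} w + integral {x k..x (Suc k)} w"
        by (rule Henstock_Kurzweil_Integration.integral_combine[symmetric]) (use xk xk' xb wI in auto)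
      have c2: "integral {a..x (Suc k)} (\<lambda>t. e * n t) = integral {a..x k} (\<lambda>t. e * n t) + integral {x k..x (Suc k)} (\<lambda>t. e * n t)"
        by (rule Henstock_Kurzweil_Integration.integral_combine[symmetric]) (use xk xk' xb nI in \<open>auto intro: integrable_on_mult_right\<close>)
      have IH: "cmod (u (x k) * v (x k) - u a * v a - integral {a..x k} w) \<le> integral {a..x k} (\<lambda>t. e * n t)"
        using Suc by simp
      show ?case unfolding c1 c2 by (rule order_trans[OF _ norm_triangle_mono[OF IH step]]) (simp add: algebra_simps)
    qed
    from this[of N] show ?thesis by (simp add: x_def Nw)
  qed
  note small = this
  have "cmod (u b * v b - u a * v a - integral {a..b} w) \<le> 0"
  proof (rule field_le_epsilon)
    fix \<eta> :: real assume "0 < \<eta>"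
    define I where "I = integral {a..b} n"
    have I: "0 \<le> I" unfolding I_def by (intro integral_nonneg nI) (auto simp: n_def)
    \<comment> \<open>\<open>I + 1\<close> keeps the divisor positive when the integral
      \<open>I\<close> is zero.\<close>
    have "cmod (u b * v b - u a * v a - integral {a..b} w) \<le> \<eta> / (I + 1) * I"
      using small[of "\<eta> / (I + 1)"] \<open>0 < \<eta>\<close> I by (simp add: I_def)
    also have "\<dots> \<le> \<eta>" using \<open>0 < \<eta>\<close> I by (simp add: field_simps)
    finally show "cmod (u b * v b - u a * v a - integral {a..b} w) \<le> 0 + \<eta>" by simp
  qed
  then show "u b * v b - u a * v a = integral {a..b} (\<lambda>t. u1 t * v t + u t * v1 t)"
    by (simp add: w_def[abs_def])
qed

lemma ac_deriv_on_mult: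
  assumes u: "ac_deriv_on I u u1" and v: "ac_deriv_on I v v1" and I: "is_interval I"
  shows "ac_deriv_on I (\<lambda>x. u x * v x) (\<lambda>x. u1 x * v x + u x * v1 x)"
  unfolding ac_deriv_on_def
proof (intro ballI impI)
  fix a b assume ab: "a \<in> I" "b \<in> I" "a \<le> b"
  show "(\<lambda>x. u1 x * v x + u x * v1 x) absolutely_integrable_on {a..b} \<and>
      u b * v b - u a * v a = integral {a..b} (\<lambda>x. u1 x * v x + u x * v1 x)"
    using ac_deriv_on_mult_Icc[OF ac_deriv_on_Icc[OF u ab I] ac_deriv_on_Icc[OF v ab I] ab(3)] by simp
qed

lemma ac_deriv_on_add:
  assumes u: "ac_deriv_on I u u1" and v: "ac_deriv_on I v v1"
  shows "ac_deriv_on I (\<lambda>x. u x + v x) (\<lambda>x. u1 x + v1 x)"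
  unfolding ac_deriv_on_def
proof (intro ballI impI conjI)
  fix a b assume ab: "a \<in> I" "b \<in> I" "a \<le> b"
  note U = ac_deriv_onD[OF u ab] and V = ac_deriv_onD[OF v ab]
  show "(\<lambda>x. u1 x + v1 x) absolutely_integrable_on {a..b}" by (rule set_integral_add(1)[OF U(1) V(1)])
  have "integral {a..b} (\<lambda>x. u1 x + v1 x) = integral {a..b} u1 + integral {a..b} v1"
    by (rule Henstock_Kurzweil_Integration.integral_add[OF U(2) V(2)])
  also have "\<dots> = (u b - u a) + (v b - v a)" by (simp only: U(3) V(3))
  finally show "u b + v b - (u a + v a) = integral {a..b} (\<lambda>x. u1 x + v1 x)" by simp
qed

lemma ac_deriv_on_scale:
  assumes u: "ac_deriv_on I u u1"
  shows "ac_deriv_on I (\<lambda>x. c * u x) (\<lambda>x. c * u1 x)"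
  unfolding ac_deriv_on_def
proof (intro ballI impI conjI)
  fix a b assume ab: "a \<in> I" "b \<in> I" "a \<le> b"
  note U = ac_deriv_onD[OF u ab]
  show "(\<lambda>x. c * u1 x) absolutely_integrable_on {a..b}" by (rule set_integrable_mult_right) (rule U(1))
  have "c * u b - c * u a = c * (u b - u a)" by (simp add: algebra_simps)
  then show "c * u b - c * u a = integral {a..b} (\<lambda>x. c * u1 x)" by (simp only: U(3)) simp
qed

lemma ac_deriv_on_cnj:
  assumes u: "ac_deriv_on I u u1"
  shows "ac_deriv_on I (\<lambda>x. cnj (u x)) (\<lambda>x. cnj (u1 x))"
  unfolding ac_deriv_on_def
proof (intro ballI impI conjI)
  fix a b assume ab: "a \<in> I" "b \<in> I" "a \<le> b"
  note U = ac_deriv_onD[OF u ab]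
  show "(\<lambda>x. cnj (u1 x)) absolutely_integrable_on {a..b}"
    using absolutely_integrable_linear[OF U(1) bounded_linear_cnj] by (simp add: o_def)
  have "cnj (u b) - cnj (u a) = cnj (u b - u a)" by simp
  then show "cnj (u b) - cnj (u a) = integral {a..b} (\<lambda>x. cnj (u1 x))"
    by (simp only: U(3) Henstock_Kurzweil_Integration.integral_cnj)
qed

lemma ac_deriv_on_C1:
  assumes "\<And>x. x \<in> I \<Longrightarrow> (u has_vector_derivative u1 x) (at x within I)" "continuous_on I u1" "is_interval I"
  shows "ac_deriv_on I u u1"
  unfolding ac_deriv_on_def
proof (intro ballI impI)
  fix a b assume ab: "a \<in> I" "b \<in> I" "a \<le> b"
  have sub: "{a..b} \<subseteq> I" using ab assms(3) by (auto intro: mem_is_interval_1_I[of I a b])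
  have "(u1 has_integral (u b - u a)) {a..b}"
    using ab sub by (intro fundamental_theorem_of_calculus has_vector_derivative_within_subset[OF assms(1)]) auto
  then show "u1 absolutely_integrable_on {a..b} \<and> u b - u a = integral {a..b} u1"
    using continuous_on_subset[OF assms(2) sub] by (auto simp: integral_unique intro: absolutely_integrable_continuous_real)
qed

text \<open>Extension by zero across c. Since w vanishes at c itself there is no jump, so the two
  indefinite integrals join. Applied to w and then to its derivative, it extends cut-off functions
  from a half-line to the whole line.\<close>

lemma ac_deriv_on_glue:
  assumes "ac_deriv_on {c..} w w1" "\<And>x. x \<le> c \<Longrightarrow> w x = 0" "\<And>x. x \<le> c \<Longrightarrow> w1 x = 0"
  shows "ac_deriv_on UNIV w w1"
  unfolding ac_deriv_on_def
proof (intro ballI impI)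
  fix a b :: real assume ab: "a \<le> b"
  have left: "w1 absolutely_integrable_on {s..t} \<and> w t - w s = integral {s..t} w1" if "t \<le> c" "s \<le> t" for s t
  proof -
    have "w1 absolutely_integrable_on {s..t}"
      by (rule absolutely_integrable_spike[OF absolutely_integrable_zero negligible_empty]) (use that assms(3) in auto)
    moreover have "integral {s..t} w1 = integral {s..t} (\<lambda>x. 0)"
      by (rule integral_cong) (use that assms(3) in auto)
    ultimately show ?thesis using that assms(2) by simp
  qed
  have right: "w1 absolutely_integrable_on {s..t} \<and> w t - w s = integral {s..t} w1" if "c \<le> s" "s \<le> t" for s t
    using assms(1) that unfolding ac_deriv_on_def by auto
  consider "b \<le> c" | "c \<le> a" | "a \<le> c" "c \<le> b" by linarith
  then show "w1 absolutely_integrable_on {a..b} \<and> w b - w a = integral {a..b} w1"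
  proof cases
    case 3
    have i: "w1 absolutely_integrable_on {a..b}"
      by (rule absolutely_integrable_on_combine[where c=c]) (use left[of c a] right[of c b] 3 in auto)
    have "integral {a..c} w1 + integral {c..b} w1 = integral {a..b} w1"
      using 3 i by (intro Henstock_Kurzweil_Integration.integral_combine) (auto simp: absolutely_integrable_on_def)
    then show ?thesis using i left[of c a] right[of c b] 3 by (auto simp: algebra_simps)
  qed (use left right ab in auto)
qed

lemma ac_deriv_on_reflect:
  assumes "ac_deriv_on UNIV u v"
  shows "ac_deriv_on UNIV (\<lambda>x. u (- x)) (\<lambda>x. - v (- x))"
  unfolding ac_deriv_on_def
proof (intro ballI impI)
  fix a b :: real assume ab: "a \<le> b"
  note D = ac_deriv_onD[OF assms, of "-b" "-a"]
  have "(\<lambda>x. v (- x)) absolutely_integrable_on {a..b}"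
    using absolutely_integrable_reflect_real[where f=v and a="-b" and b="-a"] D(1) ab by simp
  then have "(\<lambda>x. - v (- x)) absolutely_integrable_on {a..b}" by (simp add: absolutely_integrable_on_def integrable_neg_iff)
  moreover have "integral {a..b} (\<lambda>x. v (- x)) = integral {-b..-a} v"
    using Henstock_Kurzweil_Integration.integral_reflect_real[where f=v and a="-b" and b="-a"] by simp
  ultimately show "(\<lambda>x. - v (- x)) absolutely_integrable_on {a..b} \<and> u (- b) - u (- a) = integral {a..b} (\<lambda>x. - v (- x))"
    using D(3) ab by (simp add: algebra_simps)
qed

text \<open>A strictly increasing substitution maps intervals onto intervals, so the integral of u1
  transforms by the change of variables formula. Positivity of \<open>\<phi>1\<close> removes the
  absolute value of the Jacobian.\<close>

lemma ac_deriv_on_compose: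
  assumes u: "ac_deriv_on I u u1" and phi: "\<And>x. x \<in> J \<Longrightarrow> (\<phi> has_real_derivative \<phi>1 x) (at x)"
    and pos: "\<And>x. x \<in> J \<Longrightarrow> 0 < \<phi>1 x" and sub: "\<phi> ` J \<subseteq> I" and J: "is_interval J"
  shows "ac_deriv_on J (\<lambda>x. u (\<phi> x)) (\<lambda>x. complex_of_real (\<phi>1 x) * u1 (\<phi> x))"
  unfolding ac_deriv_on_def
proof (intro ballI impI)
  fix a b assume ab: "a \<in> J" "b \<in> J" "a \<le> b"
  have sJ: "{a..b} \<subseteq> J" using ab J by (auto intro: mem_is_interval_1_I[of J a b])
  have mono: "\<phi> x < \<phi> y" if "x \<in> {a..b}" "y \<in> {a..b}" "x < y" for x y
  proof (rule DERIV_pos_imp_increasing[OF that(3)])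
    fix t assume "x \<le> t" "t \<le> y"
    then have "t \<in> J" using that sJ by auto
    then show "\<exists>y. (\<phi> has_real_derivative y) (at t) \<and> 0 < y" using phi pos by blast
  qed
  have inj: "inj_on \<phi> {a..b}" using mono by (intro linorder_inj_onI) force+
  have cont: "continuous_on {a..b} \<phi>" using sJ phi by (intro DERIV_continuous_on) (blast intro: has_field_derivative_at_within)
  have "\<phi> ` {a..b} = {\<phi> a..\<phi> b}"
  proof
    show "\<phi> ` {a..b} \<subseteq> {\<phi> a..\<phi> b}"
      using mono ab by (force simp: le_less)
    show "{\<phi> a..\<phi> b} \<subseteq> \<phi> ` {a..b}"
    proof
      fix y assume "y \<in> {\<phi> a..\<phi> b}"
      then show "y \<in> \<phi> ` {a..b}" using IVT'[of \<phi> a y b] ab cont by auto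
    qed
  qed
  note im = this
  have le: "\<phi> a \<le> \<phi> b" using mono[of a b] ab by (cases "a = b") auto
  have I: "\<phi> a \<in> I" "\<phi> b \<in> I" using sub ab by auto
  have "(\<lambda>x. \<bar>\<phi>1 x\<bar> *\<^sub>R u1 (\<phi> x)) absolutely_integrable_on {a..b} \<and> integral {a..b} (\<lambda>x. \<bar>\<phi>1 x\<bar> *\<^sub>R u1 (\<phi> x)) = u (\<phi> b) - u (\<phi> a)"
  proof (subst has_absolute_integral_change_of_variables_real)
    show "u1 absolutely_integrable_on \<phi> ` {a..b} \<and> integral (\<phi> ` {a..b}) u1 = u (\<phi> b) - u (\<phi> a)"
      unfolding im using ac_deriv_onD[OF u I le] by simp
    show "(\<phi> has_real_derivative \<phi>1 x) (at x within {a..b})" if "x \<in> {a..b}" for x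
      using phi sJ that by (blast intro: has_field_derivative_at_within)
  qed (use inj in auto)
  note * = this
  have eq: "\<bar>\<phi>1 x\<bar> *\<^sub>R u1 (\<phi> x) = complex_of_real (\<phi>1 x) * u1 (\<phi> x)" if "x \<in> {a..b}" for x
    using pos[of x] sJ that by (auto simp: scaleR_conv_of_real)
  have "(\<lambda>x. complex_of_real (\<phi>1 x) * u1 (\<phi> x)) absolutely_integrable_on {a..b}"
    by (rule absolutely_integrable_spike[OF conjunct1[OF *] negligible_empty]) (use eq in auto)
  moreover have "integral {a..b} (\<lambda>x. complex_of_real (\<phi>1 x) * u1 (\<phi> x)) = integral {a..b} (\<lambda>x. \<bar>\<phi>1 x\<bar> *\<^sub>R u1 (\<phi> x))"
    by (rule Henstock_Kurzweil_Integration.integral_cong) (simp add: eq)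
  ultimately show "(\<lambda>x. complex_of_real (\<phi>1 x) * u1 (\<phi> x)) absolutely_integrable_on {a..b} \<and>
      u (\<phi> b) - u (\<phi> a) = integral {a..b} (\<lambda>x. complex_of_real (\<phi>1 x) * u1 (\<phi> x))"
    using * by simp
qed

section \<open>Integration by parts on unbounded intervals\<close>

lemma integrable_lebesgue_on_iff:
  fixes f :: "real \<Rightarrow> 'b::{banach, second_countable_topology}"
  assumes "S \<in> sets lebesgue"
  shows "integrable (lebesgue_on S) f \<longleftrightarrow> f absolutely_integrable_on S"
  using assms by (simp add: integrable_restrict_space set_integrable_def)

text \<open>Bridges two conventions: the L2 spaces live on the open half-line, whereas
  \<open>H2_on\<close> asks for absolute continuity up to the end point.\<close>

lemma absolutely_integrable_Ioi_iff:
  fixes f :: "real \<Rightarrow> complex"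
  shows "f absolutely_integrable_on {a<..} \<longleftrightarrow> f absolutely_integrable_on {a..}"
proof (rule absolutely_integrable_spike_set_eq)
  have "{x \<in> {a<..} - {a..}. f x \<noteq> 0} = {}" "{x \<in> {a..} - {a<..}. f x \<noteq> 0} \<subseteq> {a}" by auto
  then show "negligible {x \<in> {a<..} - {a..}. f x \<noteq> 0}" "negligible {x \<in> {a..} - {a<..}. f x \<noteq> 0}"
    by (auto intro: negligible_subset[OF negligible_sing])
qed

lemma integral_Ioi_eq:
  fixes f :: "real \<Rightarrow> complex"
  shows "integral {a<..} f = integral {a..} f"
proof (rule integral_spike_set)
  have "{x \<in> {a<..} - {a..}. f x \<noteq> 0} = {}" "{x \<in> {a..} - {a<..}. f x \<noteq> 0} \<subseteq> {a}" by auto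
  then show "negligible {x \<in> {a<..} - {a..}. f x \<noteq> 0}" "negligible {x \<in> {a..} - {a<..}. f x \<noteq> 0}"
    by (auto intro: negligible_subset[OF negligible_sing])
qed

text \<open>Integrability of h1 gives h a limit at infinity, and integrability of h forces that
  limit to be zero. This is what makes boundary terms at infinity vanish.\<close>

lemma ac_tendsto_0_at_top:
  assumes ac: "ac_deriv_on {a..} h h1" and h: "h absolutely_integrable_on {a..}" and h1: "h1 absolutely_integrable_on {a..}"
  shows "(h \<longlongrightarrow> 0) at_top" "integral {a..} h1 = - h a"
proof -
  have sub: "S absolutely_integrable_on {c..d}" if "S absolutely_integrable_on {a..}" "a \<le> c" for S :: "real \<Rightarrow> complex" and c d
    using that by (intro set_integrable_subset[OF that(1)]) auto
  have "((\<lambda>b. LINT x:{a..b}|lebesgue. h1 x) \<longlongrightarrow> (LINT x:{a..}|lebesgue. h1 x)) at_top"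
    by (rule tendsto_set_lebesgue_integral_at_top[OF _ h1]) auto
  then have "((\<lambda>b. LINT x:{a..b}|lebesgue. h1 x) \<longlongrightarrow> integral {a..} h1) at_top"
    using set_lebesgue_integral_eq_integral(2)[OF h1] by simp
  moreover have "\<forall>\<^sub>F b in at_top. (LINT x:{a..b}|lebesgue. h1 x) = h b - h a"
    using eventually_ge_at_top[of a]
  proof eventually_elim
    case (elim b)
    then show ?case using set_lebesgue_integral_eq_integral(2)[OF sub[OF h1, of a b]] ac_deriv_onD(3)[OF ac, of a b] by simp
  qed
  ultimately have "((\<lambda>b. h b - h a) \<longlongrightarrow> integral {a..} h1) at_top" by (rule Lim_transform_eventually)
  then have "((\<lambda>b. (h b - h a) + h a) \<longlongrightarrow> integral {a..} h1 + h a) at_top" by (intro tendsto_intros)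
  then have lim: "(h \<longlongrightarrow> integral {a..} h1 + h a) at_top" by simp
  define L where "L = integral {a..} h1 + h a"
  have "L = 0"
  proof (rule ccontr)
    assume L: "L \<noteq> 0"
    have "\<forall>\<^sub>F x in at_top. dist (h x) L < cmod L / 2"
      using lim L unfolding L_def[symmetric] by (intro tendstoD) auto
    then obtain X where X: "\<And>x. x \<ge> X \<Longrightarrow> dist (h x) L < cmod L / 2" by (auto simp: eventually_at_top_linorder)
    define c where "c = max a X"
    have ge: "cmod L / 2 \<le> cmod (h x)" if "c \<le> x" for x
    proof -
      have "dist (h x) L < cmod L / 2" using X that by (auto simp: c_def)
      then show ?thesis using norm_triangle_ineq3[of L "h x"] by (simp add: dist_norm norm_minus_commute)
    qed
    have n: "(\<lambda>x. cmod (h x)) absolutely_integrable_on {a..}" using h by (rule absolutely_integrable_norm[unfolded o_def])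
    have n1: "(\<lambda>x. cmod (h x)) integrable_on {a..}" using n by (simp add: absolutely_integrable_on_def)
    define B where "B = integral {a..} (\<lambda>x. cmod (h x))"
    have bound: "cmod L / 2 * (d - c) \<le> B" if "c \<le> d" for d
    proof -
      have n2: "(\<lambda>x. cmod (h x)) integrable_on {c..d}"
        using sub[OF h, of c d] by (auto simp: absolutely_integrable_on_def c_def)
      have "cmod L / 2 * (d - c) = integral {c..d} (\<lambda>x. cmod L / 2)" using that by simp
      also have "\<dots> \<le> integral {c..d} (\<lambda>x. cmod (h x))" by (rule integral_le[OF _ n2]) (use ge in auto)
      also have "\<dots> \<le> B" unfolding B_def by (rule integral_subset_le[OF _ n2 n1]) (auto simp: c_def)
      finally show ?thesis .
    qed
    \<comment> \<open>So long an interval that the lower bound |L| / 2 for |h| integrates to |B| +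
      1, more than the total integral \<open>B\<close>.\<close>
    define d where "d = c + (\<bar>B\<bar> + 1) / (cmod L / 2)"
    have "cmod L / 2 * (d - c) = \<bar>B\<bar> + 1" using L by (simp add: d_def)
    moreover have "c \<le> d" using L by (simp add: d_def)
    ultimately show False using bound[of d] by simp
  qed
  then show "(h \<longlongrightarrow> 0) at_top" "integral {a..} h1 = - h a"
    using lim by (auto simp: L_def eq_neg_iff_add_eq_0)
qed

lemma ac_integral_half_line:
  assumes ac: "ac_deriv_on {a..} h h1" and h: "integrable (lebesgue_on {a<..}) h" and h1: "integrable (lebesgue_on {a<..}) h1"
  shows "(\<integral>x. h1 x \<partial>lebesgue_on {a<..}) = - h a"
proof -
  have "(\<integral>x. h1 x \<partial>lebesgue_on {a<..}) = integral {a<..} h1" by (rule lebesgue_integral_eq_integral[OF h1]) simp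
  also have "\<dots> = - h a"
    using ac_tendsto_0_at_top(2)[OF ac] h h1 by (simp add: integrable_lebesgue_on_iff absolutely_integrable_Ioi_iff integral_Ioi_eq)
  finally show ?thesis .
qed

lemma reflect_half_line:
  fixes f :: "real \<Rightarrow> complex"
  shows "(\<lambda>x. f (- x)) absolutely_integrable_on {0..} \<longleftrightarrow> f absolutely_integrable_on {..0}"
    "f absolutely_integrable_on {..0} \<Longrightarrow> integral {0..} (\<lambda>x. f (- x)) = integral {..0} f"
proof -
  have im: "uminus ` {0..} = {..0::real}"
  proof
    show "{..0::real} \<subseteq> uminus ` {0..}"
    proof
      fix x :: real assume "x \<in> {..0}"
      then show "x \<in> uminus ` {0..}" by (intro image_eqI[of _ _ "- x"]) auto
    qed
  qed auto
  have *: "(\<lambda>x. \<bar>-1::real\<bar> *\<^sub>R f (- x)) absolutely_integrable_on {0..} \<and> integral {0..} (\<lambda>x. \<bar>-1::real\<bar> *\<^sub>R f (- x)) = b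
    \<longleftrightarrow> f absolutely_integrable_on uminus ` {0..} \<and> integral (uminus ` {0..}) f = b" for b
    by (rule has_absolute_integral_change_of_variables_real) (auto intro!: derivative_eq_intros simp: inj_on_def)
  show "(\<lambda>x. f (- x)) absolutely_integrable_on {0..} \<longleftrightarrow> f absolutely_integrable_on {..0}"
    using *[of "integral {0..} (\<lambda>x. f (- x))"] *[of "integral {..0} f"] unfolding im by auto
  show "integral {0..} (\<lambda>x. f (- x)) = integral {..0} f" if "f absolutely_integrable_on {..0}"
    using *[of "integral {..0} f"] that unfolding im by simp
qed

lemma ac_integral_line:
  assumes ac: "ac_deriv_on UNIV h h1" and h: "integrable lebesgue h" and h1: "integrable lebesgue h1"
  shows "(\<integral>x. h1 x \<partial>lebesgue) = 0"
proof -
  have sub: "f absolutely_integrable_on S" if "integrable lebesgue f" "S \<in> sets lebesgue" for f :: "real \<Rightarrow> complex" and S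
    using that by (simp add: set_integrable_def integrable_mult_indicator)
  have "integral {0..} h1 = - h 0"
    using ac_deriv_on_subset[OF ac, of "{0..}"] by (intro ac_tendsto_0_at_top sub h h1) auto
  moreover have "integral {0..} (\<lambda>x. - h1 (- x)) = - h (- 0)"
  proof (rule ac_tendsto_0_at_top(2))
    show "ac_deriv_on {0..} (\<lambda>x. h (- x)) (\<lambda>x. - h1 (- x))"
      by (rule ac_deriv_on_subset[OF ac_deriv_on_reflect[OF ac]]) simp
    show "(\<lambda>x. h (- x)) absolutely_integrable_on {0..}" using sub[OF h] by (simp add: reflect_half_line(1))
    have "(\<lambda>x. h1 (- x)) absolutely_integrable_on {0..}" using sub[OF h1] by (simp add: reflect_half_line(1))
    then show "(\<lambda>x. - h1 (- x)) absolutely_integrable_on {0..}" by (simp add: absolutely_integrable_on_def integrable_neg_iff)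
  qed
  then have "integral {..0} h1 = h 0" using reflect_half_line(2)[OF sub[OF h1]] by simp
  moreover have "integral ({..0} \<union> {0..}) h1 = integral {..0} h1 + integral {0..} h1"
  proof (rule Henstock_Kurzweil_Integration.integral_Un)
    have "{..0} \<inter> {0..} = {0::real}" by auto
    then show "negligible ({..0} \<inter> {0..} :: real set)" by simp
  qed (use sub[OF h1] in \<open>auto simp: absolutely_integrable_on_def\<close>)
  moreover have "{..0} \<union> {0..} = (UNIV :: real set)" by auto
  ultimately have "integral UNIV h1 = 0" by simp
  then show ?thesis using lebesgue_integral_eq_integral[of UNIV h1] h1 by (simp add: lebesgue_on_UNIV_eq)
qed

lemma L2_restrict:
  assumes f: "f \<in> L2 (lebesgue_on S)" and "T \<subseteq> S" "T \<in> sets lebesgue" "S \<in> sets lebesgue"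
  shows "f \<in> L2 (lebesgue_on T)" "L2_norm (lebesgue_on T) f \<le> L2_norm (lebesgue_on S) f"
proof -
  have m: "f \<in> borel_measurable (lebesgue_on T)"
    using L2_measurable[OF f] assms(2) by (rule measurable_restrict_mono)
  have "(\<integral>\<^sup>+x. ennreal ((cmod (f x))\<^sup>2) \<partial>lebesgue_on T) \<le> (\<integral>\<^sup>+x. ennreal ((cmod (f x))\<^sup>2) \<partial>lebesgue_on S)"
    using assms by (auto simp: nn_integral_restrict_space intro!: nn_integral_mono split: split_indicator)
  also have "\<dots> = ennreal ((L2_norm (lebesgue_on S) f)\<^sup>2)" by (rule L2_nn_integral[OF f])
  finally show "f \<in> L2 (lebesgue_on T)" "L2_norm (lebesgue_on T) f \<le> L2_norm (lebesgue_on S) f"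
    using L2I_nn_integral[OF m] by auto
qed

lemma ac_mult_cnj:
  assumes "ac_deriv_on I u u1" "ac_deriv_on I v v1" "is_interval I"
  shows "ac_deriv_on I (\<lambda>x. u x * cnj (v x)) (\<lambda>x. u1 x * cnj (v x) + u x * cnj (v1 x))"
  by (rule ac_deriv_on_mult[OF assms(1) ac_deriv_on_cnj[OF assms(2)] assms(3)])

section \<open>Sup-norm and interpolation estimates on the half-line\<close>

text \<open>|u x|^2 is minus the integral of the derivative of |u|^2 over (x, \<infinity>), and each
  half of that derivative is bounded by Cauchy-Schwarz.\<close>

lemma ac_sup_bound:
  assumes ac: "ac_deriv_on {0..} u u1" and L2: "u \<in> L2 (lebesgue_on {0<..})" "u1 \<in> L2 (lebesgue_on {0<..})" and x: "0 \<le> x"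
  shows "(cmod (u x))\<^sup>2 \<le> 2 * L2_norm (lebesgue_on {0<..}) u * L2_norm (lebesgue_on {0<..}) u1"
proof -
  let ?M = "lebesgue_on {x<..}"
  have r: "u \<in> L2 ?M" "L2_norm ?M u \<le> L2_norm (lebesgue_on {0<..}) u"
     "u1 \<in> L2 ?M" "L2_norm ?M u1 \<le> L2_norm (lebesgue_on {0<..}) u1"
    using L2_restrict[OF L2(1), of "{x<..}"] L2_restrict[OF L2(2), of "{x<..}"] x by auto
  have "ac_deriv_on {x..} (\<lambda>x. u x * cnj (u x)) (\<lambda>x. u1 x * cnj (u x) + u x * cnj (u1 x))"
    by (rule ac_deriv_on_subset[OF ac_mult_cnj[OF ac ac]]) (use x in \<open>auto simp: is_interval_ci\<close>)
  then have "(\<integral>t. u1 t * cnj (u t) + u t * cnj (u1 t) \<partial>?M) = - (u x * cnj (u x))"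
    by (rule ac_integral_half_line) (intro Bochner_Integration.integrable_add ip_integrable r)+
  moreover have "(\<integral>t. u1 t * cnj (u t) + u t * cnj (u1 t) \<partial>?M) = ip ?M u1 u + ip ?M u u1"
    unfolding ip_def by (intro Bochner_Integration.integral_add ip_integrable r)
  ultimately have "u x * cnj (u x) = - (ip ?M u1 u + ip ?M u u1)" by simp
  then have "cmod (u x * cnj (u x)) = cmod (ip ?M u1 u + ip ?M u u1)" by (metis norm_minus_cancel)
  also have "\<dots> \<le> cmod (ip ?M u1 u) + cmod (ip ?M u u1)" by (rule norm_triangle_ineq)
  also have "\<dots> \<le> L2_norm ?M u1 * L2_norm ?M u + L2_norm ?M u * L2_norm ?M u1"
    by (intro add_mono ip_norm_le r)
  also have "\<dots> = 2 * (L2_norm ?M u * L2_norm ?M u1)" by simp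
  also have "\<dots> \<le> 2 * (L2_norm (lebesgue_on {0<..}) u * L2_norm (lebesgue_on {0<..}) u1)"
    using r by (intro mult_left_mono mult_mono) auto
  finally show ?thesis by (simp add: norm_mult power2_eq_square)
qed

lemma H2_half_lineD:
  assumes "H2_on {0<..} u u1 u2"
  shows "ac_deriv_on {0..} u u1" "ac_deriv_on {0..} u1 u2" "u \<in> L2 (lebesgue_on {0<..})"
    "u1 \<in> L2 (lebesgue_on {0<..})" "u2 \<in> L2 (lebesgue_on {0<..})"
  using assms unfolding H2_on_def by auto

text \<open>Integration by parts of <u', u'> leaves a boundary term at 0. No boundary condition is
  imposed, so that term is estimated by the sup bounds for u and u'. With s^2 = ||u|| ||u''|| this
  gives n1^2 <= s^2 + 2 s n1, hence n1 <= 3 s.\<close>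

lemma H2_half_line_interpolation:
  assumes "H2_on {0<..} u u1 u2"
  shows "L2_norm (lebesgue_on {0<..}) u1 \<le> 2 * (L2_norm (lebesgue_on {0<..}) u + L2_norm (lebesgue_on {0<..}) u2)"
proof -
  let ?M = "lebesgue_on {0<..} :: real measure"
  note H = H2_half_lineD[OF assms]
  define n0 n1 n2 where "n0 = L2_norm ?M u" and "n1 = L2_norm ?M u1" and "n2 = L2_norm ?M u2"
  have nn: "0 \<le> n0" "0 \<le> n1" "0 \<le> n2" by (auto simp: n0_def n1_def n2_def)
  define s where "s = sqrt (n0 * n2)"
  have s: "0 \<le> s" "s\<^sup>2 = n0 * n2" using nn by (auto simp: s_def)
  have "(\<integral>t. u2 t * cnj (u t) + u1 t * cnj (u1 t) \<partial>?M) = - (u1 0 * cnj (u 0))"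
    by (rule ac_integral_half_line[OF ac_mult_cnj[OF H(2,1)]]) 
       (auto simp: is_interval_ci intro!: Bochner_Integration.integrable_add ip_integrable H)
  moreover have "(\<integral>t. u2 t * cnj (u t) + u1 t * cnj (u1 t) \<partial>?M) = ip ?M u2 u + ip ?M u1 u1"
    unfolding ip_def by (intro Bochner_Integration.integral_add ip_integrable H)
  ultimately have "ip ?M u2 u + ip ?M u1 u1 = - (u1 0 * cnj (u 0))" by (simp only:)
  then have "(ip ?M u2 u + ip ?M u1 u1) - ip ?M u2 u = - (u1 0 * cnj (u 0)) - ip ?M u2 u" by (simp only:)
  then have "complex_of_real (n1\<^sup>2) = - (ip ?M u2 u + u1 0 * cnj (u 0))" by (simp add: ip_self n1_def)
  then have "n1\<^sup>2 = cmod (ip ?M u2 u + u1 0 * cnj (u 0))" by (metis norm_minus_cancel norm_of_real abs_of_nonneg zero_le_power2)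
  also have "\<dots> \<le> cmod (ip ?M u2 u) + cmod (u1 0 * cnj (u 0))" by (rule norm_triangle_ineq)
  also have "cmod (ip ?M u2 u) \<le> n2 * n0" unfolding n2_def n0_def by (rule ip_norm_le[OF H(5,3)])
  also have "cmod (u1 0 * cnj (u 0)) \<le> 2 * s * n1"
  proof (rule power2_le_imp_le)
    have "(cmod (u1 0 * cnj (u 0)))\<^sup>2 = (cmod (u1 0))\<^sup>2 * (cmod (u 0))\<^sup>2" by (simp add: norm_mult power_mult_distrib)
    also have "\<dots> \<le> (2 * n1 * n2) * (2 * n0 * n1)"
      using ac_sup_bound[OF H(1,3,4), of 0] ac_sup_bound[OF H(2,4,5), of 0] nn
      by (intro mult_mono) (auto simp: n0_def n1_def n2_def)
    also have "\<dots> = (2 * s * n1)\<^sup>2" using s(2) by (simp add: power_mult_distrib power2_eq_square)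
    finally show "(cmod (u1 0 * cnj (u 0)))\<^sup>2 \<le> (2 * s * n1)\<^sup>2" .
  qed (use s nn in auto)
  finally have q: "n1\<^sup>2 \<le> s\<^sup>2 + 2 * s * n1" using s(2) by (simp add: mult.commute)
  have "n1 \<le> 3 * s"
  proof (rule ccontr)
    assume "\<not> n1 \<le> 3 * s"
    then have gt: "3 * s < n1" by simp
    then have "0 < n1" using s by linarith
    have "n1 * (3 * s) < n1 * n1" using gt \<open>0 < n1\<close> by simp
    then have "3 * (s * n1) < n1 * n1" by (simp add: mult_ac)
    moreover have "s * (3 * s) \<le> s * n1" using gt s by (intro mult_left_mono) auto
    then have "3 * (s * s) \<le> s * n1" by (simp add: mult_ac)
    moreover have "n1 * n1 \<le> s * s + 2 * (s * n1)" using q by (simp add: power2_eq_square mult_ac)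
    ultimately show False using mult_nonneg_nonneg[OF s(1) s(1)] by linarith
  qed
  also have "3 * s \<le> 2 * (n0 + n2)"
  proof (rule power2_le_imp_le)
    have "(3 * s)\<^sup>2 = 9 * (n0 * n2)" using s by (simp add: power_mult_distrib)
    also have "\<dots> \<le> (2 * (n0 + n2))\<^sup>2"
      using nn sum_squares_bound[of n0 n2] zero_le_square[of n0] zero_le_square[of n2] mult.commute[of n2 n0]
      unfolding power2_eq_square distrib_left distrib_right by linarith
    finally show "(3 * s)\<^sup>2 \<le> (2 * (n0 + n2))\<^sup>2" .
  qed (use nn in auto)
  finally show ?thesis by (simp add: n0_def n1_def n2_def)
qed

lemma AE_lebesgue_on_negligible:
  assumes "AE x in lebesgue_on S. P x" "S \<in> sets lebesgue"
  obtains N where "negligible N" "\<And>x. x \<in> S \<Longrightarrow> x \<notin> N \<Longrightarrow> P x"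
proof -
  have "AE x in lebesgue. x \<in> S \<longrightarrow> P x" using assms by (simp add: AE_restrict_space_iff)
  then obtain N where "{x \<in> space lebesgue. \<not> (x \<in> S \<longrightarrow> P x)} \<subseteq> N" "N \<in> null_sets lebesgue"
    unfolding eventually_ae_filter by blast
  then show thesis using that[of N] by (auto simp: negligible_iff_null_sets)
qed

text \<open>The negligible set \<open>I - S\<close> takes care of end points: second derivatives are
  known almost everywhere on the open interval, while absolute continuity is stated on its
  closure.\<close>

lemma ac_deriv_on_AE_cong:
  assumes ac: "ac_deriv_on I u v" and ae: "AE x in lebesgue_on S. v x = v' x" and S: "S \<in> sets lebesgue" and neg: "negligible (I - S)"
    and I: "is_interval I"
  shows "ac_deriv_on I u v'"
  unfolding ac_deriv_on_def
proof (intro ballI impI)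
  fix a b assume ab: "a \<in> I" "b \<in> I" "a \<le> b"
  obtain N where N: "negligible N" "\<And>x. x \<in> S \<Longrightarrow> x \<notin> N \<Longrightarrow> v x = v' x" by (rule AE_lebesgue_on_negligible[OF ae S]) blast
  have N': "negligible (N \<union> (I - S))" using N(1) neg by simp
  have eq: "v' x = v x" if "x \<in> {a..b} - (N \<union> (I - S))" for x
  proof -
    have "x \<in> I" using that ab I by (auto intro: mem_is_interval_1_I[of I a b])
    then show ?thesis using that N(2)[of x] by simp
  qed
  note D = ac_deriv_onD[OF ac ab]
  show "v' absolutely_integrable_on {a..b} \<and> u b - u a = integral {a..b} v'"
    using absolutely_integrable_spike[OF D(1) N' eq] integral_spike[where T="{a..b}" and f=v and g=v', OF N' eq] D(3) by simp
qed

section \<open>Uniqueness for the initial value problem\<close>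

text \<open>Gronwall's argument for the energy E = |w|^2 + |w'|^2: since E' <= c E, the product of E
  with exp (- c t) does not increase from its initial value 0. The product rule replaces pointwise
  differentiation.\<close>

lemma half_line_uniqueness:
  assumes ac: "ac_deriv_on {0..} w w1" "ac_deriv_on {0..} w1 w2"
    and init: "w 0 = 0" "w1 0 = 0"
    and ode: "AE x in lebesgue_on {0<..}. w2 x = complex_of_real (Q x) * w x"
    and Q: "\<And>x. 0 < x \<Longrightarrow> \<bar>Q x\<bar> \<le> K" and x: "0 \<le> x"
  shows "w x = 0"
proof -
  \<comment> \<open>The bound on \<open>Q\<close> is given for positive arguments. Setting the
    coefficient to zero elsewhere makes the later pointwise inequality valid at the end point as
    well.\<close>
  define Q' where "Q' t = (if 0 < t then Q t else 0)" for t
  have K: "0 \<le> K" using Q[of 1] by simp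
  have Q': "\<bar>Q' t\<bar> \<le> K" for t using Q K by (simp add: Q'_def)
  have iv: "is_interval {0::real..}" by (rule is_interval_ci)
  have "ac_deriv_on {0..} w1 (\<lambda>x. complex_of_real (Q' x) * w x)"
  proof (rule ac_deriv_on_AE_cong[OF ac(2) _ _ _ iv])
    show "AE x in lebesgue_on {0<..}. w2 x = complex_of_real (Q' x) * w x"
      using ode AE_space by eventually_elim (simp add: Q'_def)
    have "{0..} - {0<..} = {0::real}" by auto
    then show "negligible ({0..} - {0::real<..})" by simp
  qed simp
  note ac2 = this
  \<comment> \<open>The mixed terms contribute 2 |w| |w'| from the kinematic part and 2 K |w| |w'|
    from the equation, together at most (K + 1) E.\<close>
  define c where "c = K + 1"
  define E where "E t = w t * cnj (w t) + w1 t * cnj (w1 t)" for t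
  define E1 where "E1 t = (w1 t * cnj (w t) + w t * cnj (w1 t)) + ((complex_of_real (Q' t) * w t) * cnj (w1 t) + w1 t * cnj (complex_of_real (Q' t) * w t))" for t
  have acE: "ac_deriv_on {0..} E E1"
    unfolding E_def[abs_def] E1_def[abs_def] by (intro ac_deriv_on_add ac_mult_cnj ac ac2 iv)
  have ace: "ac_deriv_on {0..} (\<lambda>t. complex_of_real (exp (- c * t))) (\<lambda>t. complex_of_real (- c * exp (- c * t)))"
    by (rule ac_deriv_on_C1[OF _ _ iv])
       (auto intro!: derivative_eq_intros continuous_intros has_vector_derivative_of_real simp: has_real_derivative_iff_has_vector_derivative[symmetric])
  note F = ac_deriv_onD[OF ac_deriv_on_mult[OF ace acE iv], of 0 x]
  let ?F1 = "\<lambda>t. complex_of_real (- c * exp (- c * t)) * E t + complex_of_real (exp (- c * t)) * E1 t"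
  have int: "?F1 integrable_on {0..x}" using F(2) x by simp
  have "E 0 = 0" by (simp add: E_def init)
  then have eq: "complex_of_real (exp (- c * x)) * E x = integral {0..x} ?F1" using F(3) x by simp
  have "Re (integral {0..x} ?F1) = integral {0..x} (\<lambda>t. Re (?F1 t))"
    using integral_linear[OF int bounded_linear_Re] by (simp add: o_def)
  also have "\<dots> \<le> integral {0..x} (\<lambda>t. 0)"
  proof (rule integral_le)
    show "(\<lambda>t. Re (?F1 t)) integrable_on {0..x}"
      using integrable_linear[OF int bounded_linear_Re] by (simp add: o_def)
    fix t
    define A B where "A = cmod (w t)" and "B = cmod (w1 t)"
    have "Re (w1 t * cnj (w t)) \<le> B * A" "Re (w t * cnj (w1 t)) \<le> A * B"
      using complex_Re_le_cmod[of "w1 t * cnj (w t)"] complex_Re_le_cmod[of "w t * cnj (w1 t)"] by (auto simp: norm_mult A_def B_def)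
    moreover have "Re ((complex_of_real (Q' t) * w t) * cnj (w1 t)) \<le> K * (A * B)"
    proof -
      have "Re ((complex_of_real (Q' t) * w t) * cnj (w1 t)) \<le> cmod ((complex_of_real (Q' t) * w t) * cnj (w1 t))" by (rule complex_Re_le_cmod)
      also have "\<dots> = \<bar>Q' t\<bar> * (A * B)" by (simp add: norm_mult A_def B_def)
      also have "\<dots> \<le> K * (A * B)" using Q' by (intro mult_right_mono) (auto simp: A_def B_def)
      finally show ?thesis .
    qed
    moreover have "Re (w1 t * cnj (complex_of_real (Q' t) * w t)) \<le> K * (A * B)"
    proof -
      have "Re (w1 t * cnj (complex_of_real (Q' t) * w t)) \<le> cmod (w1 t * cnj (complex_of_real (Q' t) * w t))" by (rule complex_Re_le_cmod)
      also have "\<dots> = \<bar>Q' t\<bar> * (A * B)" by (simp add: norm_mult A_def B_def)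
      also have "\<dots> \<le> K * (A * B)" using Q' by (intro mult_right_mono) (auto simp: A_def B_def)
      finally show ?thesis .
    qed
    ultimately have "Re (E1 t) \<le> c * (2 * A * B)" by (simp add: E1_def c_def algebra_simps)
    also have "\<dots> \<le> c * (A\<^sup>2 + B\<^sup>2)" using K sum_squares_bound[of A B] by (intro mult_left_mono) (auto simp: c_def)
    also have "A\<^sup>2 + B\<^sup>2 = Re (E t)" by (simp add: E_def A_def B_def complex_norm_square[symmetric] del: complex_mult_cnj)
    finally have "Re (E1 t) \<le> c * Re (E t)" .
    then have "exp (- c * t) * Re (E1 t) \<le> exp (- c * t) * (c * Re (E t))" by (intro mult_left_mono) auto
    then show "Re (?F1 t) \<le> 0" by (simp add: mult_ac)
  qed (rule integrable_0)
  finally have "exp (- c * x) * Re (E x) \<le> 0" using arg_cong[OF eq, of Re] by simp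
  then have "Re (E x) \<le> 0" by (simp add: mult_le_0_iff)
  moreover have "Re (E x) = (cmod (w x))\<^sup>2 + (cmod (w1 x))\<^sup>2"
    by (simp add: E_def complex_norm_square[symmetric] del: complex_mult_cnj)
  ultimately have "(cmod (w x))\<^sup>2 \<le> 0" using zero_le_power2[of "cmod (w1 x)"] by linarith
  then show ?thesis by simp
qed

section \<open>The free resolvent on the line\<close>

lemma exp_L2_half_line:
  fixes \<kappa> :: complex
  assumes "0 < Re \<kappa>"
  shows "(\<lambda>t. exp (- \<kappa> * complex_of_real t)) \<in> L2 (lebesgue_on {x..})"
    "L2_norm (lebesgue_on {x..}) (\<lambda>t. exp (- \<kappa> * complex_of_real t)) = exp (- Re \<kappa> * x) / sqrt (2 * Re \<kappa>)"
proof -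
  have n: "(cmod (exp (- \<kappa> * complex_of_real t)))\<^sup>2 = exp (- (2 * Re \<kappa>) * t)" for t
    by (simp add: norm_exp_eq_Re power2_eq_square exp_add[symmetric])
  have hi: "((\<lambda>t. exp (- (2 * Re \<kappa>) * t)) has_integral exp (- (2 * Re \<kappa>) * x) / (2 * Re \<kappa>)) {x..}"
    by (rule has_integral_exp_minus_to_infinity) (use assms in simp)
  then have ai: "(\<lambda>t. exp (- (2 * Re \<kappa>) * t)) absolutely_integrable_on {x..}"
    by (intro nonnegative_absolutely_integrable_1) (auto simp: integrable_on_def)
  then have i: "integrable (lebesgue_on {x..}) (\<lambda>t. exp (- (2 * Re \<kappa>) * t))" by (simp add: integrable_lebesgue_on_iff)
  show "(\<lambda>t. exp (- \<kappa> * complex_of_real t)) \<in> L2 (lebesgue_on {x..})"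
    unfolding L2_def mem_Collect_eq n
  proof (intro conjI i)
    show "(\<lambda>t. exp (- \<kappa> * complex_of_real t)) \<in> borel_measurable (lebesgue_on {x..})"
      by (intro continuous_imp_measurable_on_sets_lebesgue continuous_intros) auto
  qed
  have "(\<integral>t. exp (- (2 * Re \<kappa>) * t) \<partial>lebesgue_on {x..}) = exp (- (2 * Re \<kappa>) * x) / (2 * Re \<kappa>)"
    using lebesgue_integral_eq_integral[OF i] hi by (simp add: integral_unique)
  also have "exp (- (2 * Re \<kappa>) * x) = (exp (- Re \<kappa> * x))\<^sup>2" by (simp add: power2_eq_square exp_add[symmetric])
  finally show "L2_norm (lebesgue_on {x..}) (\<lambda>t. exp (- \<kappa> * complex_of_real t)) = exp (- Re \<kappa> * x) / sqrt (2 * Re \<kappa>)"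
    unfolding L2_norm_def n by (simp add: real_sqrt_divide)
qed

lemma L2_lebesgue_restrict:
  "f \<in> L2 lebesgue \<Longrightarrow> S \<in> sets lebesgue \<Longrightarrow> f \<in> L2 (lebesgue_on S) \<and> L2_norm (lebesgue_on S) f \<le> L2_norm lebesgue f"
  using L2_restrict[of f UNIV S] by (simp add: lebesgue_on_UNIV_eq)

lemma integral_norm_square:
  assumes "f \<in> L2 (lebesgue_on S)" "S \<in> sets lebesgue"
  shows "((\<lambda>x. (cmod (f x))\<^sup>2) has_integral (L2_norm (lebesgue_on S) f)\<^sup>2) S"
proof -
  have i: "integrable (lebesgue_on S) (\<lambda>x. (cmod (f x))\<^sup>2)" by (rule L2_integrable[OF assms(1)])
  from has_integral_integral_lebesgue_on[OF this assms(2)] show ?thesis by (simp add: L2_norm_square)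
qed

lemma L2_lebesgue_exhaust:
  assumes f: "\<And>n::nat. f \<in> L2 (lebesgue_on {- real n..real n})" and C: "\<And>n::nat. L2_norm (lebesgue_on {- real n..real n}) f \<le> C"
    and m: "f \<in> borel_measurable lebesgue"
  shows "f \<in> L2 lebesgue" "L2_norm lebesgue f \<le> C"
proof -
  note [measurable] = m
  have C0: "0 \<le> C" using order_trans[OF L2_norm_nonneg C[of 0]] .
  define S where "S n = {- real n..real n}" for n :: nat
  have [measurable]: "S n \<in> sets lebesgue" for n by (simp add: S_def)
  have "(\<integral>\<^sup>+x. ennreal ((cmod (f x))\<^sup>2) \<partial>lebesgue) = (\<integral>\<^sup>+x. (SUP n. ennreal ((cmod (f x))\<^sup>2) * indicator (S n) x) \<partial>lebesgue)"
  proof (rule nn_integral_cong)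
    fix x :: real
    obtain n :: nat where "\<bar>x\<bar> \<le> real n" using real_arch_simple by blast
    then have "x \<in> S n" by (auto simp: S_def)
    then show "ennreal ((cmod (f x))\<^sup>2) = (SUP n. ennreal ((cmod (f x))\<^sup>2) * indicator (S n) x)"
      by (intro antisym SUP_upper2[of n] SUP_least) (auto split: split_indicator)
  qed
  also have "\<dots> = (SUP n. \<integral>\<^sup>+x. ennreal ((cmod (f x))\<^sup>2) * indicator (S n) x \<partial>lebesgue)"
  proof (rule nn_integral_monotone_convergence_SUP)
    show "incseq (\<lambda>n x. ennreal ((cmod (f x))\<^sup>2) * indicator (S n) x)"
      by (auto simp: incseq_def le_fun_def S_def split: split_indicator)
  qed measurable
  also have "\<dots> \<le> ennreal (C\<^sup>2)"
  proof (rule SUP_least)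
    fix n
    have "(\<integral>\<^sup>+x. ennreal ((cmod (f x))\<^sup>2) * indicator (S n) x \<partial>lebesgue) = (\<integral>\<^sup>+x. ennreal ((cmod (f x))\<^sup>2) \<partial>lebesgue_on (S n))"
      by (simp add: nn_integral_restrict_space S_def)
    also have "\<dots> = ennreal ((L2_norm (lebesgue_on (S n)) f)\<^sup>2)" using f unfolding S_def by (rule L2_nn_integral)
    also have "\<dots> \<le> ennreal (C\<^sup>2)" using C by (intro ennreal_leI power_mono) (auto simp: S_def)
    finally show "(\<integral>\<^sup>+x. ennreal ((cmod (f x))\<^sup>2) * indicator (S n) x \<partial>lebesgue) \<le> ennreal (C\<^sup>2)" .
  qed
  finally show "f \<in> L2 lebesgue" "L2_norm lebesgue f \<le> C" using L2I_nn_integral[OF m _ C0] by auto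
qed

lemma continuous_L2_Icc: "continuous_on {a..b} f \<Longrightarrow> f \<in> L2 (lebesgue_on {a..b::real})"
  unfolding L2_def
  by (auto simp: integrable_lebesgue_on_iff intro!: absolutely_integrable_continuous_real continuous_intros continuous_imp_measurable_on_sets_lebesgue)

lemma continuous_measurable_lebesgue: "continuous_on UNIV (f :: real \<Rightarrow> complex) \<Longrightarrow> f \<in> borel_measurable lebesgue"
  using continuous_imp_measurable_on_sets_lebesgue[of UNIV f] by (simp add: lebesgue_on_UNIV_eq)

text \<open>The bounded solution \<open>u(x) = \<integral>\<^sub>x\<^sup>\<infinity> exp (\<kappa> (x - t)) w(t) dt\<close>; it is square integrable by an energy estimate.\<close>

lemma first_order_L2_solution:
  fixes \<kappa> :: complex
  assumes k: "0 < Re \<kappa>" and w: "w \<in> L2 lebesgue"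
  shows "\<exists>u\<in>L2 lebesgue. ac_deriv_on UNIV u (\<lambda>x. \<kappa> * u x - w x)"
proof -
  define e where "e t = exp (- \<kappa> * complex_of_real t)" for t
  define P where "P x = integral {x..} (\<lambda>t. e t * w t)" for x
  define a where "a = Re \<kappa>"
  have a: "0 < a" using k by (simp add: a_def)
  have eL: "e \<in> L2 (lebesgue_on {x..})" for x unfolding e_def using exp_L2_half_line(1)[OF k] .
  have wL: "w \<in> L2 (lebesgue_on {x..})" "L2_norm (lebesgue_on {x..}) w \<le> L2_norm lebesgue w" for x using L2_lebesgue_restrict[OF w, of "{x..}"] by auto
  have ai: "(\<lambda>t. e t * w t) absolutely_integrable_on {x..}" for x
    using L2_integrable_mult[OF eL wL(1)] by (simp add: integrable_lebesgue_on_iff)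
  have acP: "ac_deriv_on UNIV P (\<lambda>t. - (e t * w t))"
    unfolding ac_deriv_on_def
  proof (intro ballI impI)
    fix x y :: real assume xy: "x \<le> y"
    have i: "(\<lambda>t. e t * w t) absolutely_integrable_on {x..y}" by (rule set_integrable_subset[OF ai[of x]]) auto
    have "integral ({x..y} \<union> {y..}) (\<lambda>t. e t * w t) = integral {x..y} (\<lambda>t. e t * w t) + integral {y..} (\<lambda>t. e t * w t)"
    proof (rule Henstock_Kurzweil_Integration.integral_Un)
      have "{x..y} \<inter> {y..} = {y}" using xy by auto
      then show "negligible ({x..y} \<inter> {y..})" by simp
    qed (use i ai[of y] in \<open>auto simp: absolutely_integrable_on_def\<close>)
    moreover have "{x..y} \<union> {y..} = {x..}" using xy by auto
    ultimately have "P y - P x = - integral {x..y} (\<lambda>t. e t * w t)" by (simp add: P_def)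
    moreover have "(\<lambda>t. - (e t * w t)) absolutely_integrable_on {x..y}"
      using i by (simp add: absolutely_integrable_on_def integrable_neg_iff)
    ultimately show "(\<lambda>t. - (e t * w t)) absolutely_integrable_on {x..y} \<and> P y - P x = integral {x..y} (\<lambda>t. - (e t * w t))" by simp
  qed
  define E where "E x = exp (\<kappa> * complex_of_real x)" for x
  have Ee: "E x * e x = 1" for x by (simp add: E_def e_def exp_add[symmetric])
  have acE: "ac_deriv_on UNIV E (\<lambda>x. \<kappa> * E x)"
  proof (rule ac_deriv_on_C1)
    fix x :: real
    have "((\<lambda>z. exp (\<kappa> * z)) has_field_derivative \<kappa> * E x) (at (complex_of_real x))"
      by (auto intro!: derivative_eq_intros simp: E_def)
    from has_vector_derivative_real_field[OF this] show "(E has_vector_derivative \<kappa> * E x) (at x)" by (simp add: E_def[abs_def])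
  qed (auto simp: E_def intro!: continuous_intros)
  define u where "u x = E x * P x" for x
  have "ac_deriv_on UNIV u (\<lambda>x. \<kappa> * E x * P x + E x * (- (e x * w x)))"
    unfolding u_def by (rule ac_deriv_on_mult[OF acE acP]) simp
  moreover have "\<kappa> * E x * P x + E x * (- (e x * w x)) = \<kappa> * u x - w x" for x
    using Ee[of x] by (simp add: u_def mult.assoc[symmetric])
  ultimately have ac: "ac_deriv_on UNIV u (\<lambda>x. \<kappa> * u x - w x)" by simp
  \<comment> \<open>A uniform bound for u: Cauchy-Schwarz on (x, \<infinity>) yields a decaying
    exponential which the growing factor \<open>E x\<close> cancels exactly. It is used only for the
    boundary terms of the energy estimate.\<close>
  define B where "B = L2_norm lebesgue w / sqrt (2 * a)"
  have bd: "cmod (u x) \<le> B" for x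
  proof -
    have "P x = ip (lebesgue_on {x..}) e (\<lambda>t. cnj (w t))"
      unfolding P_def ip_def complex_cnj_cnj
      by (rule lebesgue_integral_eq_integral[symmetric]) (use L2_integrable_mult[OF eL wL(1)] in auto)
    then have "cmod (P x) \<le> L2_norm (lebesgue_on {x..}) e * L2_norm (lebesgue_on {x..}) (\<lambda>t. cnj (w t))"
      using ip_norm_le[OF eL L2_cnj[OF wL(1)]] by simp
    also have "\<dots> \<le> (exp (- a * x) / sqrt (2 * a)) * L2_norm lebesgue w"
      using exp_L2_half_line(2)[OF k, of x] wL(2)[of x] a
      by (intro mult_mono) (auto simp: e_def[abs_def] a_def L2_norm_def)
    finally have "cmod (E x) * cmod (P x) \<le> cmod (E x) * ((exp (- a * x) / sqrt (2 * a)) * L2_norm lebesgue w)"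
      by (intro mult_left_mono) auto
    also have "\<dots> = (exp (a * x) * exp (- a * x)) * B" by (simp add: E_def norm_exp_eq_Re a_def B_def)
    also have "\<dots> = B" by (simp add: exp_add[symmetric])
    finally show ?thesis by (simp add: u_def norm_mult)
  qed
  have uc: "continuous_on UNIV u" by (rule ac_deriv_on_continuous[OF ac]) simp
  have "u \<in> L2 lebesgue"
  proof (rule L2_lebesgue_exhaust(1)[where C="sqrt ((B\<^sup>2 + (L2_norm lebesgue w)\<^sup>2 / a) / a)"])
    show "u \<in> borel_measurable lebesgue" by (rule continuous_measurable_lebesgue[OF uc])
    fix n :: nat
    define S where "S = {- real n..real n}"
    show uL: "u \<in> L2 (lebesgue_on {- real n..real n})" using uc by (intro continuous_L2_Icc) (auto intro: continuous_on_subset)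
    have wS: "w \<in> L2 (lebesgue_on S)" "L2_norm (lebesgue_on S) w \<le> L2_norm lebesgue w" using L2_lebesgue_restrict[OF w, of S] by (auto simp: S_def)
    have uS: "u \<in> L2 (lebesgue_on S)" using uL by (simp add: S_def)
    \<comment> \<open>The derivative of |u|^2. Its real part is 2 a |u|^2 - 2 Re (w cnj u), and
      Young's inequality absorbs the mixed term into a |u|^2. Integrated over [-n, n], this bounds
      the norm of u independently of n.\<close>
    define D where "D x = (\<kappa> * u x - w x) * cnj (u x) + u x * cnj (\<kappa> * u x - w x)" for x
    have "ac_deriv_on UNIV (\<lambda>x. u x * cnj (u x)) D" unfolding D_def by (rule ac_mult_cnj[OF ac ac]) simp
    from ac_deriv_onD[OF this, of "- real n" "real n"] have D: "D integrable_on S" "integral S D = u (real n) * cnj (u (real n)) - u (- real n) * cnj (u (- real n))"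
      by (auto simp: S_def)
    have I1: "((\<lambda>x. (cmod (u x))\<^sup>2) has_integral (L2_norm (lebesgue_on S) u)\<^sup>2) S" by (rule integral_norm_square[OF uS]) (simp add: S_def)
    have I2: "((\<lambda>x. (cmod (w x))\<^sup>2) has_integral (L2_norm (lebesgue_on S) w)\<^sup>2) S" by (rule integral_norm_square[OF wS(1)]) (simp add: S_def)
    have "(\<lambda>x. Re (D x)) integrable_on S" "integral S (\<lambda>x. Re (D x)) = Re (integral S D)"
      using integrable_linear[OF D(1) bounded_linear_Re] integral_linear[OF D(1) bounded_linear_Re] by (auto simp: o_def)
    then have I3: "((\<lambda>x. Re (D x)) has_integral Re (integral S D)) S" by (metis has_integral_integral)
    have "a * (L2_norm (lebesgue_on S) u)\<^sup>2 \<le> Re (integral S D) + (L2_norm (lebesgue_on S) w)\<^sup>2 / a"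
    proof (rule has_integral_le)
      show "((\<lambda>x. a * (cmod (u x))\<^sup>2) has_integral a * (L2_norm (lebesgue_on S) u)\<^sup>2) S" by (rule has_integral_mult_right[OF I1])
      show "((\<lambda>x. Re (D x) + (cmod (w x))\<^sup>2 / a) has_integral Re (integral S D) + (L2_norm (lebesgue_on S) w)\<^sup>2 / a) S"
        by (intro has_integral_add I3 has_integral_divide I2)
      fix x
      have "Re (D x) = 2 * a * (cmod (u x))\<^sup>2 - 2 * Re (w x * cnj (u x))"
        unfolding D_def cmod_power2 by (simp add: a_def power2_eq_square algebra_simps)
      moreover have "2 * Re (w x * cnj (u x)) \<le> a * (cmod (u x))\<^sup>2 + (cmod (w x))\<^sup>2 / a"
      proof -
        have "Re (w x * cnj (u x)) \<le> cmod (w x) * cmod (u x)" using complex_Re_le_cmod[of "w x * cnj (u x)"] by (simp add: norm_mult)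
        moreover have "2 * (cmod (w x) * cmod (u x)) \<le> a * (cmod (u x))\<^sup>2 + (cmod (w x))\<^sup>2 / a"
        proof -
          have "2 * ((cmod (w x) / sqrt a) * (sqrt a * cmod (u x))) \<le> (cmod (w x) / sqrt a)\<^sup>2 + (sqrt a * cmod (u x))\<^sup>2"
            using sum_squares_bound[of "cmod (w x) / sqrt a" "sqrt a * cmod (u x)"] by (simp only: mult.assoc)
          then show ?thesis using a by (simp add: power_divide power_mult_distrib)
        qed
        ultimately show ?thesis by linarith
      qed
      ultimately show "a * (cmod (u x))\<^sup>2 \<le> Re (D x) + (cmod (w x))\<^sup>2 / a" by simp
    qed
    moreover have "Re (integral S D) \<le> B\<^sup>2"
    proof -
      have "Re (integral S D) = (cmod (u (real n)))\<^sup>2 - (cmod (u (- real n)))\<^sup>2"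
        by (simp add: D(2) complex_norm_square[symmetric] del: complex_mult_cnj)
      also have "\<dots> \<le> (cmod (u (real n)))\<^sup>2" by simp
      also have "\<dots> \<le> B\<^sup>2" using bd by (intro power_mono) auto
      finally show ?thesis .
    qed
    moreover have "(L2_norm (lebesgue_on S) w)\<^sup>2 / a \<le> (L2_norm lebesgue w)\<^sup>2 / a" using wS(2) a by (intro divide_right_mono power_mono) auto
    ultimately have "a * (L2_norm (lebesgue_on S) u)\<^sup>2 \<le> B\<^sup>2 + (L2_norm lebesgue w)\<^sup>2 / a" by linarith
    then have "(L2_norm (lebesgue_on S) u)\<^sup>2 \<le> (B\<^sup>2 + (L2_norm lebesgue w)\<^sup>2 / a) / a" using a by (simp add: field_simps)
    then show "L2_norm (lebesgue_on {- real n..real n}) u \<le> sqrt ((B\<^sup>2 + (L2_norm lebesgue w)\<^sup>2 / a) / a)"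
      by (simp add: S_def real_le_rsqrt)
  qed
  then show ?thesis using ac by blast
qed

lemma L2_lebesgue_reflect:
  assumes "f \<in> L2 lebesgue" shows "(\<lambda>x::real. f (- x)) \<in> L2 lebesgue"
proof -
  have "uminus \<in> lebesgue \<rightarrow>\<^sub>M (lebesgue :: real measure)"
  proof -
    have "(\<lambda>x::real. (-1) *\<^sub>R x) \<in> lebesgue \<rightarrow>\<^sub>M lebesgue" by (rule lebesgue_measurable_scaling)
    then show ?thesis by simp
  qed
  then have "(\<lambda>x. f (- x)) \<in> borel_measurable lebesgue"
    by (rule measurable_compose[OF _ L2_measurable[OF assms]])
  moreover have "integrable lebesgue (\<lambda>x. (cmod (f (- x)))\<^sup>2)"
  proof -
    have "(\<lambda>x. (cmod (f x))\<^sup>2) absolutely_integrable_on uminus ` UNIV \<longleftrightarrow>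
      (\<lambda>x. \<bar>- 1::real\<bar> *\<^sub>R (cmod (f (- x)))\<^sup>2) absolutely_integrable_on UNIV"
      by (rule absolutely_integrable_change_of_variables_real) (auto intro!: derivative_eq_intros)
    moreover have "(\<lambda>x. (cmod (f x))\<^sup>2) absolutely_integrable_on UNIV"
      using L2_integrable[OF assms] by (simp add: set_integrable_def)
    ultimately show ?thesis by (simp add: set_integrable_def)
  qed
  ultimately show ?thesis by (simp add: L2_def)
qed

text \<open>Factorisation of - d^2/dx^2 + \<kappa>^2 into (d/dx + \<kappa>) (\<kappa> - d/dx). The
  right factor is the first order problem already solved; the left one is reduced to it by
  reflecting the line.\<close>

lemma free_resolvent_line:
  fixes \<kappa> :: complex
  assumes k: "0 < Re \<kappa>" and f: "f \<in> L2 lebesgue"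
  shows "\<exists>u u1. u \<in> L2 lebesgue \<and> u1 \<in> L2 lebesgue \<and> ac_deriv_on UNIV u u1 \<and> ac_deriv_on UNIV u1 (\<lambda>x. \<kappa>\<^sup>2 * u x - f x)"
proof -
  obtain w where w: "w \<in> L2 lebesgue" "ac_deriv_on UNIV w (\<lambda>x. \<kappa> * w x - f (- x))"
    using first_order_L2_solution[OF k L2_lebesgue_reflect[OF f]] by blast
  define v where "v x = w (- x)" for x
  have v: "v \<in> L2 lebesgue" unfolding v_def by (rule L2_lebesgue_reflect[OF w(1)])
  have acv: "ac_deriv_on UNIV v (\<lambda>x. f x - \<kappa> * v x)"
    using ac_deriv_on_reflect[OF w(2)] by (simp add: v_def[abs_def])
  obtain u where u: "u \<in> L2 lebesgue" "ac_deriv_on UNIV u (\<lambda>x. \<kappa> * u x - v x)"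
    using first_order_L2_solution[OF k v] by blast
  have "ac_deriv_on UNIV (\<lambda>x. \<kappa> * u x + (-1) * v x) (\<lambda>x. \<kappa> * (\<kappa> * u x - v x) + (-1) * (f x - \<kappa> * v x))"
    by (intro ac_deriv_on_add ac_deriv_on_scale u(2) acv)
  moreover have "(\<lambda>x. \<kappa> * (\<kappa> * u x - v x) + (-1) * (f x - \<kappa> * v x)) = (\<lambda>x. \<kappa>\<^sup>2 * u x - f x)"
    by (auto simp: algebra_simps power2_eq_square)
  ultimately have "ac_deriv_on UNIV (\<lambda>x. \<kappa> * u x - v x) (\<lambda>x. \<kappa>\<^sup>2 * u x - f x)" by simp
  moreover have "(\<lambda>x. \<kappa> * u x - v x) \<in> L2 lebesgue" using u v by simp
  ultimately show ?thesis using u by blast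
qed

section \<open>Schroedinger operators are selfadjoint\<close>

lemma ac_boundary_integral:
  assumes I: "I = UNIV \<or> I = {0<..}" and ac: "ac_deriv_on (closure I) h h1"
    and int: "integrable (lebesgue_on I) h" "integrable (lebesgue_on I) h1"
  shows "(\<integral>x. h1 x \<partial>lebesgue_on I) = (if I = UNIV then 0 else - h 0)"
  using I
proof
  assume "I = UNIV"
  then show ?thesis using ac_integral_line[of h h1] ac int by (simp add: lebesgue_on_UNIV_eq)
next
  assume "I = {0<..}"
  moreover have "{0::real<..} \<noteq> UNIV" by (metis UNIV_I greaterThan_iff less_irrefl)
  ultimately show ?thesis using ac_integral_half_line[of 0 h h1] ac int by simp
qed

lemma is_interval_closure_I: "I = UNIV \<or> I = {0<..} \<Longrightarrow> is_interval (closure I :: real set)"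
  by (auto simp: is_interval_ci)

lemma H2_onD:
  assumes "H2_on I u u1 u2"
  shows "ac_deriv_on (closure I) u u1" "ac_deriv_on (closure I) u1 u2" "u \<in> L2 (lebesgue_on I)"
    "u1 \<in> L2 (lebesgue_on I)" "u2 \<in> L2 (lebesgue_on I)"
  using assms unfolding H2_on_def by auto

lemma H2_on_add:
  assumes "H2_on I u u1 u2" "H2_on I v v1 v2"
  shows "H2_on I (\<lambda>x. u x + v x) (\<lambda>x. u1 x + v1 x) (\<lambda>x. u2 x + v2 x)"
  using assms unfolding H2_on_def by (auto intro: ac_deriv_on_add)

lemma H2_on_scale:
  assumes "H2_on I u u1 u2"
  shows "H2_on I (\<lambda>x. c * u x) (\<lambda>x. c * u1 x) (\<lambda>x. c * u2 x)"
  using assms unfolding H2_on_def by (auto intro: ac_deriv_on_scale)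

text \<open>Integrates the derivative of u1 cnj v - u cnj v1. On the line both ends contribute
  nothing; on the half-line the value at 0 vanishes by \<open>bdry\<close>.\<close>

lemma H2_on_Green:
  assumes I: "I = UNIV \<or> I = {0<..}" and u: "H2_on I u u1 u2" and v: "H2_on I v v1 v2"
    and bdry: "I = {0<..} \<Longrightarrow> u1 0 * cnj (v 0) = u 0 * cnj (v1 0)"
  shows "ip (lebesgue_on I) u2 v = ip (lebesgue_on I) u v2"
proof -
  note U = H2_onD[OF u] and V = H2_onD[OF v] and iv = is_interval_closure_I[OF I]
  let ?h = "\<lambda>x. u1 x * cnj (v x) + (-1) * (u x * cnj (v1 x))"
  let ?h1 = "\<lambda>x. (u2 x * cnj (v x) + u1 x * cnj (v1 x)) + (-1) * (u1 x * cnj (v1 x) + u x * cnj (v2 x))"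
  have "ac_deriv_on (closure I) ?h ?h1" by (intro ac_deriv_on_add ac_deriv_on_scale ac_mult_cnj U V iv)
  moreover have "integrable (lebesgue_on I) ?h" "integrable (lebesgue_on I) ?h1"
    by (intro Bochner_Integration.integrable_add integrable_mult_right ip_integrable U V)+
  ultimately have "(\<integral>x. ?h1 x \<partial>lebesgue_on I) = (if I = UNIV then 0 else - ?h 0)" by (rule ac_boundary_integral[OF I])
  also have "\<dots> = 0" using I bdry by auto
  finally have "(\<integral>x. u2 x * cnj (v x) - u x * cnj (v2 x) \<partial>lebesgue_on I) = 0" by simp
  moreover have "(\<integral>x. u2 x * cnj (v x) - u x * cnj (v2 x) \<partial>lebesgue_on I) = ip (lebesgue_on I) u2 v - ip (lebesgue_on I) u v2"
    unfolding ip_def by (intro Bochner_Integration.integral_diff ip_integrable U V)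
  ultimately show ?thesis by simp
qed

lemma schroedingerE:
  assumes "(f, g) \<in> schroedinger I bc q"
  obtains u u1 u2 where "H2_on I u u1 u2" "bc u u1" "AE x in lebesgue_on I. f x = u x"
    "AE x in lebesgue_on I. g x = - u2 x + complex_of_real (q x) * u x" "f \<in> L2 (lebesgue_on I)" "g \<in> L2 (lebesgue_on I)"
  using assms unfolding schroedinger_def by blast

lemma schroedingerI:
  assumes "H2_on I u u1 u2" "bc u u1" "AE x in lebesgue_on I. f x = u x"
    "AE x in lebesgue_on I. g x = - u2 x + complex_of_real (q x) * u x" "f \<in> L2 (lebesgue_on I)" "g \<in> L2 (lebesgue_on I)"
  shows "(f, g) \<in> schroedinger I bc q"
  using assms unfolding schroedinger_def by blast

lemma symmetric_op_schroedinger: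
  fixes q :: "real \<Rightarrow> real"
  assumes I: "I = UNIV \<or> I = {0<..}"
    and q: "(\<lambda>x. complex_of_real (q x)) \<in> borel_measurable (lebesgue_on I)" "\<And>x. x \<in> I \<Longrightarrow> \<bar>q x\<bar> \<le> K"
    and bc_add: "\<And>u u1 v v1. bc u u1 \<Longrightarrow> bc v v1 \<Longrightarrow> bc (\<lambda>x. u x + v x) (\<lambda>x. u1 x + v1 x)"
    and bc_scale: "\<And>u u1 c. bc u u1 \<Longrightarrow> bc (\<lambda>x. c * u x) (\<lambda>x. c * u1 x)"
    and bc_sym: "\<And>u u1 v v1. I = {0<..} \<Longrightarrow> bc u u1 \<Longrightarrow> bc v v1 \<Longrightarrow> u1 0 * cnj (v 0) = u 0 * cnj (v1 0)"
  shows "symmetric_op (lebesgue_on I) (schroedinger I bc q)"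
proof
  let ?M = "lebesgue_on I"
  show "f \<in> L2 ?M \<and> g \<in> L2 ?M" if "(f, g) \<in> schroedinger I bc q" for f g
    using that by (auto elim: schroedingerE)
  show "(f', g') \<in> schroedinger I bc q" if "(f, g) \<in> schroedinger I bc q" "f' \<in> L2 ?M" "g' \<in> L2 ?M"
    "AE x in ?M. f x = f' x" "AE x in ?M. g x = g' x" for f g f' g'
  proof -
    from that(1) obtain u u1 u2 where u: "H2_on I u u1 u2" "bc u u1" "AE x in ?M. f x = u x"
      "AE x in ?M. g x = - u2 x + complex_of_real (q x) * u x" by (rule schroedingerE)
    show ?thesis
    proof (rule schroedingerI[where bc=bc, OF u(1,2) _ _ that(2,3)])
      show "AE x in ?M. f' x = u x" using that(4) u(3) by eventually_elim simp
      show "AE x in ?M. g' x = - u2 x + complex_of_real (q x) * u x" using that(5) u(4) by eventually_elim simp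
    qed
  qed
  show "(\<lambda>x. f x + f' x, \<lambda>x. g x + g' x) \<in> schroedinger I bc q" if "(f, g) \<in> schroedinger I bc q" "(f', g') \<in> schroedinger I bc q" for f g f' g'
  proof -
    from that(1) obtain u u1 u2 where u: "H2_on I u u1 u2" "bc u u1" "AE x in ?M. f x = u x"
      "AE x in ?M. g x = - u2 x + complex_of_real (q x) * u x" "f \<in> L2 ?M" "g \<in> L2 ?M" by (rule schroedingerE)
    from that(2) obtain v v1 v2 where v: "H2_on I v v1 v2" "bc v v1" "AE x in ?M. f' x = v x"
      "AE x in ?M. g' x = - v2 x + complex_of_real (q x) * v x" "f' \<in> L2 ?M" "g' \<in> L2 ?M" by (rule schroedingerE)
    show ?thesis
    proof (rule schroedingerI[where bc=bc, OF H2_on_add[OF u(1) v(1)] bc_add[OF u(2) v(2)]])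
      show "AE x in ?M. f x + f' x = u x + v x" using u(3) v(3) by eventually_elim simp
      show "AE x in ?M. g x + g' x = - (u2 x + v2 x) + complex_of_real (q x) * (u x + v x)" using u(4) v(4) by eventually_elim (simp add: distrib_left)
    qed (use u v in auto)
  qed
  show "(\<lambda>x. c * f x, \<lambda>x. c * g x) \<in> schroedinger I bc q" if "(f, g) \<in> schroedinger I bc q" for f g c
  proof -
    from that obtain u u1 u2 where u: "H2_on I u u1 u2" "bc u u1" "AE x in ?M. f x = u x"
      "AE x in ?M. g x = - u2 x + complex_of_real (q x) * u x" "f \<in> L2 ?M" "g \<in> L2 ?M" by (rule schroedingerE)
    show ?thesis
    proof (rule schroedingerI[where bc=bc, OF H2_on_scale[OF u(1)] bc_scale[OF u(2)]])
      show "AE x in ?M. c * f x = c * u x" using u(3) by eventually_elim simp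
      show "AE x in ?M. c * g x = - (c * u2 x) + complex_of_real (q x) * (c * u x)" using u(4) by eventually_elim (simp add: right_diff_distrib mult.left_commute)
    qed (use u in auto)
  qed
  show "ip ?M g f' = ip ?M f g'" if "(f, g) \<in> schroedinger I bc q" "(f', g') \<in> schroedinger I bc q" for f g f' g'
  proof -
    from that(1) obtain u u1 u2 where u: "H2_on I u u1 u2" "bc u u1" "AE x in ?M. f x = u x"
      "AE x in ?M. g x = - u2 x + complex_of_real (q x) * u x" "f \<in> L2 ?M" "g \<in> L2 ?M" by (rule schroedingerE)
    from that(2) obtain v v1 v2 where v: "H2_on I v v1 v2" "bc v v1" "AE x in ?M. f' x = v x"
      "AE x in ?M. g' x = - v2 x + complex_of_real (q x) * v x" "f' \<in> L2 ?M" "g' \<in> L2 ?M" by (rule schroedingerE)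
    note U = H2_onD[OF u(1)] and V = H2_onD[OF v(1)]
    have q': "cmod (complex_of_real (q x)) \<le> K" if "x \<in> space ?M" for x using q(2) that by simp
    have qu: "(\<lambda>x. complex_of_real (q x) * u x) \<in> L2 ?M" by (rule L2_mult_bounded[OF q(1) q' U(3)])
    have qv: "(\<lambda>x. complex_of_real (q x) * v x) \<in> L2 ?M" by (rule L2_mult_bounded[OF q(1) q' V(3)])
    have "ip ?M g f' = ip ?M (\<lambda>x. complex_of_real (q x) * u x - u2 x) v"
      using u v U V qu by (intro ip_cong_AE L2_measurable L2_diff) auto
    also have "\<dots> = ip ?M (\<lambda>x. complex_of_real (q x) * u x) v - ip ?M u2 v" by (rule ip_diff_left[OF qu U(5) V(3)])
    also have "ip ?M u2 v = ip ?M u v2" by (rule H2_on_Green[OF I u(1) v(1)]) (rule bc_sym[OF _ u(2) v(2)])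
    also have "ip ?M (\<lambda>x. complex_of_real (q x) * u x) v = ip ?M u (\<lambda>x. complex_of_real (q x) * v x)"
      by (simp add: ip_def mult_ac)
    also have "ip ?M u (\<lambda>x. complex_of_real (q x) * v x) - ip ?M u v2 = ip ?M u (\<lambda>x. complex_of_real (q x) * v x - v2 x)"
      by (rule ip_diff_right[OF qv V(5) U(3), symmetric])
    also have "\<dots> = ip ?M f g'"
    proof (rule ip_cong_AE)
      show "AE x in ?M. complex_of_real (q x) * v x - v2 x = g' x" using v(4) by eventually_elim simp
      show "AE x in ?M. u x = f x" using u(3) by eventually_elim simp
    qed (use u v U V qv in \<open>auto intro!: L2_measurable L2_diff\<close>)
    finally show ?thesis .
  qed
qed

text \<open>Only the free equation has to be solved by hand. The potential is a bounded perturbation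
  and can be added at spectral parameters far from the real axis, one in each half-plane.\<close>

lemma selfadjoint_op_schroedinger:
  fixes q :: "real \<Rightarrow> real"
  assumes I: "I = UNIV \<or> I = {0<..}"
    and q: "(\<lambda>x. complex_of_real (q x)) \<in> borel_measurable (lebesgue_on I)" "\<And>x. x \<in> I \<Longrightarrow> \<bar>q x\<bar> \<le> K"
    and bc_add: "\<And>u u1 v v1. bc u u1 \<Longrightarrow> bc v v1 \<Longrightarrow> bc (\<lambda>x. u x + v x) (\<lambda>x. u1 x + v1 x)"
    and bc_scale: "\<And>u u1 c. bc u u1 \<Longrightarrow> bc (\<lambda>x. c * u x) (\<lambda>x. c * u1 x)"
    and bc_sym: "\<And>u u1 v v1. I = {0<..} \<Longrightarrow> bc u u1 \<Longrightarrow> bc v v1 \<Longrightarrow> u1 0 * cnj (v 0) = u 0 * cnj (v1 0)"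
    and free: "\<And>z k. Im z \<noteq> 0 \<Longrightarrow> k \<in> L2 (lebesgue_on I) \<Longrightarrow> \<exists>u u1. H2_on I u u1 (\<lambda>x. - z * u x - k x) \<and> bc u u1"
  shows "selfadjoint_op (lebesgue_on I) (schroedinger I bc q)"
proof -
  let ?M = "lebesgue_on I"
  interpret A: symmetric_op ?M "schroedinger I bc q"
    by (rule symmetric_op_schroedinger[where K=K]; fact)
  interpret A0: symmetric_op ?M "schroedinger I bc (\<lambda>x. 0)"
    by (rule symmetric_op_schroedinger[where K=0], fact I, simp, simp, fact bc_add, fact bc_scale, fact bc_sym)
  have K: "\<bar>K\<bar> \<ge> \<bar>q x\<bar>" if "x \<in> I" for x using q(2)[OF that] by simp
  have free_surj: "A0.surj_at z" if z: "Im z \<noteq> 0" for z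
    unfolding A0.surj_at_def
  proof
    fix k assume k: "k \<in> L2 ?M"
    from free[OF z k] obtain u u1 where u: "H2_on I u u1 (\<lambda>x. - z * u x - k x)" "bc u u1" by blast
    have "(u, \<lambda>x. k x + z * u x) \<in> schroedinger I bc (\<lambda>x. 0)"
      by (rule schroedingerI[where bc=bc, OF u]) (use H2_onD[OF u(1)] k in auto)
    then show "\<exists>f. (f, \<lambda>x. k x + z * f x) \<in> schroedinger I bc (\<lambda>x. 0)" by blast
  qed
  \<comment> \<open>At distance |K| + 1 from the real axis the free resolvent has norm at most 1 /
    (|K| + 1), so its product with the bound |K| of the potential is below 1.\<close>
  have surj: "A.surj_at z" if z: "\<bar>Im z\<bar> = \<bar>K\<bar> + 1" for z
    unfolding A.surj_at_def
  proof
    fix k assume k: "k \<in> L2 ?M"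
    have "\<exists>f. (f, \<lambda>x. k x - complex_of_real (q x) * f x + z * f x) \<in> schroedinger I bc (\<lambda>x. 0)"
    proof (rule A0.surj_perturb[where K="\<bar>K\<bar>" and C="1 / (\<bar>K\<bar> + 1)"])
      show "A0.surj_at z" using free_surj[of z] z by auto
      show "L2_norm ?M f \<le> 1 / (\<bar>K\<bar> + 1) * L2_norm ?M (\<lambda>x. g x - z * f x)" if "(f, g) \<in> schroedinger I bc (\<lambda>x. 0)" for f g
        using A0.norm_shift_ge[OF that, of z] unfolding z by (simp add: field_simps)
    qed (use q K k in \<open>auto simp: field_simps\<close>)
    then obtain f where f: "(f, \<lambda>x. k x - complex_of_real (q x) * f x + z * f x) \<in> schroedinger I bc (\<lambda>x. 0)" by blast
    then obtain u u1 u2 where u: "H2_on I u u1 u2" "bc u u1" "AE x in ?M. f x = u x"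
      "AE x in ?M. k x - complex_of_real (q x) * f x + z * f x = - u2 x + complex_of_real 0 * u x" "f \<in> L2 ?M" by (rule schroedingerE)
    have "(f, \<lambda>x. k x + z * f x) \<in> schroedinger I bc q"
    proof (rule schroedingerI[where bc=bc, OF u(1,2,3) _ u(5)])
      show "AE x in ?M. k x + z * f x = - u2 x + complex_of_real (q x) * u x"
        using u(3,4) by eventually_elim (simp add: algebra_simps)
    qed (use k u(5) in simp)
    then show "\<exists>f. (f, \<lambda>x. k x + z * f x) \<in> schroedinger I bc q" by blast
  qed
  show ?thesis
  proof
    show "\<exists>z. 0 < Im z \<and> A.surj_at z" by (rule exI[of _ "\<i> * complex_of_real (\<bar>K\<bar> + 1)"]) (auto intro!: surj)
    show "\<exists>z. Im z < 0 \<and> A.surj_at z" by (rule exI[of _ "- \<i> * complex_of_real (\<bar>K\<bar> + 1)"]) (auto intro!: surj)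
  qed
qed

text \<open>The positive real part selects the decaying exponential; the nonzero imaginary part
  later excludes that this exponential satisfies a selfadjoint boundary condition.\<close>

lemma csqrt_nonreal:
  assumes "Im z \<noteq> 0"
  shows "0 < Re (csqrt (- z))" "Im (csqrt (- z)) \<noteq> 0" "(csqrt (- z))\<^sup>2 = - z"
proof -
  show sq: "(csqrt (- z))\<^sup>2 = - z" by simp
  have "Im ((csqrt (- z))\<^sup>2) = 2 * Re (csqrt (- z)) * Im (csqrt (- z))" by (rule Im_power2)
  then have "Re (csqrt (- z)) * Im (csqrt (- z)) \<noteq> 0" using assms unfolding sq by auto
  then show "0 < Re (csqrt (- z))" "Im (csqrt (- z)) \<noteq> 0"
    using csqrt_principal[of "- z"] by auto
qed

lemma selfadjoint_line:
  fixes q :: "real \<Rightarrow> real"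
  assumes q: "q \<in> borel_measurable lebesgue" "\<And>x. \<bar>q x\<bar> \<le> K"
  shows "selfadjoint_op (lebesgue_on UNIV) (schroedinger_line q)"
  unfolding schroedinger_line_def
proof (rule selfadjoint_op_schroedinger[where K=K])
  fix z k assume z: "Im z \<noteq> 0" and k: "k \<in> L2 (lebesgue_on (UNIV :: real set))"
  obtain u u1 where u: "u \<in> L2 lebesgue" "u1 \<in> L2 lebesgue" "ac_deriv_on UNIV u u1" "ac_deriv_on UNIV u1 (\<lambda>x. (csqrt (- z))\<^sup>2 * u x - k x)"
    using free_resolvent_line[OF csqrt_nonreal(1)[OF z] k[unfolded lebesgue_on_UNIV_eq]] by blast
  then have "H2_on UNIV u u1 (\<lambda>x. - z * u x - k x)"
    using k unfolding H2_on_def csqrt_nonreal(3)[OF z] by (simp add: lebesgue_on_UNIV_eq)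
  then show "\<exists>u u1. H2_on UNIV u u1 (\<lambda>x. - z * u x - k x) \<and> True" by blast
next
  show "(\<lambda>x. complex_of_real (q x)) \<in> borel_measurable (lebesgue_on UNIV)"
    using q(1) by (simp add: lebesgue_on_UNIV_eq)
\<comment> \<open>The boundary symmetry is required only if \<open>UNIV = {0<..}\<close>, which is
  refuted by testing membership of 0.\<close>
qed (use q in \<open>auto simp: greaterThan_def dest!: arg_cong[where f="\<lambda>S. 0 \<in> S"]\<close>)

text \<open>The free equation is solved on the whole line with right-hand side extended by zero; a
  multiple of the decaying exponential then corrects the boundary value at 0.\<close>

lemma selfadjoint_half_line:
  fixes q :: "real \<Rightarrow> real"
  assumes q: "q \<in> borel_measurable (lebesgue_on {0<..})" "\<And>x. 0 < x \<Longrightarrow> \<bar>q x\<bar> \<le> K"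
  shows "selfadjoint_op (lebesgue_on {0<..}) (schroedinger_half_line \<theta> q)"
  unfolding schroedinger_half_line_def
proof (rule selfadjoint_op_schroedinger[where K=K])
  let ?c = "complex_of_real (cos \<theta>)" and ?s = "complex_of_real (sin \<theta>)"
  have cs: "?c * ?c + ?s * ?s = 1"
    by (metis (mono_tags, lifting) of_real_1 of_real_add of_real_mult power2_eq_square sin_cos_squared_add2)
  fix u u1 v v1 :: "real \<Rightarrow> complex"
  assume u: "?c * u 0 + ?s * u1 0 = 0" and v: "?c * v 0 + ?s * v1 0 = 0"
  have v': "?c * cnj (v 0) + ?s * cnj (v1 0) = 0"
    using arg_cong[OF v, of cnj] by simp
  \<comment> \<open>The boundary form. Both cos \<theta> and sin \<theta> times it vanish by the two
    boundary conditions, and cos and sin are not both zero.\<close>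
  let ?D = "u1 0 * cnj (v 0) - u 0 * cnj (v1 0)"
  have "?c * ?D = u1 0 * (?c * cnj (v 0) + ?s * cnj (v1 0)) - (?c * u 0 + ?s * u1 0) * cnj (v1 0)" by (simp add: algebra_simps)
  then have 1: "?c * ?D = 0" unfolding u v' by simp
  have "?s * ?D = (?c * u 0 + ?s * u1 0) * cnj (v 0) - u 0 * (?c * cnj (v 0) + ?s * cnj (v1 0))" by (simp add: algebra_simps)
  then have 2: "?s * ?D = 0" unfolding u v' by simp
  have "(?c * ?c + ?s * ?s) * ?D = ?c * (?c * ?D) + ?s * (?s * ?D)" by (simp only: distrib_right mult.assoc)
  then have "?D = 0" unfolding 1 2 cs by simp
  then show "u1 0 * cnj (v 0) = u 0 * cnj (v1 0)" by simp
next
  fix u u1 v v1 :: "real \<Rightarrow> complex"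
  let ?c = "complex_of_real (cos \<theta>)" and ?s = "complex_of_real (sin \<theta>)"
  assume "?c * u 0 + ?s * u1 0 = 0" "?c * v 0 + ?s * v1 0 = 0"
  then have "(?c * u 0 + ?s * u1 0) + (?c * v 0 + ?s * v1 0) = 0" by simp
  then show "?c * (u 0 + v 0) + ?s * (u1 0 + v1 0) = 0" by (simp add: distrib_left add_ac)
next
  let ?c = "complex_of_real (cos \<theta>)" and ?s = "complex_of_real (sin \<theta>)"
  fix z k assume z: "Im z \<noteq> 0" and k: "k \<in> L2 (lebesgue_on {0::real<..})"
  define \<kappa> where "\<kappa> = csqrt (- z)"
  have kap: "0 < Re \<kappa>" "Im \<kappa> \<noteq> 0" "\<kappa>\<^sup>2 = - z" using csqrt_nonreal[OF z] by (auto simp: \<kappa>_def)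
  \<comment> \<open>Extension by zero, so that the resolvent on the line applies; only the
    restriction of the solution to the half-line is kept.\<close>
  define k' where "k' x = (if 0 < x then k x else 0)" for x
  have k'eq: "k' = (\<lambda>x. indicator {0<..} x *\<^sub>R k x)" by (auto simp: k'_def fun_eq_iff)
  have k': "k' \<in> L2 lebesgue"
  proof -
    have "k' \<in> borel_measurable lebesgue"
      using L2_measurable[OF k] unfolding k'eq by (subst (asm) borel_measurable_restrict_space_iff) auto
    moreover have "integrable lebesgue (\<lambda>x. (cmod (k' x))\<^sup>2)"
    proof -
      have "integrable lebesgue (\<lambda>x. indicator {0<..} x *\<^sub>R (cmod (k x))\<^sup>2)"
        using L2_integrable[OF k] by (subst (asm) integrable_restrict_space) auto
      also have "(\<lambda>x. indicator {0<..} x *\<^sub>R (cmod (k x))\<^sup>2) = (\<lambda>x. (cmod (k' x))\<^sup>2)" by (auto simp: k'_def fun_eq_iff)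
      finally show ?thesis .
    qed
    ultimately show ?thesis by (simp add: L2_def)
  qed
  obtain u u1 where u: "u \<in> L2 lebesgue" "u1 \<in> L2 lebesgue" "ac_deriv_on UNIV u u1" "ac_deriv_on UNIV u1 (\<lambda>x. \<kappa>\<^sup>2 * u x - k' x)"
    using free_resolvent_line[OF kap(1) k'] by blast
  have cl: "closure {0<..} = {0::real..}" by simp
  have H: "H2_on {0<..} u u1 (\<lambda>x. \<kappa>\<^sup>2 * u x - k x)"
    unfolding H2_on_def cl
  proof (intro conjI)
    show "ac_deriv_on {0..} u u1" by (rule ac_deriv_on_subset[OF u(3)]) simp
    have "ac_deriv_on {0..} u1 (\<lambda>x. \<kappa>\<^sup>2 * u x - k' x)" by (rule ac_deriv_on_subset[OF u(4)]) simp
    then show "ac_deriv_on {0..} u1 (\<lambda>x. \<kappa>\<^sup>2 * u x - k x)"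
    proof (rule ac_deriv_on_AE_cong)
      show "AE x in lebesgue_on {0<..}. \<kappa>\<^sup>2 * u x - k' x = \<kappa>\<^sup>2 * u x - k x"
        using AE_space by eventually_elim (simp add: k'_def)
      have "{0..} - {0<..} = {0::real}" by auto
      then show "negligible ({0..} - {0::real<..})" by simp
    qed (auto simp: is_interval_ci)
    show uL: "u \<in> L2 (lebesgue_on {0<..})" "u1 \<in> L2 (lebesgue_on {0<..})" using L2_lebesgue_restrict[OF u(1), of "{0<..}"] L2_lebesgue_restrict[OF u(2), of "{0<..}"] by auto
    show "(\<lambda>x. \<kappa>\<^sup>2 * u x - k x) \<in> L2 (lebesgue_on {0<..})" using uL k by simp
  qed
  define e where "e t = exp (- \<kappa> * complex_of_real t)" for t
  have de: "(e has_vector_derivative - \<kappa> * e x) (at x)" for x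
  proof -
    have "((\<lambda>z. exp (- \<kappa> * z)) has_field_derivative - \<kappa> * e x) (at (complex_of_real x))"
      by (auto intro!: derivative_eq_intros simp: e_def)
    from has_vector_derivative_real_field[OF this] show ?thesis by (simp add: e_def[abs_def])
  qed
  have ac: "ac_deriv_on {0..} e (\<lambda>x. - \<kappa> * e x)"
  proof (rule ac_deriv_on_C1)
    show "(e has_vector_derivative - \<kappa> * e x) (at x within {0..})" for x by (rule has_vector_derivative_at_within[OF de])
    show "continuous_on {0..} (\<lambda>x. - \<kappa> * e x)" unfolding e_def by (intro continuous_intros)
  qed (rule is_interval_ci)
  have "e \<in> L2 (lebesgue_on {0..})" unfolding e_def by (rule exp_L2_half_line(1)[OF kap(1)])
  then have eL: "e \<in> L2 (lebesgue_on {0<..})" by (rule L2_restrict) auto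
  have He: "H2_on {0<..} e (\<lambda>x. - \<kappa> * e x) (\<lambda>x. - \<kappa> * (- \<kappa> * e x))"
    unfolding H2_on_def cl using eL ac ac_deriv_on_scale[OF ac, of "- \<kappa>"] by (intro conjI L2_scale) auto
  \<comment> \<open>This is the boundary functional of exp (- \<kappa> x). If it vanished, its
    imaginary part would give sin \<theta> = 0, since Im \<kappa> is nonzero, and then cos \<theta>
    = 0.\<close>
  have ne: "?c - \<kappa> * ?s \<noteq> 0"
  proof
    assume "?c - \<kappa> * ?s = 0"
    then have "Im (?c - \<kappa> * ?s) = 0" "Re (?c - \<kappa> * ?s) = 0" by auto
    then have "sin \<theta> = 0" "cos \<theta> = 0" using kap(2) by auto
    then show False using sin_cos_squared_add[of \<theta>] by simp
  qed
  \<comment> \<open>The coefficient for which \<open>u + \<alpha> * e\<close> satisfies the boundary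
    condition.\<close>
  define \<alpha> where "\<alpha> = - (?c * u 0 + ?s * u1 0) / (?c - \<kappa> * ?s)"
  have "H2_on {0<..} (\<lambda>x. u x + \<alpha> * e x) (\<lambda>x. u1 x + \<alpha> * (- \<kappa> * e x)) (\<lambda>x. (\<kappa>\<^sup>2 * u x - k x) + \<alpha> * (- \<kappa> * (- \<kappa> * e x)))"
    by (rule H2_on_add[OF H H2_on_scale[OF He]])
  moreover have "(\<lambda>x. (\<kappa>\<^sup>2 * u x - k x) + \<alpha> * (- \<kappa> * (- \<kappa> * e x))) = (\<lambda>x. - z * (u x + \<alpha> * e x) - k x)"
    unfolding kap(3)[symmetric] by (auto simp: algebra_simps power2_eq_square)
  moreover have "?c * (u 0 + \<alpha> * e 0) + ?s * (u1 0 + \<alpha> * (- \<kappa> * e 0)) = 0"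
  proof -
    have "?c * (u 0 + \<alpha> * e 0) + ?s * (u1 0 + \<alpha> * (- \<kappa> * e 0)) = (?c * u 0 + ?s * u1 0) + \<alpha> * (?c - \<kappa> * ?s)"
      by (simp add: e_def algebra_simps)
    also have "\<dots> = 0" using ne by (simp add: \<alpha>_def)
    finally show ?thesis .
  qed
  ultimately show "\<exists>u u1. H2_on {0<..} u u1 (\<lambda>x. - z * u x - k x) \<and> ?c * u 0 + ?s * u1 0 = 0" by auto
qed (use q in \<open>auto simp: mult.left_commute simp flip: distrib_left\<close>)

section \<open>Eigenspaces of the half-line operator\<close>

text \<open>The boundary condition confines the initial data (u 0, u1 0) to a complex line. A
  suitable nontrivial combination of two eigenfunctions therefore has zero initial data and vanishes
  by uniqueness.\<close>

lemma half_line_solutions_one_dim: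
  fixes q :: "real \<Rightarrow> real"
  assumes q: "\<And>x. 0 < x \<Longrightarrow> \<bar>q x\<bar> \<le> K"
    and f: "f \<in> eigenspace (lebesgue_on {0<..}) (schroedinger_half_line \<theta> q) (complex_of_real l)"
    and g: "g \<in> eigenspace (lebesgue_on {0<..}) (schroedinger_half_line \<theta> q) (complex_of_real l)"
  shows "\<exists>a b. (a \<noteq> 0 \<or> b \<noteq> 0) \<and> (AE x in lebesgue_on {0<..}. a * f x + b * g x = 0)"
proof -
  let ?M = "lebesgue_on {0<..} :: real measure"
  let ?c = "complex_of_real (cos \<theta>)" and ?s = "complex_of_real (sin \<theta>)"
  have ex: "\<exists>u u1 u2. H2_on {0<..} u u1 u2 \<and> ?c * u 0 + ?s * u1 0 = 0 \<and> (AE x in ?M. f x = u x) \<and>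
      (AE x in ?M. u2 x = complex_of_real (q x - l) * u x)"
    if "f \<in> eigenspace ?M (schroedinger_half_line \<theta> q) (complex_of_real l)" for f
  proof -
    from that obtain f' where f': "(f, f') \<in> schroedinger_half_line \<theta> q" "AE x in ?M. f' x = complex_of_real l * f x"
      by (auto simp: eigenspace_def)
    from f'(1) obtain u u1 u2 where u: "H2_on {0<..} u u1 u2" "?c * u 0 + ?s * u1 0 = 0" "AE x in ?M. f x = u x"
      "AE x in ?M. f' x = - u2 x + complex_of_real (q x) * u x"
      unfolding schroedinger_half_line_def by (rule schroedingerE)
    have "AE x in ?M. u2 x = complex_of_real (q x - l) * u x"
      using f'(2) u(3,4) by eventually_elim (simp add: algebra_simps)
    with u show ?thesis by blast
  qed
  obtain u u1 u2 where u: "H2_on {0<..} u u1 u2" "?c * u 0 + ?s * u1 0 = 0" "AE x in ?M. f x = u x"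
    "AE x in ?M. u2 x = complex_of_real (q x - l) * u x" using ex[OF f] by blast
  obtain v v1 v2 where v: "H2_on {0<..} v v1 v2" "?c * v 0 + ?s * v1 0 = 0" "AE x in ?M. g x = v x"
    "AE x in ?M. v2 x = complex_of_real (q x - l) * v x" using ex[OF g] by blast
  have cs: "?c * ?c + ?s * ?s = 1"
    by (metis (mono_tags, lifting) of_real_1 of_real_add of_real_mult power2_eq_square sin_cos_squared_add2)
  \<comment> \<open>Data satisfying the condition are multiples of (sin \<theta>, - cos \<theta>);
    the multiple is recovered by pairing the data with this unit vector.\<close>
  have param: "w0 = (?s * w0 - ?c * w1) * ?s \<and> w1 = - ((?s * w0 - ?c * w1) * ?c)" if "?c * w0 + ?s * w1 = 0" for w0 w1
  proof
    have "(?s * w0 - ?c * w1) * ?s = (?c * ?c + ?s * ?s) * w0 - ?c * (?c * w0 + ?s * w1)" by (simp add: algebra_simps)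
    then show "w0 = (?s * w0 - ?c * w1) * ?s" by (simp add: cs that)
    have "- ((?s * w0 - ?c * w1) * ?c) = (?c * ?c + ?s * ?s) * w1 - ?s * (?c * w0 + ?s * w1)" by (simp add: algebra_simps)
    then show "w1 = - ((?s * w0 - ?c * w1) * ?c)" by (simp add: cs that)
  qed
  define \<alpha> \<beta> where "\<alpha> = ?s * u 0 - ?c * u1 0" and "\<beta> = ?s * v 0 - ?c * v1 0"
  have pu: "u 0 = \<alpha> * ?s" "u1 0 = - (\<alpha> * ?c)" using param[OF u(2)] by (auto simp: \<alpha>_def)
  have pv: "v 0 = \<beta> * ?s" "v1 0 = - (\<beta> * ?c)" using param[OF v(2)] by (auto simp: \<beta>_def)
  have zero: "AE x in ?M. a * f x + b * g x = 0" if ab: "a * \<alpha> + b * \<beta> = 0" for a b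
  proof -
    let ?w = "\<lambda>x. a * u x + b * v x" and ?w1 = "\<lambda>x. a * u1 x + b * v1 x" and ?w2 = "\<lambda>x. a * u2 x + b * v2 x"
    have "H2_on {0<..} ?w ?w1 ?w2" by (intro H2_on_add H2_on_scale u v)
    note W = H2_half_lineD[OF this]
    have w0: "?w x = 0" if "0 \<le> x" for x
    proof (rule half_line_uniqueness[OF W(1,2), where Q="\<lambda>x. q x - l" and K="K + \<bar>l\<bar>"])
      have "?w 0 = (a * \<alpha> + b * \<beta>) * ?s" unfolding pu pv by (simp add: algebra_simps)
      then show "?w 0 = 0" by (simp add: ab)
      have "?w1 0 = - ((a * \<alpha> + b * \<beta>) * ?c)" unfolding pu pv by (simp add: algebra_simps)
      then show "?w1 0 = 0" by (simp add: ab)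
      show "AE x in ?M. ?w2 x = complex_of_real (q x - l) * ?w x"
        using u(4) v(4) by eventually_elim (simp add: distrib_left mult.left_commute)
      show "\<bar>q x - l\<bar> \<le> K + \<bar>l\<bar>" if "0 < x" for x using q[OF that] by arith
    qed (rule that)
    show ?thesis using u(3) v(3) AE_space by eventually_elim (use w0 in auto)
  qed
  show ?thesis
  proof (cases "\<alpha> = 0 \<and> \<beta> = 0")
    case True
    then show ?thesis using zero[of 1 0] by (intro exI[of _ 1] exI[of _ 0]) auto
  next
    case False
    then show ?thesis using zero[of \<beta> "- \<alpha>"] by (intro exI[of _ \<beta>] exI[of _ "- \<alpha>"]) (auto simp: mult.commute)
  qed
qed

lemma L2_finite_dim_one_dim:
  assumes L2: "E \<subseteq> L2 M" and one: "\<And>f g. f \<in> E \<Longrightarrow> g \<in> E \<Longrightarrow> \<exists>a b. (a \<noteq> 0 \<or> b \<noteq> 0) \<and> (AE x in M. a * f x + b * g x = 0)"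
  shows "L2_finite_dim M E"
proof (cases "\<forall>f\<in>E. AE x in M. f x = 0")
  case True
  then show ?thesis unfolding L2_finite_dim_def by (intro exI[of _ "{}"]) auto
next
  case False
  then obtain h where h: "h \<in> E" "\<not> (AE x in M. h x = 0)" by blast
  have "\<exists>c. AE x in M. f x = (\<Sum>b\<in>{h}. c b * b x)" if f: "f \<in> E" for f
  proof -
    obtain a b where ab: "a \<noteq> 0 \<or> b \<noteq> 0" "AE x in M. a * h x + b * f x = 0" using one[OF h(1) f] by blast
    have "b \<noteq> 0"
    proof
      assume "b = 0"
      with ab have "a \<noteq> 0" by simp
      have "AE x in M. h x = 0" using ab(2) by eventually_elim (use \<open>a \<noteq> 0\<close> \<open>b = 0\<close> in simp)
      with h(2) show False by blast
    qed
    have "AE x in M. f x = (- a / b) * h x"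
      using ab(2) by eventually_elim (use \<open>b \<noteq> 0\<close> in \<open>simp add: field_simps add_eq_0_iff2\<close>)
    then show ?thesis by (intro exI[of _ "\<lambda>_. - a / b"]) simp
  qed
  then show ?thesis unfolding L2_finite_dim_def using h L2 by (intro exI[of _ "{h}"]) auto
qed

section \<open>Change of variables and cut-offs\<close>

text \<open>Preimages of Lebesgue sets under a continuous map need not be Lebesgue measurable. Here
  the preimage is rewritten as an image under the differentiable inverse \<open>\<psi>\<close>, and
  differentiable images of Lebesgue sets are Lebesgue measurable.\<close>

lemma measurable_compose_diffeo:
  fixes h :: "real \<Rightarrow> 'a::topological_space"
  assumes h: "h \<in> borel_measurable (lebesgue_on T)" and S: "S \<in> sets lebesgue" and T: "T \<in> sets lebesgue"
    and phi: "\<phi> differentiable_on S" "\<phi> ` S \<subseteq> T" and psi: "\<psi> differentiable_on \<phi> ` S" "\<And>x. x \<in> S \<Longrightarrow> \<psi> (\<phi> x) = x"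
  shows "(\<lambda>x::real. h (\<phi> x)) \<in> borel_measurable (lebesgue_on S)"
proof (rule measurableI)
  fix B :: "'a set" assume B: "B \<in> sets borel"
  have im: "\<phi> ` S \<in> sets lebesgue" by (rule differentiable_image_in_sets_lebesgue[OF S _ phi(1)]) simp
  have "h -` B \<inter> space (lebesgue_on T) \<in> sets (lebesgue_on T)" using h B by (rule measurable_sets)
  then have hB: "h -` B \<inter> T \<in> sets lebesgue" using T by (auto simp: sets_restrict_space_iff)
  then have "h -` B \<inter> T \<inter> \<phi> ` S \<in> sets lebesgue" using im by blast
  then have "\<psi> ` (h -` B \<inter> T \<inter> \<phi> ` S) \<in> sets lebesgue"
    by (rule differentiable_image_in_sets_lebesgue) (auto intro: differentiable_on_subset[OF psi(1)])
  moreover have "(\<lambda>x. h (\<phi> x)) -` B \<inter> space (lebesgue_on S) = \<psi> ` (h -` B \<inter> T \<inter> \<phi> ` S)"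
    using phi(2) psi(2) by (force simp: image_iff)
  ultimately show "(\<lambda>x. h (\<phi> x)) -` B \<inter> space (lebesgue_on S) \<in> sets (lebesgue_on S)"
    using S by (auto simp: sets_restrict_space_iff)
qed auto

text \<open>With a Jacobian between 1/2 and 2, squared norms change at most by the factor 2. The
  lower estimate concerns the image of S only, because nothing is known of h outside it.\<close>

lemma L2_compose:
  assumes h: "h \<in> L2 (lebesgue_on T)" and S: "S \<in> sets lebesgue" and T: "T \<in> sets lebesgue"
    and phi: "\<And>x. x \<in> S \<Longrightarrow> (\<phi> has_real_derivative \<phi>1 x) (at x within S)" "\<phi> ` S \<subseteq> T"
    and psi: "\<psi> differentiable_on \<phi> ` S" "\<And>x. x \<in> S \<Longrightarrow> \<psi> (\<phi> x) = x"
    and bd: "\<And>x. x \<in> S \<Longrightarrow> 1 / 2 \<le> \<phi>1 x" "\<And>x. x \<in> S \<Longrightarrow> \<phi>1 x \<le> 2"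
  shows "(\<lambda>x. h (\<phi> x)) \<in> L2 (lebesgue_on S)"
    "L2_norm (lebesgue_on S) (\<lambda>x. h (\<phi> x)) \<le> 2 * L2_norm (lebesgue_on T) h"
    "L2_norm (lebesgue_on (\<phi> ` S)) h \<le> 2 * L2_norm (lebesgue_on S) (\<lambda>x. h (\<phi> x))"
proof -
  have dphi: "\<phi> differentiable_on S"
    using phi(1) unfolding differentiable_on_def real_differentiable_def by blast
  have im: "\<phi> ` S \<in> sets lebesgue" by (rule differentiable_image_in_sets_lebesgue[OF S _ dphi]) simp
  have inj: "inj_on \<phi> S" using psi(2) by (metis inj_onI)
  have m: "(\<lambda>x. h (\<phi> x)) \<in> borel_measurable (lebesgue_on S)"
    by (rule measurable_compose_diffeo[OF L2_measurable[OF h] S T dphi phi(2) psi])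
  have hr: "h \<in> L2 (lebesgue_on (\<phi> ` S))" "L2_norm (lebesgue_on (\<phi> ` S)) h \<le> L2_norm (lebesgue_on T) h"
    using L2_restrict[OF h phi(2) im T] by auto
  let ?F = "\<lambda>x. (cmod (h x))\<^sup>2"
  have "?F absolutely_integrable_on \<phi> ` S"
    using L2_integrable[OF hr(1)] integrable_lebesgue_on_iff[OF im] by blast
  moreover have I: "integral (\<phi> ` S) ?F = (L2_norm (lebesgue_on (\<phi> ` S)) h)\<^sup>2"
    using integral_norm_square[OF hr(1) im] by (rule integral_unique)
  ultimately have G: "(\<lambda>x. \<bar>\<phi>1 x\<bar> * ?F (\<phi> x)) absolutely_integrable_on S"
    "integral S (\<lambda>x. \<bar>\<phi>1 x\<bar> * ?F (\<phi> x)) = (L2_norm (lebesgue_on (\<phi> ` S)) h)\<^sup>2"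
    using has_absolute_integral_change_of_variables_1'[OF S phi(1) inj, of ?F "(L2_norm (lebesgue_on (\<phi> ` S)) h)\<^sup>2"] by blast+
  have Gi: "integrable (lebesgue_on S) (\<lambda>x. \<bar>\<phi>1 x\<bar> * ?F (\<phi> x))" using G(1) integrable_lebesgue_on_iff[OF S] by blast
  have GI: "(\<integral>x. \<bar>\<phi>1 x\<bar> * ?F (\<phi> x) \<partial>lebesgue_on S) = (L2_norm (lebesgue_on (\<phi> ` S)) h)\<^sup>2"
    using lebesgue_integral_eq_integral[OF Gi S] G(2) by simp
  have ib: "integrable (lebesgue_on S) (\<lambda>x. ?F (\<phi> x))"
  proof (rule Bochner_Integration.integrable_bound)
    show "integrable (lebesgue_on S) (\<lambda>x. 2 * (\<bar>\<phi>1 x\<bar> * ?F (\<phi> x)))" using Gi by simp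
    show "(\<lambda>x. ?F (\<phi> x)) \<in> borel_measurable (lebesgue_on S)" using m by measurable
    show "AE x in lebesgue_on S. norm (?F (\<phi> x)) \<le> norm (2 * (\<bar>\<phi>1 x\<bar> * ?F (\<phi> x)))"
    proof (rule AE_I2)
      fix x assume "x \<in> space (lebesgue_on S)"
      then have "1 \<le> 2 * \<bar>\<phi>1 x\<bar>" using bd(1)[of x] by simp
      then have "1 * ?F (\<phi> x) \<le> (2 * \<bar>\<phi>1 x\<bar>) * ?F (\<phi> x)" by (rule mult_right_mono) simp
      then show "norm (?F (\<phi> x)) \<le> norm (2 * (\<bar>\<phi>1 x\<bar> * ?F (\<phi> x)))" by (simp add: abs_mult)
    qed
  qed
  show L: "(\<lambda>x. h (\<phi> x)) \<in> L2 (lebesgue_on S)" using m ib by (simp add: L2_def)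
  show "L2_norm (lebesgue_on S) (\<lambda>x. h (\<phi> x)) \<le> 2 * L2_norm (lebesgue_on T) h"
  proof (rule power2_le_imp_le)
    have "(L2_norm (lebesgue_on S) (\<lambda>x. h (\<phi> x)))\<^sup>2 = (\<integral>x. ?F (\<phi> x) \<partial>lebesgue_on S)" by (simp add: L2_norm_square)
    also have "\<dots> \<le> (\<integral>x. 2 * (\<bar>\<phi>1 x\<bar> * ?F (\<phi> x)) \<partial>lebesgue_on S)"
    proof (rule integral_mono[OF ib])
      fix x assume "x \<in> space (lebesgue_on S)"
      then have "1 \<le> 2 * \<bar>\<phi>1 x\<bar>" using bd(1)[of x] by simp
      then have "1 * ?F (\<phi> x) \<le> (2 * \<bar>\<phi>1 x\<bar>) * ?F (\<phi> x)" by (rule mult_right_mono) simp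
      then show "?F (\<phi> x) \<le> 2 * (\<bar>\<phi>1 x\<bar> * ?F (\<phi> x))" by simp
    qed (use Gi in simp)
    also have "\<dots> = 2 * (L2_norm (lebesgue_on (\<phi> ` S)) h)\<^sup>2" by (simp add: GI)
    also have "\<dots> \<le> 2 * (L2_norm (lebesgue_on T) h)\<^sup>2" using hr(2) by (simp add: power_mono)
    also have "\<dots> \<le> (2 * L2_norm (lebesgue_on T) h)\<^sup>2" by (simp add: power_mult_distrib)
    finally show "(L2_norm (lebesgue_on S) (\<lambda>x. h (\<phi> x)))\<^sup>2 \<le> (2 * L2_norm (lebesgue_on T) h)\<^sup>2" .
  qed simp
  show "L2_norm (lebesgue_on (\<phi> ` S)) h \<le> 2 * L2_norm (lebesgue_on S) (\<lambda>x. h (\<phi> x))"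
  proof (rule power2_le_imp_le)
    have "(L2_norm (lebesgue_on (\<phi> ` S)) h)\<^sup>2 = (\<integral>x. \<bar>\<phi>1 x\<bar> * ?F (\<phi> x) \<partial>lebesgue_on S)" by (simp add: GI)
    also have "\<dots> \<le> (\<integral>x. 2 * ?F (\<phi> x) \<partial>lebesgue_on S)"
    proof (rule integral_mono[OF Gi])
      fix x assume "x \<in> space (lebesgue_on S)"
      then have "\<bar>\<phi>1 x\<bar> \<le> 2" using bd[of x] by simp
      then show "\<bar>\<phi>1 x\<bar> * ?F (\<phi> x) \<le> 2 * ?F (\<phi> x)" by (rule mult_right_mono) simp
    qed (use ib in simp)
    also have "\<dots> = 2 * (L2_norm (lebesgue_on S) (\<lambda>x. h (\<phi> x)))\<^sup>2" by (simp add: L2_norm_square)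
    also have "\<dots> \<le> (2 * L2_norm (lebesgue_on S) (\<lambda>x. h (\<phi> x)))\<^sup>2" by (simp add: power_mult_distrib)
    finally show "(L2_norm (lebesgue_on (\<phi> ` S)) h)\<^sup>2 \<le> (2 * L2_norm (lebesgue_on S) (\<lambda>x. h (\<phi> x)))\<^sup>2" .
  qed simp
qed

lemma L2_extend:
  assumes f: "f \<in> L2 (lebesgue_on S)" and sub: "S \<subseteq> T" and S: "S \<in> sets lebesgue" and T: "T \<in> sets lebesgue"
    and zero: "\<And>x. x \<in> T \<Longrightarrow> x \<notin> S \<Longrightarrow> f x = 0"
  shows "f \<in> L2 (lebesgue_on T)" "L2_norm (lebesgue_on T) f = L2_norm (lebesgue_on S) f"
proof -
  have eq: "indicator T x *\<^sub>R f x = indicator S x *\<^sub>R f x" for x using sub zero by (auto split: split_indicator)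
  have m: "f \<in> borel_measurable (lebesgue_on T)"
    using L2_measurable[OF f] S T by (simp add: borel_measurable_restrict_space_iff eq)
  have "(\<integral>\<^sup>+x. ennreal ((cmod (f x))\<^sup>2) \<partial>lebesgue_on T) = (\<integral>\<^sup>+x. ennreal ((cmod (f x))\<^sup>2) \<partial>lebesgue_on S)"
    using S T sub zero by (auto simp: nn_integral_restrict_space intro!: nn_integral_cong split: split_indicator)
  also have "\<dots> = ennreal ((L2_norm (lebesgue_on S) f)\<^sup>2)" by (rule L2_nn_integral[OF f])
  finally have n: "(\<integral>\<^sup>+x. ennreal ((cmod (f x))\<^sup>2) \<partial>lebesgue_on T) \<le> ennreal ((L2_norm (lebesgue_on S) f)\<^sup>2)" by simp
  show fT: "f \<in> L2 (lebesgue_on T)" by (rule L2I_nn_integral(1)[OF m n]) simp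
  show "L2_norm (lebesgue_on T) f = L2_norm (lebesgue_on S) f"
    using L2I_nn_integral(2)[OF m n] L2_restrict(2)[OF fT sub S T] by simp
qed

text \<open>The chain rule used twice. The second derivative of u \<circ> \<phi> acquires the factor
  \<open>\<phi>1\<close>^2 on u2 and the extra first order term with \<open>\<phi>2\<close>; these
  are the error terms of the substitution.\<close>

lemma ac_transplant:
  assumes u: "ac_deriv_on I u u1" "ac_deriv_on I u1 u2"
    and phi: "\<And>x. c \<le> x \<Longrightarrow> (\<phi> has_real_derivative \<phi>1 x) (at x)" "\<And>x. c \<le> x \<Longrightarrow> (\<phi>1 has_real_derivative \<phi>2 x) (at x)"
      "continuous_on {c..} \<phi>2" "\<And>x. c \<le> x \<Longrightarrow> 0 < \<phi>1 x" "\<phi> ` {c..} \<subseteq> I"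
  shows "ac_deriv_on {c..} (\<lambda>x. u (\<phi> x)) (\<lambda>x. complex_of_real (\<phi>1 x) * u1 (\<phi> x))"
    "ac_deriv_on {c..} (\<lambda>x. complex_of_real (\<phi>1 x) * u1 (\<phi> x))
      (\<lambda>x. complex_of_real (\<phi>2 x) * u1 (\<phi> x) + complex_of_real (\<phi>1 x) * (complex_of_real (\<phi>1 x) * u2 (\<phi> x)))"
proof -
  show "ac_deriv_on {c..} (\<lambda>x. u (\<phi> x)) (\<lambda>x. complex_of_real (\<phi>1 x) * u1 (\<phi> x))"
    by (rule ac_deriv_on_compose[OF u(1)]) (use phi in \<open>auto simp: is_interval_ci\<close>)
  have 1: "ac_deriv_on {c..} (\<lambda>x. u1 (\<phi> x)) (\<lambda>x. complex_of_real (\<phi>1 x) * u2 (\<phi> x))"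
    by (rule ac_deriv_on_compose[OF u(2)]) (use phi in \<open>auto simp: is_interval_ci\<close>)
  have 2: "ac_deriv_on {c..} (\<lambda>x. complex_of_real (\<phi>1 x)) (\<lambda>x. complex_of_real (\<phi>2 x))"
  proof (rule ac_deriv_on_C1)
    show "((\<lambda>x. complex_of_real (\<phi>1 x)) has_vector_derivative complex_of_real (\<phi>2 x)) (at x within {c..})" if "x \<in> {c..}" for x
      using phi(2)[of x] that
      by (intro has_vector_derivative_of_real has_vector_derivative_at_within) (auto simp: has_real_derivative_iff_has_vector_derivative)
    show "continuous_on {c..} (\<lambda>x. complex_of_real (\<phi>2 x))" using phi(3) by (intro continuous_intros)
  qed (rule is_interval_ci)
  show "ac_deriv_on {c..} (\<lambda>x. complex_of_real (\<phi>1 x) * u1 (\<phi> x))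
      (\<lambda>x. complex_of_real (\<phi>2 x) * u1 (\<phi> x) + complex_of_real (\<phi>1 x) * (complex_of_real (\<phi>1 x) * u2 (\<phi> x)))"
    by (rule ac_deriv_on_mult[OF 2 1 is_interval_ci])
qed

lemma ac_deriv_on_cutoff:
  assumes a: "\<And>x. (a has_real_derivative a1 x) (at x)" "\<And>x. (a1 has_real_derivative a2 x) (at x)" "continuous_on UNIV a2"
    and u: "ac_deriv_on I u u1" "ac_deriv_on I u1 u2" and I: "is_interval I"
  shows "ac_deriv_on I (\<lambda>x. complex_of_real (a x) * u x) (\<lambda>x. complex_of_real (a1 x) * u x + complex_of_real (a x) * u1 x)"
    "ac_deriv_on I (\<lambda>x. complex_of_real (a1 x) * u x + complex_of_real (a x) * u1 x)
      (\<lambda>x. complex_of_real (a2 x) * u x + 2 * complex_of_real (a1 x) * u1 x + complex_of_real (a x) * u2 x)"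
proof -
  have ac: "ac_deriv_on I (\<lambda>x. complex_of_real (f x)) (\<lambda>x. complex_of_real (f1 x))"
    if "\<And>x. (f has_real_derivative f1 x) (at x)" "continuous_on UNIV f1" for f f1
  proof (rule ac_deriv_on_C1)
    show "((\<lambda>x. complex_of_real (f x)) has_vector_derivative complex_of_real (f1 x)) (at x within I)" if "x \<in> I" for x
      using \<open>(f has_real_derivative f1 x) (at x)\<close>
      by (intro has_vector_derivative_of_real has_vector_derivative_at_within) (auto simp: has_real_derivative_iff_has_vector_derivative)
    show "continuous_on I (\<lambda>x. complex_of_real (f1 x))" using that(2) by (intro continuous_intros) (auto intro: continuous_on_subset)
  qed (rule I)
  have "continuous_on UNIV a1" using a(2) by (intro DERIV_continuous_on)
  note A = ac[OF a(1) this] and A1 = ac[OF a(2,3)]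
  show "ac_deriv_on I (\<lambda>x. complex_of_real (a x) * u x) (\<lambda>x. complex_of_real (a1 x) * u x + complex_of_real (a x) * u1 x)"
    by (rule ac_deriv_on_mult[OF A u(1) I])
  have "ac_deriv_on I (\<lambda>x. complex_of_real (a1 x) * u x + complex_of_real (a x) * u1 x)
     (\<lambda>x. (complex_of_real (a2 x) * u x + complex_of_real (a1 x) * u1 x) + (complex_of_real (a1 x) * u1 x + complex_of_real (a x) * u2 x))"
    by (intro ac_deriv_on_add ac_deriv_on_mult A A1 u I)
  then show "ac_deriv_on I (\<lambda>x. complex_of_real (a1 x) * u x + complex_of_real (a x) * u1 x)
      (\<lambda>x. complex_of_real (a2 x) * u x + 2 * complex_of_real (a1 x) * u1 x + complex_of_real (a x) * u2 x)"
    by (simp add: algebra_simps)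
qed

section \<open>A twice continuously differentiable cut-off\<close>

lemma max_power_has_derivative:
  "((\<lambda>t. (max 0 t) ^ (Suc (Suc n))) has_real_derivative real (Suc (Suc n)) * (max 0 t) ^ Suc n) (at t)"
proof -
  consider "0 < t" | "t < 0" | "t = 0" by linarith
  then show ?thesis
  proof cases
    case 1
    have "((\<lambda>t. t ^ (Suc (Suc n))) has_real_derivative real (Suc (Suc n)) * t ^ Suc n) (at t)"
      using DERIV_pow[of "Suc (Suc n)" t] by simp
    moreover have "\<forall>\<^sub>F s in nhds t. (max 0 s) ^ (Suc (Suc n)) = s ^ (Suc (Suc n))"
      using eventually_nhds_in_open[of "{0<..}" t] 1 by (auto elim: eventually_mono)
    ultimately show ?thesis using 1 by (subst DERIV_cong_ev[OF refl _ refl]) auto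
  next
    case 2
    have "\<forall>\<^sub>F s in nhds t. (max 0 s) ^ (Suc (Suc n)) = (0::real)"
      using eventually_nhds_in_open[of "{..<0}" t] 2 by (auto elim!: eventually_mono)
    note ev = this
    have "((\<lambda>t. (max 0 t) ^ (Suc (Suc n))) has_real_derivative 0) (at t)"
      by (rule iffD2[OF DERIV_cong_ev[OF refl ev refl]]) simp
    then show ?thesis using 2 by simp
  next
    case 3
    have "((\<lambda>h. ((max 0 (0 + h)) ^ (Suc (Suc n)) - (max 0 0) ^ (Suc (Suc n))) / h) \<longlongrightarrow> 0) (at (0::real))"
    proof (rule Lim_null_comparison)
      show "\<forall>\<^sub>F h in at 0. norm (((max 0 (0 + h)) ^ (Suc (Suc n)) - (max 0 0) ^ (Suc (Suc n))) / h) \<le> \<bar>h\<bar> ^ Suc n"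
        by (rule always_eventually) (auto simp: max_def intro!: mult_nonpos_nonneg)
      show "((\<lambda>h. \<bar>h\<bar> ^ Suc n) \<longlongrightarrow> 0) (at (0::real))" by (auto intro!: tendsto_eq_intros)
    qed
    then show ?thesis using 3 by (simp add: DERIV_def)
  qed
qed

text \<open>The integral of the quadratic B-spline: a \<open>C\<^sup>2\<close> transition from 0 (left of 0) to 1 (right of 3).\<close>

definition ramp :: "real \<Rightarrow> real" where
  "ramp t = ((max 0 t)^3 - 3 * (max 0 (t - 1))^3 + 3 * (max 0 (t - 2))^3 - (max 0 (t - 3))^3) / 6"

text \<open>The quadratic B-spline with knots 0, 1, 2, 3 in truncated powers; the coefficients 1,
  -3, 3, -1 are those of a third difference.\<close>

definition ramp1 :: "real \<Rightarrow> real" where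
  "ramp1 t = ((max 0 t)^2 - 3 * (max 0 (t - 1))^2 + 3 * (max 0 (t - 2))^2 - (max 0 (t - 3))^2) / 2"

definition ramp2 :: "real \<Rightarrow> real" where
  "ramp2 t = max 0 t - 3 * max 0 (t - 1) + 3 * max 0 (t - 2) - max 0 (t - 3)"

lemma max_power_shift_has_derivative:
  "((\<lambda>t. (max 0 (t - s)) ^ 3) has_real_derivative 3 * (max 0 (t - s))^2) (at t)"
  "((\<lambda>t. (max 0 (t - s)) ^ 2) has_real_derivative 2 * max 0 (t - s)) (at t)"
proof -
  have d: "((\<lambda>t. t - s) has_real_derivative 1) (at t)" by (auto intro!: derivative_eq_intros)
  show "((\<lambda>t. (max 0 (t - s)) ^ 3) has_real_derivative 3 * (max 0 (t - s))^2) (at t)"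
    using DERIV_chain2[OF max_power_has_derivative[of 1 "t - s"] d] by (simp add: numeral_eq_Suc)
  show "((\<lambda>t. (max 0 (t - s)) ^ 2) has_real_derivative 2 * max 0 (t - s)) (at t)"
    using DERIV_chain2[OF max_power_has_derivative[of 0 "t - s"] d] by (simp add: numeral_eq_Suc)
qed

lemma ramp_has_derivative: "(ramp has_real_derivative ramp1 t) (at t)"
proof -
  note d = max_power_shift_has_derivative(1)[where t=t]
  have d0: "((\<lambda>t. (max 0 t) ^ 3) has_real_derivative 3 * (max 0 t)^2) (at t)" using d[of 0] by simp
  show ?thesis
    unfolding ramp_def[abs_def]
    by (rule DERIV_cong[OF DERIV_cdivide[OF DERIV_diff[OF DERIV_add[OF DERIV_diff[OF d0 DERIV_cmult[OF d]] DERIV_cmult[OF d]] d]]])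
       (simp add: ramp1_def field_simps)
qed

lemma ramp1_has_derivative: "(ramp1 has_real_derivative ramp2 t) (at t)"
proof -
  note d = max_power_shift_has_derivative(2)[where t=t]
  have d0: "((\<lambda>t. (max 0 t) ^ 2) has_real_derivative 2 * max 0 t) (at t)" using d[of 0] by simp
  show ?thesis
    unfolding ramp1_def[abs_def]
    by (rule DERIV_cong[OF DERIV_cdivide[OF DERIV_diff[OF DERIV_add[OF DERIV_diff[OF d0 DERIV_cmult[OF d]] DERIV_cmult[OF d]] d]]])
       (simp add: ramp2_def field_simps)
qed

lemma continuous_ramp: "continuous_on S ramp" "continuous_on S ramp1" "continuous_on S ramp2"
  unfolding ramp_def ramp1_def ramp2_def by (intro continuous_intros; simp)+

lemma ramp_left: "t \<le> 0 \<Longrightarrow> ramp t = 0" "t \<le> 0 \<Longrightarrow> ramp1 t = 0" "t \<le> 0 \<Longrightarrow> ramp2 t = 0"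
  by (auto simp: ramp_def ramp1_def ramp2_def)

text \<open>Beyond 3 no truncation is active, and the third difference of t^3 is 6, while that of
  polynomials of degree at most two is 0.\<close>

lemma ramp_right: "3 \<le> t \<Longrightarrow> ramp t = 1" "3 \<le> t \<Longrightarrow> ramp1 t = 0" "3 \<le> t \<Longrightarrow> ramp2 t = 0"
  by (auto simp: ramp_def ramp1_def ramp2_def power2_eq_square power3_eq_cube algebra_simps)

lemma ramp_bound:
  obtains B where "1 \<le> B" "\<And>t. \<bar>ramp t\<bar> \<le> B" "\<And>t. \<bar>ramp1 t\<bar> \<le> B" "\<And>t. \<bar>ramp2 t\<bar> \<le> B"
proof -
  have ex: "\<exists>B. \<forall>t\<in>{0..3}. \<bar>f t\<bar> \<le> B" if "continuous_on {0..3} f" for f :: "real \<Rightarrow> real"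
  proof -
    have "bounded (f ` {0..3})" using that by (intro compact_imp_bounded compact_continuous_image) auto
    then show ?thesis by (auto simp: bounded_iff)
  qed
  obtain B0 where B0: "\<forall>t\<in>{0..3}. \<bar>ramp t\<bar> \<le> B0" using ex[OF continuous_ramp(1)] by blast
  obtain B1 where B1: "\<forall>t\<in>{0..3}. \<bar>ramp1 t\<bar> \<le> B1" using ex[OF continuous_ramp(2)] by blast
  obtain B2 where B2: "\<forall>t\<in>{0..3}. \<bar>ramp2 t\<bar> \<le> B2" using ex[OF continuous_ramp(3)] by blast
  define B where "B = 1 + \<bar>B0\<bar> + \<bar>B1\<bar> + \<bar>B2\<bar>"
  have cases: "t \<le> 0 \<or> 3 \<le> t \<or> t \<in> {0..3}" for t :: real by auto
  show thesis
  proof (rule that[of B])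
    show "\<bar>ramp t\<bar> \<le> B" for t using cases[of t] bspec[OF B0, of t] by (auto simp: ramp_left ramp_right B_def)
    show "\<bar>ramp1 t\<bar> \<le> B" for t using cases[of t] bspec[OF B1, of t] by (auto simp: ramp_left ramp_right B_def)
    show "\<bar>ramp2 t\<bar> \<le> B" for t using cases[of t] bspec[OF B2, of t] by (auto simp: ramp_left ramp_right B_def)
  qed (simp add: B_def)
qed

section \<open>The substitution x + sqrt x and its inverse\<close>

definition sq :: "real \<Rightarrow> real" where "sq x = x + sqrt x"
text \<open>From t = x + sqrt x one gets t + 1/4 = (sqrt x + 1/2)^2; solving for x and expanding the
  square yields this formula.\<close>

definition xi :: "real \<Rightarrow> real" where "xi t = t + 1 / 2 - sqrt (t + 1 / 4)"

lemma sqrt_sq: "0 \<le> x \<Longrightarrow> sqrt (sq x + 1 / 4) = sqrt x + 1 / 2"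
proof (rule real_sqrt_unique)
  assume "0 \<le> x"
  then show "(sqrt x + 1 / 2)\<^sup>2 = sq x + 1 / 4" by (simp add: sq_def power2_eq_square algebra_simps)
qed simp

lemma xi_sq: "0 \<le> x \<Longrightarrow> xi (sq x) = x"
  by (simp add: xi_def sqrt_sq) (simp add: sq_def)

lemma sqrt_quarter_ge: "0 \<le> t \<Longrightarrow> 1 / 2 \<le> sqrt (t + 1 / 4)"
  by (rule real_le_rsqrt) (simp add: power2_eq_square)

lemma sqrt_xi: "0 \<le> t \<Longrightarrow> sqrt (xi t) = sqrt (t + 1 / 4) - 1 / 2"
proof (rule real_sqrt_unique)
  assume t: "0 \<le> t"
  then show "(sqrt (t + 1 / 4) - 1 / 2)\<^sup>2 = xi t" by (simp add: xi_def power2_eq_square algebra_simps)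
  show "0 \<le> sqrt (t + 1 / 4) - 1 / 2" using sqrt_quarter_ge[OF t] by simp
qed

lemma sq_xi: "0 \<le> t \<Longrightarrow> sq (xi t) = t"
  by (simp add: sq_def sqrt_xi) (simp add: xi_def)

lemma xi_nonneg: "0 \<le> t \<Longrightarrow> 0 \<le> xi t"
  using sqrt_xi[of t] sqrt_quarter_ge[of t] by (metis diff_ge_0_iff_ge real_sqrt_ge_0_iff)

lemma xi_pos: "0 < t \<Longrightarrow> 0 < xi t"
proof -
  assume t: "0 < t"
  have "xi t \<noteq> 0" using sq_xi[of t] t by (auto simp: sq_def)
  then show ?thesis using xi_nonneg[of t] t by simp
qed

lemma xi_le: "0 \<le> t \<Longrightarrow> xi t \<le> t"
  using sqrt_quarter_ge[of t] by (simp add: xi_def)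

lemma sq_mono: "x \<le> y \<Longrightarrow> sq x \<le> sq y"
  by (simp add: sq_def add_mono)

lemma sq_derivative: "0 < x \<Longrightarrow> (sq has_real_derivative 1 + 1 / (2 * sqrt x)) (at x)"
  unfolding sq_def[abs_def] by (auto intro!: derivative_eq_intros simp: field_simps)

lemma xi_derivative: "0 \<le> t \<Longrightarrow> (xi has_real_derivative 1 - 1 / (2 * sqrt (t + 1 / 4))) (at t)"
  unfolding xi_def[abs_def] by (auto intro!: derivative_eq_intros simp: field_simps)

lemma sq_derivative2: "0 < x \<Longrightarrow> ((\<lambda>x. 1 + 1 / (2 * sqrt x)) has_real_derivative - 1 / (4 * x * sqrt x)) (at x)"
  by (auto intro!: derivative_eq_intros simp: field_simps)

lemma xi_derivative2: "0 \<le> t \<Longrightarrow> ((\<lambda>t. 1 - 1 / (2 * sqrt (t + 1 / 4))) has_real_derivative 1 / (4 * (t + 1 / 4) * sqrt (t + 1 / 4))) (at t)"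
  by (auto intro!: derivative_eq_intros simp: field_simps)

lemma xi_differentiable_on: "(\<And>t. t \<in> S \<Longrightarrow> 0 \<le> t) \<Longrightarrow> xi differentiable_on S"
  unfolding differentiable_on_def real_differentiable_def
  using xi_derivative has_field_derivative_at_within by blast

lemma sq_differentiable_on: "(\<And>x. x \<in> S \<Longrightarrow> 0 < x) \<Longrightarrow> sq differentiable_on S"
  unfolding differentiable_on_def real_differentiable_def
  using sq_derivative has_field_derivative_at_within by blast

lemma sq_compose_measurable:
  assumes "V \<in> borel_measurable lebesgue"
  shows "(\<lambda>x. V (sq x) :: real) \<in> borel_measurable (lebesgue_on {0<..})"
proof (rule measurable_compose_diffeo[where h=V and \<phi>=sq and T=UNIV and \<psi>=xi])
  show "V \<in> borel_measurable (lebesgue_on UNIV)" using assms by (simp add: lebesgue_on_UNIV_eq)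
  show "sq differentiable_on {0<..}" by (rule sq_differentiable_on) simp
  show "xi differentiable_on sq ` {0<..}" by (rule xi_differentiable_on) (auto simp: sq_def intro!: add_nonneg_nonneg)
qed (auto simp: xi_sq)

section \<open>The a priori estimate on the half-line\<close>

lemma L2_mult_real:
  assumes "continuous_on S b" "\<And>x. x \<in> S \<Longrightarrow> \<bar>b x\<bar> \<le> B" "f \<in> L2 (lebesgue_on S)" "S \<in> sets lebesgue" "0 \<le> B"
  shows "(\<lambda>x. complex_of_real (b x) * f x) \<in> L2 (lebesgue_on S)"
    "L2_norm (lebesgue_on S) (\<lambda>x. complex_of_real (b x) * f x) \<le> B * L2_norm (lebesgue_on S) f"
proof -
  have m: "(\<lambda>x. complex_of_real (b x)) \<in> borel_measurable (lebesgue_on S)"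
    using assms(1,4) by (intro continuous_imp_measurable_on_sets_lebesgue continuous_intros)
  have bd: "cmod (complex_of_real (b x)) \<le> B" if "x \<in> space (lebesgue_on S)" for x using assms(2) that by simp
  show "(\<lambda>x. complex_of_real (b x) * f x) \<in> L2 (lebesgue_on S)" by (rule L2_mult_bounded[OF m bd assms(3)])
  show "L2_norm (lebesgue_on S) (\<lambda>x. complex_of_real (b x) * f x) \<le> B * L2_norm (lebesgue_on S) f"
    by (rule L2_norm_mult_bounded[OF m bd assms(3,5)])
qed

lemma L2_norm_bounded_Icc:
  assumes f: "f \<in> L2 (lebesgue_on S)" and S: "S \<subseteq> {a..b}" "S \<in> sets lebesgue" and ab: "a \<le> b" and c: "\<And>x. x \<in> S \<Longrightarrow> cmod (f x) \<le> c" "0 \<le> c"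
  shows "L2_norm (lebesgue_on S) f \<le> c * sqrt (b - a)"
proof (rule L2I_nn_integral(2)[OF L2_measurable[OF f]])
  have "(\<integral>\<^sup>+x. ennreal ((cmod (f x))\<^sup>2) \<partial>lebesgue_on S) \<le> (\<integral>\<^sup>+x. ennreal (c\<^sup>2) * indicator {a..b} x \<partial>lebesgue)"
    using S c by (auto simp: nn_integral_restrict_space intro!: nn_integral_mono ennreal_leI power_mono split: split_indicator)
  also have "\<dots> = ennreal (c\<^sup>2) * ennreal (b - a)" using ab by (subst nn_integral_cmult_indicator) auto
  also have "\<dots> = ennreal ((c * sqrt (b - a))\<^sup>2)" using ab by (simp add: ennreal_mult[symmetric] power_mult_distrib)
  finally show "(\<integral>\<^sup>+x. ennreal ((cmod (f x))\<^sup>2) \<partial>lebesgue_on S) \<le> ennreal ((c * sqrt (b - a))\<^sup>2)" .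
qed (use c ab in simp)

lemma L2_norm_split:
  assumes f: "f \<in> L2 (lebesgue_on S)" and S: "S \<in> sets lebesgue" "S1 \<in> sets lebesgue" "S2 \<in> sets lebesgue" "S1 \<subseteq> S" "S2 \<subseteq> S" "S \<subseteq> S1 \<union> S2"
  shows "L2_norm (lebesgue_on S) f \<le> L2_norm (lebesgue_on S1) f + L2_norm (lebesgue_on S2) f"
proof -
  define n1 n2 where "n1 = L2_norm (lebesgue_on S1) f" and "n2 = L2_norm (lebesgue_on S2) f"
  have f1: "f \<in> L2 (lebesgue_on S1)" by (rule L2_restrict(1)[OF f S(4,2,1)])
  have f2: "f \<in> L2 (lebesgue_on S2)" by (rule L2_restrict(1)[OF f S(5,3,1)])
  note [measurable] = L2_measurable[OF f]
  let ?g = "\<lambda>x. ennreal ((cmod (f x))\<^sup>2)"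
  have gm: "(\<lambda>x. ?g x * indicator A x) \<in> borel_measurable lebesgue" if A: "A \<in> sets lebesgue" "f \<in> L2 (lebesgue_on A)" for A
  proof -
    have "(\<lambda>x. indicator A x *\<^sub>R f x) \<in> borel_measurable lebesgue"
      using L2_measurable[OF A(2)] A(1) by (simp add: borel_measurable_restrict_space_iff)
    then have "(\<lambda>x. ennreal ((cmod (indicator A x *\<^sub>R f x))\<^sup>2)) \<in> borel_measurable lebesgue" by measurable
    also have "(\<lambda>x. ennreal ((cmod (indicator A x *\<^sub>R f x))\<^sup>2)) = (\<lambda>x. ?g x * indicator A x)" by (auto simp: fun_eq_iff split: split_indicator)
    finally show ?thesis .
  qed
  have "(\<integral>\<^sup>+x. ?g x \<partial>lebesgue_on S) \<le> (\<integral>\<^sup>+x. ?g x * indicator S1 x + ?g x * indicator S2 x \<partial>lebesgue)"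
    using S by (auto simp: nn_integral_restrict_space intro!: nn_integral_mono split: split_indicator)
  also have "\<dots> = (\<integral>\<^sup>+x. ?g x * indicator S1 x \<partial>lebesgue) + (\<integral>\<^sup>+x. ?g x * indicator S2 x \<partial>lebesgue)"
    by (rule nn_integral_add) (use gm S f1 f2 in auto)
  also have "\<dots> = (\<integral>\<^sup>+x. ?g x \<partial>lebesgue_on S1) + (\<integral>\<^sup>+x. ?g x \<partial>lebesgue_on S2)" using S by (simp add: nn_integral_restrict_space)
  also have "\<dots> = ennreal (n1\<^sup>2) + ennreal (n2\<^sup>2)" by (simp add: L2_nn_integral[OF f1] L2_nn_integral[OF f2] n1_def n2_def)
  also have "\<dots> \<le> ennreal ((n1 + n2)\<^sup>2)" by (auto simp: n1_def n2_def ennreal_plus[symmetric] power2_sum intro!: ennreal_leI simp del: ennreal_plus)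
  finally show ?thesis
    unfolding n1_def[symmetric] n2_def[symmetric] by (rule L2I_nn_integral(2)[OF L2_measurable[OF f]]) (simp add: n1_def n2_def)
qed

text \<open>
  The substitution \<open>t = x + sqrt x\<close> turns \<open>- u'' + W u\<close> exactly into \<open>- v'' + V v\<close> up to coefficients
  which are small far out, and the cut-off moves the remaining errors into a compact interval.
\<close>

lemma half_line_estimate:
  fixes V W :: "real \<Rightarrow> real"
  assumes V: "V \<in> borel_measurable lebesgue" "\<And>x. \<bar>V x\<bar> \<le> K" and W: "\<And>x. 0 < x \<Longrightarrow> W x = V (sq x)"
    and C0: "0 < C0" "\<And>f g. (f, g) \<in> schroedinger_line V \<Longrightarrow> L2_norm (lebesgue_on UNIV) f \<le> C0 * L2_norm (lebesgue_on UNIV) (\<lambda>x. g x - complex_of_real l * f x)"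
  shows "\<exists>R C. 0 < R \<and> 0 < C \<and> (\<forall>u u1 u2 s. H2_on {0<..} u u1 u2 \<longrightarrow> (\<forall>x\<in>{0..R}. cmod (u x) \<le> s \<and> cmod (u1 x) \<le> s) \<longrightarrow>
    L2_norm (lebesgue_on {0<..}) u \<le> C * (L2_norm (lebesgue_on {0<..}) (\<lambda>x. (- u2 x + complex_of_real (W x) * u x) - complex_of_real l * u x) + s))"
proof -
  obtain B where B: "1 \<le> B" "\<And>t. \<bar>ramp t\<bar> \<le> B" "\<And>t. \<bar>ramp1 t\<bar> \<le> B" "\<And>t. \<bar>ramp2 t\<bar> \<le> B" by (rule ramp_bound) blast
  have K0: "0 \<le> K" using V(2)[of 0] by simp
  \<comment> \<open>The coefficient of ||u|| when ||u'|| + ||u''|| is bounded through the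
    interpolation inequality and the equation u'' = (W - l) u - k.\<close>
  define Q where "Q = 3 * (K + \<bar>l\<bar>) + 2"
  have Q: "0 < Q" using K0 by (simp add: Q_def)
  \<comment> \<open>So far out that 8 C0 B \<open>\<epsilon>\<close> Q <= 1 with
    \<open>\<epsilon>\<close> = 1 / sqrt R. Then the part of the error proportional to ||u|| has
    coefficient at most 1/2 and can be absorbed.\<close>
  define R where "R = max 1 ((8 * C0 * B * Q)\<^sup>2)"
  define \<epsilon> where "\<epsilon> = 1 / sqrt R"
  have R: "1 \<le> R" by (simp add: R_def)
  have sR: "1 \<le> sqrt R" "8 * C0 * B * Q \<le> sqrt R"
    using R C0 B Q by (auto simp: R_def intro!: real_le_rsqrt)
  have e: "0 < \<epsilon>" "\<epsilon> \<le> 1" "8 * C0 * B * \<epsilon> * Q \<le> 1" using sR R by (auto simp: \<epsilon>_def field_simps)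
  define C where "C = 2 * ((R + 3) + 40 * C0 * B)"
  \<comment> \<open>The compact interval ends at R + 3 because the cut-off rises from 0 to 1 between
    R and R + 3; this is the radius finally returned.\<close>
  have "L2_norm (lebesgue_on {0<..}) u \<le> C * (L2_norm (lebesgue_on {0<..}) (\<lambda>x. (- u2 x + complex_of_real (W x) * u x) - complex_of_real l * u x) + s)"
    if H: "H2_on {0<..} u u1 u2" and s: "\<And>x. x \<in> {0..R + 3} \<Longrightarrow> cmod (u x) \<le> s \<and> cmod (u1 x) \<le> s" for u u1 u2 s
  proof -
    let ?M = "lebesgue_on {0<..} :: real measure"
    let ?MR = "lebesgue_on {R..} :: real measure"
    let ?l = "complex_of_real l"
    note U = H2_half_lineD[OF H]
    have s0: "0 \<le> s" using order_trans[OF norm_ge_zero conjunct1[OF s[of 0]]] R by simp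
    have Wm: "(\<lambda>x. complex_of_real (W x)) \<in> borel_measurable ?M"
    proof -
      have "(\<lambda>x. complex_of_real (V (sq x))) \<in> borel_measurable ?M" using sq_compose_measurable[OF V(1)] by measurable
      then show ?thesis by (subst measurable_cong[where g="\<lambda>x. complex_of_real (V (sq x))"]) (auto simp: W)
    qed
    have Wb: "cmod (complex_of_real (W x)) \<le> K" if "x \<in> space ?M" for x using V(2) that by (simp add: W)
    have WuL: "(\<lambda>x. complex_of_real (W x) * u x) \<in> L2 ?M" by (rule L2_mult_bounded[OF Wm Wb U(3)])
    define k where "k x = (- u2 x + complex_of_real (W x) * u x) - ?l * u x" for x
    have kL: "k \<in> L2 ?M" unfolding k_def by (intro L2_diff L2_add L2_minus L2_scale U WuL)
    define F n0 n1 n2 where "F = L2_norm ?M k" and "n0 = L2_norm ?M u" and "n1 = L2_norm ?M u1" and "n2 = L2_norm ?M u2"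
    have nn: "0 \<le> F" "0 \<le> n0" "0 \<le> n1" "0 \<le> n2" by (auto simp: F_def n0_def n1_def n2_def)
    have n2: "n2 \<le> F + (K + \<bar>l\<bar>) * n0"
    proof -
      have "u2 = (\<lambda>x. (complex_of_real (W x) * u x - ?l * u x) - k x)" by (auto simp: k_def)
      then have "n2 \<le> L2_norm ?M (\<lambda>x. complex_of_real (W x) * u x - ?l * u x) + F"
        unfolding n2_def F_def using L2_norm_diff_triangle[of "\<lambda>x. complex_of_real (W x) * u x - ?l * u x" ?M k] WuL kL U by simp
      also have "L2_norm ?M (\<lambda>x. complex_of_real (W x) * u x - ?l * u x) \<le> L2_norm ?M (\<lambda>x. complex_of_real (W x) * u x) + L2_norm ?M (\<lambda>x. ?l * u x)"
        by (intro L2_norm_diff_triangle L2_scale WuL U)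
      also have "\<dots> \<le> K * n0 + \<bar>l\<bar> * n0"
        using L2_norm_mult_bounded[OF Wm Wb U(3) K0] by (simp add: n0_def L2_norm_scale)
      finally show ?thesis by (simp add: algebra_simps)
    qed
    have n1: "n1 \<le> 2 * (n0 + n2)" unfolding n0_def n1_def n2_def by (rule H2_half_line_interpolation[OF H])
    have n12: "n1 + n2 \<le> 3 * F + Q * n0" using n1 n2 by (simp add: Q_def algebra_simps)
    define x1 where "x1 t = 1 - 1 / (2 * sqrt (t + 1 / 4))" for t :: real
    define x2 where "x2 t = 1 / (4 * (t + 1 / 4) * sqrt (t + 1 / 4))" for t :: real
    have st: "1 \<le> sqrt (t + 1 / 4)" "sqrt R \<le> sqrt (t + 1 / 4)" if "R \<le> t" for t using that R sR by auto
    have x1b: "1 / 2 \<le> x1 t" "x1 t \<le> 1" if "R \<le> t" for t using st(1)[OF that] by (auto simp: x1_def field_simps)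
    have x1a: "\<bar>x1 t\<bar> \<le> 1" if "R \<le> t" for t using x1b[OF that] by simp
    \<comment> \<open>1 - x1^2 is at most 2 (1 - x1) = 1 / sqrt (t + 1/4), so it decays like
      t^(-1/2). This slow decay dictates the square in the choice of \<open>R\<close>.\<close>
    have x1s: "\<bar>1 - (x1 t)\<^sup>2\<bar> \<le> \<epsilon>" if "R \<le> t" for t
    proof -
      have "1 - (x1 t)\<^sup>2 = (1 - x1 t) * (1 + x1 t)" by (simp add: power2_eq_square algebra_simps)
      moreover have "0 \<le> (1 - x1 t) * (1 + x1 t)" using x1b[OF that] by simp
      moreover have "(1 - x1 t) * (1 + x1 t) \<le> (1 - x1 t) * 2" using x1b[OF that] by (intro mult_left_mono) auto
      moreover have "(1 - x1 t) * 2 = 1 / sqrt (t + 1 / 4)" by (simp add: x1_def)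
      moreover have "1 / sqrt (t + 1 / 4) \<le> \<epsilon>" unfolding \<epsilon>_def using st[OF that] sR by (intro divide_left_mono) auto
      ultimately show ?thesis by simp
    qed
    have x2s: "\<bar>x2 t\<bar> \<le> \<epsilon>" if "R \<le> t" for t
    proof -
      have "1 * sqrt R \<le> (4 * (t + 1 / 4)) * sqrt (t + 1 / 4)" using st[OF that] that R by (intro mult_mono) auto
      then have "1 / (4 * (t + 1 / 4) * sqrt (t + 1 / 4)) \<le> 1 / sqrt R" using sR R by (intro frac_le) auto
      then show ?thesis using that R by (simp add: x2_def \<epsilon>_def)
    qed
    have cont: "continuous_on {R..} x1" "continuous_on {R..} x2"
      unfolding x1_def x2_def using R by (auto intro!: continuous_intros)
    have comp: "(\<lambda>t. h (xi t)) \<in> L2 (lebesgue_on {r..})" "L2_norm (lebesgue_on {r..}) (\<lambda>t. h (xi t)) \<le> 2 * L2_norm ?M h"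
      "L2_norm (lebesgue_on (xi ` {r..})) h \<le> 2 * L2_norm (lebesgue_on {r..}) (\<lambda>t. h (xi t))"
      if h: "h \<in> L2 ?M" and r: "R \<le> r" for h r
    proof -
      have d: "(xi has_real_derivative x1 t) (at t within {r..})" if "t \<in> {r..}" for t
        unfolding x1_def using that r R by (auto intro: has_field_derivative_at_within[OF xi_derivative])
      have sub: "xi ` {r..} \<subseteq> {0<..}" using r R by (auto intro!: xi_pos)
      have ps: "sq differentiable_on xi ` {r..}" using sub by (intro sq_differentiable_on) auto
      have inv: "sq (xi t) = t" if "t \<in> {r..}" for t using that r R by (simp add: sq_xi)
      have b: "1 / 2 \<le> x1 t" "x1 t \<le> 2" if "t \<in> {r..}" for t using that r x1b[of t] by auto
      note * = L2_compose[where \<phi>=xi and ?\<phi>1.0=x1 and \<psi>=sq and S="{r..}" and T="{0<..}", OF h _ _ d sub ps inv b]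
      show "(\<lambda>t. h (xi t)) \<in> L2 (lebesgue_on {r..})" by (rule *(1)) auto
      show "L2_norm (lebesgue_on {r..}) (\<lambda>t. h (xi t)) \<le> 2 * L2_norm ?M h" by (rule *(2)) auto
      show "L2_norm (lebesgue_on (xi ` {r..})) h \<le> 2 * L2_norm (lebesgue_on {r..}) (\<lambda>t. h (xi t))" by (rule *(3)) auto
    qed
    note cu = comp[OF U(3) order_refl] and cu1 = comp[OF U(4) order_refl] and cu2 = comp[OF U(5) order_refl] and ck = comp[OF kL order_refl]
    define a a1 a2 where "a t = ramp (t - R)" and "a1 t = ramp1 (t - R)" and "a2 t = ramp2 (t - R)" for t
    have ac0: "ac_deriv_on {R..} (\<lambda>t. u (xi t)) (\<lambda>t. complex_of_real (x1 t) * u1 (xi t))"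
      "ac_deriv_on {R..} (\<lambda>t. complex_of_real (x1 t) * u1 (xi t))
        (\<lambda>t. complex_of_real (x2 t) * u1 (xi t) + complex_of_real (x1 t) * (complex_of_real (x1 t) * u2 (xi t)))"
    proof -
      have d1: "(xi has_real_derivative x1 t) (at t)" if "R \<le> t" for t unfolding x1_def using that R by (intro xi_derivative) auto
      have d2: "(x1 has_real_derivative x2 t) (at t)" if "R \<le> t" for t unfolding x1_def x2_def using that R by (intro xi_derivative2) auto
      have pos: "0 < x1 t" if "R \<le> t" for t using x1b[OF that] by simp
      have sub: "xi ` {R..} \<subseteq> {0..}" using R by (auto intro!: xi_nonneg)
      show "ac_deriv_on {R..} (\<lambda>t. u (xi t)) (\<lambda>t. complex_of_real (x1 t) * u1 (xi t))"
        "ac_deriv_on {R..} (\<lambda>t. complex_of_real (x1 t) * u1 (xi t))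
        (\<lambda>t. complex_of_real (x2 t) * u1 (xi t) + complex_of_real (x1 t) * (complex_of_real (x1 t) * u2 (xi t)))"
        by (rule ac_transplant[OF U(1,2) d1 d2 cont(2) pos sub]; simp)+
    qed
    have da: "(a has_real_derivative a1 t) (at t)" "(a1 has_real_derivative a2 t) (at t)" for t
    proof -
      have dt: "((\<lambda>t. t - R) has_real_derivative 1) (at t)" by (auto intro!: derivative_eq_intros)
      show "(a has_real_derivative a1 t) (at t)" "(a1 has_real_derivative a2 t) (at t)"
        unfolding a_def a1_def a2_def
        using DERIV_chain2[OF ramp_has_derivative dt] DERIV_chain2[OF ramp1_has_derivative dt] by simp_all
    qed
    have ca: "continuous_on S a" "continuous_on S a1" "continuous_on S a2" for S
      unfolding a_def a1_def a2_def
      by (intro continuous_on_compose2[OF continuous_ramp(1)[of UNIV]] continuous_on_compose2[OF continuous_ramp(2)[of UNIV]]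
         continuous_on_compose2[OF continuous_ramp(3)[of UNIV]] continuous_intros; simp)+
    have az: "a t = 0" "a1 t = 0" "a2 t = 0" if "t \<le> R" for t using that by (auto simp: a_def a1_def a2_def ramp_left)
    have ab: "\<bar>a t\<bar> \<le> B" "\<bar>a1 t\<bar> \<le> B" "\<bar>a2 t\<bar> \<le> B" for t using B by (auto simp: a_def a1_def a2_def)
    define v where "v t = complex_of_real (a t) * u (xi t)" for t
    define v1 where "v1 t = complex_of_real (a1 t) * u (xi t) + complex_of_real (a t) * (complex_of_real (x1 t) * u1 (xi t))" for t
    define v2 where "v2 t = complex_of_real (a2 t) * u (xi t) + 2 * complex_of_real (a1 t) * (complex_of_real (x1 t) * u1 (xi t))
        + complex_of_real (a t) * (complex_of_real (x2 t) * u1 (xi t) + complex_of_real (x1 t) * (complex_of_real (x1 t) * u2 (xi t)))" for t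
    note acR = ac_deriv_on_cutoff[OF da ca(3) ac0 is_interval_ci]
    have acv: "ac_deriv_on UNIV v v1" "ac_deriv_on UNIV v1 v2"
    proof -
      have "ac_deriv_on {R..} v v1" "ac_deriv_on {R..} v1 v2"
        unfolding v_def[abs_def] v1_def[abs_def] v2_def[abs_def] by (rule acR)+
      then show "ac_deriv_on UNIV v v1" "ac_deriv_on UNIV v1 v2"
        by (auto intro!: ac_deriv_on_glue[of R] simp: v_def v1_def v2_def az)
    qed
    have xL: "(\<lambda>t. complex_of_real (x1 t) * u1 (xi t)) \<in> L2 ?MR"
      by (rule L2_mult_real(1)[where B=1, OF cont(1) _ cu1(1)]) (use x1a in auto)
    have x2L: "(\<lambda>t. complex_of_real (x2 t) * u1 (xi t)) \<in> L2 ?MR"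
      by (rule L2_mult_real(1)[where B=\<epsilon>, OF cont(2) _ cu1(1)]) (use x2s e in auto)
    have xxL: "(\<lambda>t. complex_of_real (x1 t) * (complex_of_real (x1 t) * u2 (xi t))) \<in> L2 ?MR"
      by (intro L2_mult_real(1)[where B=1, OF cont(1)] cu2(1)) (use x1a in auto)
    have aL: "(\<lambda>t. complex_of_real (a t) * f t) \<in> L2 ?MR" "(\<lambda>t. complex_of_real (a1 t) * f t) \<in> L2 ?MR" "(\<lambda>t. complex_of_real (a2 t) * f t) \<in> L2 ?MR"
      if "f \<in> L2 ?MR" for f
      using that ab B(1) by (auto intro!: L2_mult_real(1)[where B=B] ca)
    have vR: "v \<in> L2 ?MR" unfolding v_def by (intro aL cu)
    have v1R: "v1 \<in> L2 ?MR" unfolding v1_def by (intro L2_add aL cu xL)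
    have v2R: "v2 \<in> L2 ?MR" unfolding v2_def mult.assoc by (intro L2_add L2_scale aL cu xL x2L xxL)
    have ext: "f \<in> L2 (lebesgue_on UNIV) \<and> L2_norm (lebesgue_on UNIV) f = L2_norm ?MR f" if "f \<in> L2 ?MR" "\<And>t. t \<le> R \<Longrightarrow> f t = 0" for f
      using L2_extend[OF that(1), of UNIV] that(2) by auto
    have vz: "v t = 0" "v1 t = 0" "v2 t = 0" if "t \<le> R" for t using az[OF that] by (auto simp: v_def v1_def v2_def)
    have Hv: "H2_on UNIV v v1 v2"
      unfolding H2_on_def using acv ext[OF vR vz(1)] ext[OF v1R vz(2)] ext[OF v2R vz(3)] by simp
    have Vm: "(\<lambda>x. complex_of_real (V x)) \<in> borel_measurable (lebesgue_on UNIV)" using V(1) by (simp add: lebesgue_on_UNIV_eq)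
    have VvL: "(\<lambda>t. complex_of_real (V t) * v t) \<in> L2 (lebesgue_on UNIV)"
      by (rule L2_mult_bounded[OF Vm _ H2_onD(3)[OF Hv], of K]) (use V(2) in simp)
    let ?g = "\<lambda>t. - v2 t + complex_of_real (V t) * v t"
    have mem: "(v, ?g) \<in> schroedinger_line V"
      unfolding schroedinger_line_def
      by (rule schroedingerI[where bc="\<lambda>u u1. True", OF Hv]) (use H2_onD[OF Hv] VvL in auto)
    define r where "r t = ?g t - ?l * v t" for t
    have vle: "L2_norm (lebesgue_on UNIV) v \<le> C0 * L2_norm (lebesgue_on UNIV) r"
      using C0(2)[OF mem] by (simp add: r_def[abs_def])
    \<comment> \<open>The commutator of the cut-off with the second derivative. It is supported
      where the derivatives of the cut-off live, that is in [R, R + 3]; since \<open>xi t\<close>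
      does not exceed t, the values of u and u1 met there are bounded by s.\<close>
    define er where "er t = complex_of_real (a2 t) * u (xi t) + complex_of_real (2 * a1 t * x1 t) * u1 (xi t)" for t
    have r_eq: "r t = complex_of_real (a t) * k (xi t) + (complex_of_real (a t) * (complex_of_real (1 - (x1 t)\<^sup>2) * u2 (xi t))
         - (complex_of_real (a t) * (complex_of_real (x2 t) * u1 (xi t)) + er t))" for t
    proof (cases "R \<le> t")
      case True
      then have "W (xi t) = V t" using R xi_pos[of t] sq_xi[of t] by (simp add: W)
      then show ?thesis by (simp add: r_def v_def v2_def k_def er_def algebra_simps power2_eq_square)
    next
      case False
      then show ?thesis using az[of t] by (simp add: r_def vz er_def)
    qed
    have erL: "er \<in> L2 ?MR"
    proof -
      have "er = (\<lambda>t. complex_of_real (a2 t) * u (xi t) + 2 * (complex_of_real (a1 t) * (complex_of_real (x1 t) * u1 (xi t))))"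
        by (auto simp: er_def fun_eq_iff)
      then show ?thesis by (simp only:) (intro L2_add L2_scale aL cu xL)
    qed
    have ern: "L2_norm ?MR er \<le> 6 * B * s"
    proof -
      have S: "{R..R + 3} \<subseteq> {R..}" by auto
      have eS: "er \<in> L2 (lebesgue_on {R..R + 3})" by (rule L2_restrict(1)[OF erL S]) auto
      have "L2_norm ?MR er = L2_norm (lebesgue_on {R..R + 3}) er"
        by (rule L2_extend(2)[OF eS S]) (auto simp: er_def a1_def a2_def ramp_right)
      also have "\<dots> \<le> (3 * B * s) * sqrt ((R + 3) - R)"
      proof (rule L2_norm_bounded_Icc[OF eS order_refl])
        fix t assume t: "t \<in> {R..R + 3}"
        have "xi t \<in> {0..R + 3}" using t R xi_nonneg[of t] xi_le[of t] by auto
        then have us: "cmod (u (xi t)) \<le> s" "cmod (u1 (xi t)) \<le> s" using s by auto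
        have "cmod (er t) \<le> \<bar>a2 t\<bar> * cmod (u (xi t)) + \<bar>2 * a1 t * x1 t\<bar> * cmod (u1 (xi t))"
          unfolding er_def by (rule order_trans[OF norm_triangle_ineq]) (simp add: norm_mult abs_mult)
        also have "\<dots> \<le> B * s + (2 * B) * s"
        proof (intro add_mono mult_mono us ab)
          have "\<bar>a1 t\<bar> * \<bar>x1 t\<bar> \<le> B * 1" using x1b[of t] t ab B(1) by (intro mult_mono) auto
          then show "\<bar>2 * a1 t * x1 t\<bar> \<le> 2 * B" by (simp add: abs_mult)
        qed (use B(1) in auto)
        finally show "cmod (er t) \<le> 3 * B * s" by simp
      qed (use B(1) s0 in auto)
      also have "\<dots> \<le> (3 * B * s) * 2" using B(1) s0 by (intro mult_left_mono real_le_lsqrt) auto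
      finally show ?thesis by simp
    qed
    have t1: "L2_norm ?MR (\<lambda>t. complex_of_real (a t) * k (xi t)) \<le> 2 * B * F"
    proof -
      have "L2_norm ?MR (\<lambda>t. complex_of_real (a t) * k (xi t)) \<le> B * L2_norm ?MR (\<lambda>t. k (xi t))"
        by (rule L2_mult_real(2)[OF ca(1) _ ck(1)]) (use ab B(1) in auto)
      also have "\<dots> \<le> B * (2 * F)" using ck(2) B(1) unfolding F_def by (intro mult_left_mono) auto
      finally show ?thesis by simp
    qed
    have t2: "L2_norm ?MR (\<lambda>t. complex_of_real (a t) * (complex_of_real (1 - (x1 t)\<^sup>2) * u2 (xi t))) \<le> B * (\<epsilon> * (2 * n2))"
      and t2L: "(\<lambda>t. complex_of_real (a t) * (complex_of_real (1 - (x1 t)\<^sup>2) * u2 (xi t))) \<in> L2 ?MR"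
    proof -
      have c: "continuous_on {R..} (\<lambda>t. 1 - (x1 t)\<^sup>2)" using cont by (intro continuous_intros)
      have i: "(\<lambda>t. complex_of_real (1 - (x1 t)\<^sup>2) * u2 (xi t)) \<in> L2 ?MR"
        by (rule L2_mult_real(1)[where B=\<epsilon>, OF c _ cu2(1)]) (use x1s e in auto)
      have "L2_norm ?MR (\<lambda>t. complex_of_real (1 - (x1 t)\<^sup>2) * u2 (xi t)) \<le> \<epsilon> * L2_norm ?MR (\<lambda>t. u2 (xi t))"
        by (rule L2_mult_real(2)[where B=\<epsilon>, OF c _ cu2(1)]) (use x1s e in auto)
      also have "\<dots> \<le> \<epsilon> * (2 * n2)" using cu2(2) e unfolding n2_def by (intro mult_left_mono) auto
      finally have j: "L2_norm ?MR (\<lambda>t. complex_of_real (1 - (x1 t)\<^sup>2) * u2 (xi t)) \<le> \<epsilon> * (2 * n2)" .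
      show "(\<lambda>t. complex_of_real (a t) * (complex_of_real (1 - (x1 t)\<^sup>2) * u2 (xi t))) \<in> L2 ?MR" by (rule aL(1)[OF i])
      have "L2_norm ?MR (\<lambda>t. complex_of_real (a t) * (complex_of_real (1 - (x1 t)\<^sup>2) * u2 (xi t))) \<le> B * L2_norm ?MR (\<lambda>t. complex_of_real (1 - (x1 t)\<^sup>2) * u2 (xi t))"
        by (rule L2_mult_real(2)[OF ca(1) _ i]) (use ab B(1) in auto)
      also have "\<dots> \<le> B * (\<epsilon> * (2 * n2))" using j B(1) by (intro mult_left_mono) auto
      finally show "L2_norm ?MR (\<lambda>t. complex_of_real (a t) * (complex_of_real (1 - (x1 t)\<^sup>2) * u2 (xi t))) \<le> B * (\<epsilon> * (2 * n2))" .
    qed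
    have t3: "L2_norm ?MR (\<lambda>t. complex_of_real (a t) * (complex_of_real (x2 t) * u1 (xi t))) \<le> B * (\<epsilon> * (2 * n1))"
    proof -
      have "L2_norm ?MR (\<lambda>t. complex_of_real (x2 t) * u1 (xi t)) \<le> \<epsilon> * L2_norm ?MR (\<lambda>t. u1 (xi t))"
        by (rule L2_mult_real(2)[where B=\<epsilon>, OF cont(2) _ cu1(1)]) (use x2s e in auto)
      also have "\<dots> \<le> \<epsilon> * (2 * n1)" using cu1(2) e unfolding n1_def by (intro mult_left_mono) auto
      finally have j: "L2_norm ?MR (\<lambda>t. complex_of_real (x2 t) * u1 (xi t)) \<le> \<epsilon> * (2 * n1)" .
      have "L2_norm ?MR (\<lambda>t. complex_of_real (a t) * (complex_of_real (x2 t) * u1 (xi t))) \<le> B * L2_norm ?MR (\<lambda>t. complex_of_real (x2 t) * u1 (xi t))"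
        by (rule L2_mult_real(2)[OF ca(1) _ x2L]) (use ab B(1) in auto)
      also have "\<dots> \<le> B * (\<epsilon> * (2 * n1))" using j B(1) by (intro mult_left_mono) auto
      finally show ?thesis .
    qed
    have t3L: "(\<lambda>t. complex_of_real (a t) * (complex_of_real (x2 t) * u1 (xi t))) \<in> L2 ?MR" by (rule aL(1)[OF x2L])
    have t1L: "(\<lambda>t. complex_of_real (a t) * k (xi t)) \<in> L2 ?MR" by (rule aL(1)[OF ck(1)])
    have rfun: "r = (\<lambda>t. complex_of_real (a t) * k (xi t) + (complex_of_real (a t) * (complex_of_real (1 - (x1 t)\<^sup>2) * u2 (xi t))
         - (complex_of_real (a t) * (complex_of_real (x2 t) * u1 (xi t)) + er t)))" using r_eq by blast
    have rR: "r \<in> L2 ?MR" unfolding rfun by (intro L2_add L2_diff t1L t2L t3L erL)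
    have rz: "r t = 0" if "t \<le> R" for t using vz[OF that] by (simp add: r_def)
    have "L2_norm ?MR r \<le> 2 * B * F + (B * (\<epsilon> * (2 * n2)) + (B * (\<epsilon> * (2 * n1)) + 6 * B * s))"
      unfolding rfun
      by (intro order_trans[OF L2_norm_triangle] order_trans[OF L2_norm_diff_triangle] add_mono t1 t2 t3 ern L2_add L2_diff t1L t2L t3L erL)
    also have "\<dots> = 2 * B * F + 2 * B * \<epsilon> * (n1 + n2) + 6 * B * s" by (simp add: algebra_simps)
    also have "\<dots> \<le> 2 * B * F + 2 * B * \<epsilon> * (3 * F + Q * n0) + 6 * B * s"
    proof -
      have "2 * B * \<epsilon> * (n1 + n2) \<le> 2 * B * \<epsilon> * (3 * F + Q * n0)" using n12 B(1) e by (intro mult_left_mono) auto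
      then show ?thesis by simp
    qed
    also have "\<dots> \<le> 8 * B * F + 2 * B * \<epsilon> * (Q * n0) + 6 * B * s"
    proof -
      have "2 * B * \<epsilon> * (3 * F) \<le> 2 * B * 1 * (3 * F)" using B(1) e nn by (intro mult_right_mono mult_left_mono) auto
      then show ?thesis by (simp add: algebra_simps)
    qed
    finally have rn: "L2_norm ?MR r \<le> 8 * B * F + 2 * B * \<epsilon> * (Q * n0) + 6 * B * s" .
    have vn: "L2_norm (lebesgue_on UNIV) v \<le> C0 * (8 * B * F + 2 * B * \<epsilon> * (Q * n0) + 6 * B * s)"
      using vle ext[OF rR rz] mult_left_mono[OF rn less_imp_le[OF C0(1)]] by simp
    \<comment> \<open>The half-line is covered by (0, R + 3], where |u| <= s, and the image of [R +
      3, \<infinity>) under \<open>xi\<close>, where the cut-off is 1 and u composed with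
      \<open>xi\<close> is v. The cover is complete because \<open>sq x\<close> is at least
      x.\<close>
    have "n0 \<le> L2_norm (lebesgue_on {0<..R + 3}) u + L2_norm (lebesgue_on (xi ` {R + 3..})) u"
      unfolding n0_def
    proof (rule L2_norm_split[OF U(3)])
      show "xi ` {R + 3..} \<subseteq> {0<..}" using R by (auto intro!: xi_pos)
      show "xi ` {R + 3..} \<in> sets lebesgue"
        using R by (intro differentiable_image_in_sets_lebesgue xi_differentiable_on) auto
      show "{0<..} \<subseteq> {0<..R + 3} \<union> xi ` {R + 3..}"
      proof
        fix x :: real assume "x \<in> {0<..}"
        then have x: "0 < x" by simp
        show "x \<in> {0<..R + 3} \<union> xi ` {R + 3..}"
        proof (cases "x \<le> R + 3")
          case False
          have "sq x \<in> {R + 3..}" using False x real_sqrt_ge_zero[of x] by (simp add: sq_def del: real_sqrt_ge_0_iff)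
          moreover have "x = xi (sq x)" using x by (simp add: xi_sq)
          ultimately show ?thesis by blast
        qed (use x in simp)
      qed
    qed auto
    also have "L2_norm (lebesgue_on {0<..R + 3}) u \<le> s * sqrt ((R + 3) - 0)"
      by (rule L2_norm_bounded_Icc[OF L2_restrict(1)[OF U(3)]]) (use s s0 R in auto)
    also have "s * sqrt ((R + 3) - 0) \<le> s * (R + 3)"
      using R s0 by (intro mult_left_mono real_le_lsqrt) (auto simp: power2_eq_square)
    also have "L2_norm (lebesgue_on (xi ` {R + 3..})) u \<le> 2 * L2_norm (lebesgue_on UNIV) v"
    proof -
      have "L2_norm (lebesgue_on (xi ` {R + 3..})) u \<le> 2 * L2_norm (lebesgue_on {R + 3..}) (\<lambda>t. u (xi t))" by (rule comp(3)[OF U(3)]) simp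
      also have "L2_norm (lebesgue_on {R + 3..}) (\<lambda>t. u (xi t)) = L2_norm (lebesgue_on {R + 3..}) v"
        unfolding L2_norm_def by (intro arg_cong[where f=sqrt] Bochner_Integration.integral_cong refl) (simp add: v_def a_def ramp_right)
      also have "\<dots> \<le> L2_norm (lebesgue_on UNIV) v" by (rule L2_restrict(2)[OF H2_onD(3)[OF Hv]]) auto
      finally show ?thesis by simp
    qed
    finally have "n0 \<le> s * (R + 3) + 2 * (C0 * (8 * B * F + 2 * B * \<epsilon> * (Q * n0) + 6 * B * s))" using vn by linarith
    also have "\<dots> = s * (R + 3) + 16 * C0 * B * F + 12 * C0 * B * s + (1 / 2) * (8 * C0 * B * \<epsilon> * Q) * n0" by (simp add: algebra_simps)
    \<comment> \<open>Here the choice of \<open>R\<close> pays off: the term in \<open>n0\<close> on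
      the right is at most half of the left side and is moved over.\<close>
    also have "\<dots> \<le> s * (R + 3) + 16 * C0 * B * F + 12 * C0 * B * s + (1 / 2) * 1 * n0"
    proof -
      have "(1 / 2) * (8 * C0 * B * \<epsilon> * Q) * n0 \<le> (1 / 2) * 1 * n0" using e(3) nn by (intro mult_right_mono mult_left_mono) auto
      then show ?thesis by simp
    qed
    finally have "n0 \<le> 2 * (s * (R + 3) + 16 * C0 * B * F + 12 * C0 * B * s)" by simp
    also have "\<dots> \<le> C * (F + s)"
    proof -
      have "0 \<le> R * F" "0 \<le> C0 * (B * F)" "0 \<le> C0 * (B * s)" using R nn C0(1) B(1) s0 by auto
      then show ?thesis using nn by (simp add: C_def algebra_simps)
    qed
    finally show ?thesis by (simp add: n0_def F_def k_def[abs_def])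
  qed
  moreover have "0 < R + 3" "0 < C" using R C0(1) B(1) by (auto simp: C_def intro!: add_pos_nonneg)
  ultimately show ?thesis by blast
qed

section \<open>Transfer of Weyl sequences\<close>

text \<open>The squared tail norm is the integral over [1, \<infinity>) minus the integral over
  [1, b], which tends to zero. Starting at 1 keeps every interval inside the open half-line.\<close>

lemma L2_half_line_tail:
  fixes h :: "real \<Rightarrow> complex"
  assumes h: "h \<in> L2 (lebesgue_on {0<..})" and e: "0 < e"
  shows "\<exists>X\<ge>1. \<forall>Y\<ge>X. L2_norm (lebesgue_on {Y..}) h < e"
proof -
  have sub: "h \<in> L2 (lebesgue_on {x..})" if "0 < x" for x
  proof -
    have "{x..} \<subseteq> {0<..}" using that by auto
    from L2_restrict(1)[OF h this] show ?thesis by simp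
  qed
  have i: "(\<lambda>t. (cmod (h t))\<^sup>2) absolutely_integrable_on {x..}" if "0 < x" for x
  proof -
    have S: "{x..} \<in> sets lebesgue" by simp
    from integrable_lebesgue_on_iff[OF S, THEN iffD1, OF L2_integrable[OF sub[OF that]]] show ?thesis .
  qed
  let ?F = "\<lambda>t. (cmod (h t))\<^sup>2"
  have T: "((\<lambda>b. LINT x:{1..b}|lebesgue. ?F x) \<longlongrightarrow> (LINT x:{1..}|lebesgue. ?F x)) at_top"
    by (rule tendsto_set_lebesgue_integral_at_top[OF _ i]) auto
  have E: "\<forall>\<^sub>F b in at_top. (LINT x:{1..b}|lebesgue. ?F x) = (L2_norm (lebesgue_on {1..}) h)\<^sup>2 - (L2_norm (lebesgue_on {b..}) h)\<^sup>2"
    using eventually_ge_at_top[of 1]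
  proof eventually_elim
    case (elim b)
    have ib: "?F absolutely_integrable_on {1..b}" by (rule set_integrable_subset[OF i[of 1]]) auto
    have "integral ({1..b} \<union> {b..}) ?F = integral {1..b} ?F + integral {b..} ?F"
    proof (rule Henstock_Kurzweil_Integration.integral_Un)
      have "{1..b} \<inter> {b..} = {b}" using elim by auto
      then show "negligible ({1..b} \<inter> {b..})" by simp
    qed (use set_lebesgue_integral_eq_integral(1)[OF ib] set_lebesgue_integral_eq_integral(1)[OF i[of b]] elim in auto)
    moreover have "{1..b} \<union> {b..} = {1..}" using elim by auto
    moreover have "integral {x..} ?F = (L2_norm (lebesgue_on {x..}) h)\<^sup>2" if "0 < x" for x
      using integral_norm_square[OF sub[OF that]] by (simp add: integral_unique)
    ultimately show ?case using set_lebesgue_integral_eq_integral(2)[OF ib] elim by simp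
  qed
  have "(LINT x:{1..}|lebesgue. ?F x) = (L2_norm (lebesgue_on {1..}) h)\<^sup>2"
    using set_lebesgue_integral_eq_integral(2)[OF i[of 1]] integral_norm_square[OF sub[of 1]] by (simp add: integral_unique)
  with Lim_transform_eventually[OF T E] have "((\<lambda>b. (L2_norm (lebesgue_on {1..}) h)\<^sup>2 - (L2_norm (lebesgue_on {b..}) h)\<^sup>2) \<longlongrightarrow> (L2_norm (lebesgue_on {1..}) h)\<^sup>2) at_top"
    by simp
  from tendsto_diff[OF tendsto_const[of "(L2_norm (lebesgue_on {1..}) h)\<^sup>2"] this]
  have "((\<lambda>b. (L2_norm (lebesgue_on {b..}) h)\<^sup>2) \<longlongrightarrow> 0) at_top" by (simp only: diff_diff_eq2 add_diff_cancel_left' diff_self)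
  from order_tendstoD(2)[OF this, of "e\<^sup>2"] e
  have "\<forall>\<^sub>F b in at_top. (L2_norm (lebesgue_on {b..}) h)\<^sup>2 < e\<^sup>2" by simp
  then obtain X where X: "\<And>b. b \<ge> X \<Longrightarrow> (L2_norm (lebesgue_on {b..}) h)\<^sup>2 < e\<^sup>2" by (auto simp: eventually_at_top_linorder)
  show ?thesis
  proof (intro exI[of _ "max 1 X"] conjI allI impI)
    fix Y assume "max 1 X \<le> Y"
    then have "(L2_norm (lebesgue_on {Y..}) h)\<^sup>2 < e\<^sup>2" using X by simp
    then show "L2_norm (lebesgue_on {Y..}) h < e" using e by (simp add: power2_less_imp_less)
  qed simp
qed

lemma L2_lebesgue_bounded_mass:
  assumes f: "f \<in> L2 lebesgue" and c: "0 \<le> c" "c < L2_norm lebesgue f"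
  shows "\<exists>n::nat. c < L2_norm (lebesgue_on {- real n..real n}) f"
proof (rule ccontr)
  assume "\<not> ?thesis"
  then have le: "L2_norm (lebesgue_on {- real n..real n}) f \<le> c" for n :: nat by (auto simp: not_less)
  have fn: "f \<in> L2 (lebesgue_on {- real n..real n})" for n :: nat using L2_lebesgue_restrict[OF f] by simp
  show False using L2_lebesgue_exhaust(2)[OF fn le L2_measurable[OF f]] c by simp
qed

text \<open>A cut-off stretched to scale L has derivatives of order 1/L, so it disturbs the equation
  by an amount tending to zero, while the mass of u inside the plateau stays above 1/2.\<close>

lemma compactly_supported_approx:
  fixes V :: "real \<Rightarrow> real"
  assumes V: "V \<in> borel_measurable lebesgue" "\<And>x. \<bar>V x\<bar> \<le> K" and l: "complex_of_real l \<in> spectrum (lebesgue_on UNIV) (schroedinger_line V)" and d: "0 < d"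
  shows "\<exists>b b1 b2 L. H2_on UNIV b b1 b2 \<and> (\<forall>x. L \<le> \<bar>x\<bar> \<longrightarrow> b x = 0 \<and> b1 x = 0 \<and> b2 x = 0) \<and> 1 / 2 < L2_norm (lebesgue_on UNIV) b \<and>
    L2_norm (lebesgue_on UNIV) (\<lambda>x. (- b2 x + complex_of_real (V x) * b x) - complex_of_real l * b x) < d"
proof -
  interpret HV: selfadjoint_op "lebesgue_on UNIV" "schroedinger_line V" by (rule selfadjoint_line[OF V])
  let ?M = "lebesgue_on UNIV :: real measure"
  let ?l = "complex_of_real l"
  obtain B where B: "1 \<le> B" "\<And>t. \<bar>ramp t\<bar> \<le> B" "\<And>t. \<bar>ramp1 t\<bar> \<le> B" "\<And>t. \<bar>ramp2 t\<bar> \<le> B" by (rule ramp_bound) blast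
  have "0 < d / (4 * B)" using d B by simp
  from HV.spectrum_approx[OF l this] obtain f g where fg: "(f, g) \<in> schroedinger_line V" "L2_norm ?M f = 1" "L2_norm ?M (\<lambda>x. g x - ?l * f x) < d / (4 * B)"
    by blast
  from fg(1) obtain u u1 u2 where u: "H2_on UNIV u u1 u2" "AE x in ?M. f x = u x" "AE x in ?M. g x = - u2 x + complex_of_real (V x) * u x" "f \<in> L2 ?M" "g \<in> L2 ?M"
    unfolding schroedinger_line_def by (rule schroedingerE) blast
  note U = H2_onD[OF u(1)]
  have acU: "ac_deriv_on UNIV u u1" "ac_deriv_on UNIV u1 u2" using U by auto
  have Vm: "(\<lambda>x. complex_of_real (V x)) \<in> borel_measurable ?M" using V(1) by (simp add: lebesgue_on_UNIV_eq)
  have VL: "(\<lambda>t. complex_of_real (V t) * h t) \<in> L2 ?M" if "h \<in> L2 ?M" for h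
    by (rule L2_mult_bounded[OF Vm _ that, of K]) (use V(2) in simp)
  define k where "k x = (- u2 x + complex_of_real (V x) * u x) - ?l * u x" for x
  have kL: "k \<in> L2 ?M" unfolding k_def by (intro L2_diff L2_add L2_minus L2_scale U VL)
  have kn: "L2_norm ?M k < d / (4 * B)"
  proof -
    have "L2_norm ?M k = L2_norm ?M (\<lambda>x. g x - ?l * f x)"
    proof (rule L2_norm_AE_cong)
      show "AE x in ?M. k x = g x - ?l * f x" using u(2,3) by eventually_elim (simp add: k_def)
    qed (use kL u in \<open>auto intro!: L2_measurable\<close>)
    then show ?thesis using fg(3) by simp
  qed
  have un: "L2_norm ?M u = 1" using L2_norm_AE_cong[OF L2_measurable[OF u(4)] L2_measurable[OF U(3)] u(2)] fg(2) by simp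
  \<comment> \<open>An interval carrying norm more than 1/2; the scale L is taken at least n, so the
    interval lies in the plateau of the cut-off.\<close>
  obtain n :: nat where n: "1 / 2 < L2_norm (lebesgue_on {- real n..real n}) u"
    using L2_lebesgue_bounded_mass[of u "1 / 2"] U(3) un by (auto simp: lebesgue_on_UNIV_eq)
  \<comment> \<open>The commutator is bounded by 2 (2 B / L) ||u1|| + (2 B / L) ||u||, and ||u|| =
    1; \<open>N\<close> collects the factors of 1 / L.\<close>
  define N where "N = 4 * B * L2_norm ?M u1 + 2 * B"
  have N: "0 < N" using B(1) by (simp add: N_def add_nonneg_pos)
  define L where "L = max 1 (max (real n) (2 * N / d))"
  have L: "1 \<le> L" "real n \<le> L" "N / L \<le> d / 2"
  proof -
    show L1: "1 \<le> L" "real n \<le> L" by (auto simp: L_def)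
    have "2 * N / d \<le> L" by (auto simp: L_def)
    then have "2 * N \<le> L * d" using d by (simp add: field_simps)
    then show "N / L \<le> d / 2" using L1 by (simp add: field_simps)
  qed
  \<comment> \<open>A rising and a shifted falling ramp: equal to 1 for |x| <= 3 L and to 0 for |x|
    >= 6 L.\<close>
  define a where "a x = ramp (x / L + 6) - ramp (x / L - 3)" for x
  define a1 where "a1 x = (ramp1 (x / L + 6) - ramp1 (x / L - 3)) / L" for x
  define a2 where "a2 x = (ramp2 (x / L + 6) - ramp2 (x / L - 3)) / L / L" for x
  have da: "(a has_real_derivative a1 x) (at x)" "(a1 has_real_derivative a2 x) (at x)" for x
  proof -
    have t: "((\<lambda>x. x / L + 6) has_real_derivative 1 / L) (at x)" "((\<lambda>x. x / L - 3) has_real_derivative 1 / L) (at x)"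
      using L by (auto intro!: derivative_eq_intros)
    show "(a has_real_derivative a1 x) (at x)"
      unfolding a_def[abs_def]
      by (rule DERIV_cong[OF DERIV_diff[OF DERIV_chain2[OF ramp_has_derivative t(1)] DERIV_chain2[OF ramp_has_derivative t(2)]]])
         (simp add: a1_def diff_divide_distrib)
    show "(a1 has_real_derivative a2 x) (at x)"
      unfolding a1_def[abs_def]
      by (rule DERIV_cong[OF DERIV_cdivide[OF DERIV_diff[OF DERIV_chain2[OF ramp1_has_derivative t(1)] DERIV_chain2[OF ramp1_has_derivative t(2)]]]])
         (simp add: a2_def diff_divide_distrib)
  qed
  have ca: "continuous_on UNIV a" "continuous_on UNIV a1" "continuous_on UNIV a2"
    unfolding a_def a1_def a2_def using L
    by (intro continuous_on_compose2[OF continuous_ramp(1)[of UNIV]] continuous_on_compose2[OF continuous_ramp(2)[of UNIV]]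
         continuous_on_compose2[OF continuous_ramp(3)[of UNIV]] continuous_intros; simp)+
  have ab: "\<bar>a x\<bar> \<le> 2 * B" "\<bar>a1 x\<bar> \<le> 2 * B / L" "\<bar>a2 x\<bar> \<le> 2 * B / L" for x
  proof -
    have tri: "\<bar>p - q\<bar> \<le> 2 * B" if "\<bar>p\<bar> \<le> B" "\<bar>q\<bar> \<le> B" for p q using that by linarith
    show "\<bar>a x\<bar> \<le> 2 * B" unfolding a_def by (rule tri[OF B(2) B(2)])
    have "\<bar>ramp1 (x / L + 6) - ramp1 (x / L - 3)\<bar> / L \<le> 2 * B / L" using tri[OF B(3) B(3)] L by (intro divide_right_mono) auto
    then show "\<bar>a1 x\<bar> \<le> 2 * B / L" using L by (simp add: a1_def)
    have "\<bar>ramp2 (x / L + 6) - ramp2 (x / L - 3)\<bar> / L / L \<le> 2 * B / L / L" using tri[OF B(4) B(4)] L by (intro divide_right_mono) auto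
    also have "\<dots> \<le> 2 * B / L / 1" using L B(1) by (intro divide_left_mono) auto
    finally show "\<bar>a2 x\<bar> \<le> 2 * B / L" using L by (simp add: a2_def)
  qed
  have az: "a x = 0" "a1 x = 0" "a2 x = 0" if x: "6 * L \<le> \<bar>x\<bar>" for x
  proof -
    have "6 \<le> \<bar>x\<bar> / L" using x L by (simp add: field_simps)
    then have "6 \<le> x / L \<or> x / L \<le> - 6" by (cases "0 \<le> x") (auto simp: field_simps)
    then show "a x = 0" "a1 x = 0" "a2 x = 0"
      by (auto simp: a_def a1_def a2_def ramp_left ramp_right)
  qed
  have a_one: "a x = 1" if x: "\<bar>x\<bar> \<le> 3 * L" for x
  proof -
    have "- 3 \<le> x / L" "x / L \<le> 3" using x L by (auto simp: field_simps abs_le_iff)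
    then show ?thesis by (simp add: a_def ramp_left ramp_right)
  qed
  define b where "b x = complex_of_real (a x) * u x" for x
  define b1 where "b1 x = complex_of_real (a1 x) * u x + complex_of_real (a x) * u1 x" for x
  define b2 where "b2 x = complex_of_real (a2 x) * u x + 2 * complex_of_real (a1 x) * u1 x + complex_of_real (a x) * u2 x" for x
  have acb: "ac_deriv_on UNIV b b1" "ac_deriv_on UNIV b1 b2"
    unfolding b_def[abs_def] b1_def[abs_def] b2_def[abs_def] by (rule ac_deriv_on_cutoff[OF da ca(3) acU]; simp)+
  have aL: "(\<lambda>x. complex_of_real (a x) * h x) \<in> L2 ?M" "(\<lambda>x. complex_of_real (a1 x) * h x) \<in> L2 ?M" "(\<lambda>x. complex_of_real (a2 x) * h x) \<in> L2 ?M"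
    and an: "L2_norm ?M (\<lambda>x. complex_of_real (a x) * h x) \<le> 2 * B * L2_norm ?M h"
      "L2_norm ?M (\<lambda>x. complex_of_real (a1 x) * h x) \<le> 2 * B / L * L2_norm ?M h"
      "L2_norm ?M (\<lambda>x. complex_of_real (a2 x) * h x) \<le> 2 * B / L * L2_norm ?M h"
    if "h \<in> L2 ?M" for h
    using L2_mult_real[OF ca(1) ab(1) that] L2_mult_real[OF ca(2) ab(2) that] L2_mult_real[OF ca(3) ab(3) that] B(1) L by auto
  have Hb: "H2_on UNIV b b1 b2"
    unfolding H2_on_def using acb aL U
    by (auto simp: b_def[abs_def] b1_def[abs_def] b2_def[abs_def] mult.assoc)
  have "L2_norm (lebesgue_on {- real n..real n}) u = L2_norm (lebesgue_on {- real n..real n}) b"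
    unfolding L2_norm_def using L by (intro arg_cong[where f=sqrt] Bochner_Integration.integral_cong refl) (auto simp: b_def a_one)
  also have "\<dots> \<le> L2_norm ?M b" by (rule L2_restrict(2)[OF H2_onD(3)[OF Hb]]) auto
  finally have bn: "1 / 2 < L2_norm ?M b" using n by simp
  define r where "r x = (- b2 x + complex_of_real (V x) * b x) - ?l * b x" for x
  have req: "r = (\<lambda>x. complex_of_real (a x) * k x - (2 * (complex_of_real (a1 x) * u1 x) + complex_of_real (a2 x) * u x))"
    by (auto simp: r_def b_def b2_def k_def algebra_simps)
  have "L2_norm ?M r \<le> 2 * B * L2_norm ?M k + (cmod 2 * (2 * B / L * L2_norm ?M u1) + 2 * B / L * L2_norm ?M u)"
    unfolding req
    by (intro order_trans[OF L2_norm_diff_triangle] order_trans[OF L2_norm_triangle] add_mono an aL L2_add L2_scale kL U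
        order_trans[OF eq_refl[OF L2_norm_scale]] mult_left_mono) auto
  also have "\<dots> = 2 * B * L2_norm ?M k + N / L" by (simp add: N_def un add_divide_distrib)
  also have "\<dots> < d"
  proof -
    have "2 * B * L2_norm ?M k < 2 * B * (d / (4 * B))" using kn B(1) by (intro mult_strict_left_mono) auto
    also have "\<dots> = d / 2" using B(1) by simp
    finally show ?thesis using L(3) by linarith
  qed
  finally have rn: "L2_norm ?M r < d" .
  have bz: "b x = 0 \<and> b1 x = 0 \<and> b2 x = 0" if "6 * L \<le> \<bar>x\<bar>" for x using az[OF that] by (simp add: b_def b1_def b2_def)
  show ?thesis
    by (rule exI[of _ b], rule exI[of _ b1], rule exI[of _ b2], rule exI[of _ "6 * L"]) (use Hb bz bn rn in \<open>auto simp: r_def[abs_def]\<close>)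
qed

lemma periodic_shift:
  fixes V :: "real \<Rightarrow> real"
  assumes "\<And>x. V (x + p) = V x"
  shows "V (x - real m * p) = V x"
proof (induction m)
  case (Suc m)
  have "V (x - real (Suc m) * p) = V (x - real (Suc m) * p + p)" using assms by simp
  also have "x - real (Suc m) * p + p = x - real m * p" by (simp add: algebra_simps)
  finally show ?case using Suc by simp
qed simp

text \<open>Composing a compactly supported b with \<open>sq x - c\<close>, where c is a multiple of
  the period, keeps the potential exact: V (sq x - c) = V (sq x) = W x. The errors come from
  derivatives of \<open>sq\<close>, which are small beyond X. The support beyond X gives both
  near-orthogonality to h and the boundary condition at 0.\<close>

lemma transplanted_approx:
  fixes V W :: "real \<Rightarrow> real"
  assumes V: "V \<in> borel_measurable lebesgue" "\<And>x. \<bar>V x\<bar> \<le> K" and W: "\<And>x. 0 < x \<Longrightarrow> W x = V (sq x)"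
    and p: "0 < p" "\<And>x. V (x + p) = V x"
    and l: "complex_of_real l \<in> spectrum (lebesgue_on UNIV) (schroedinger_line V)"
    and e: "0 < e" and h: "h \<in> L2 (lebesgue_on {0<..})"
  shows "\<exists>(f, g)\<in>schroedinger_half_line \<theta> W. L2_norm (lebesgue_on {0<..}) f = 1 \<and>
    L2_norm (lebesgue_on {0<..}) (\<lambda>x. g x - complex_of_real l * f x) < e \<and> cmod (ip (lebesgue_on {0<..}) f h) < e"
proof -
  let ?M = "lebesgue_on {0<..} :: real measure" and ?U = "lebesgue_on UNIV :: real measure"
  let ?l = "complex_of_real l"
  have "0 < e / 16" using e by simp
  from compactly_supported_approx[OF V l this] obtain b b1 b2 L where b: "H2_on UNIV b b1 b2"
    "\<And>x. L \<le> \<bar>x\<bar> \<Longrightarrow> b x = 0 \<and> b1 x = 0 \<and> b2 x = 0" "1 / 2 < L2_norm ?U b"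
    "L2_norm ?U (\<lambda>x. (- b2 x + complex_of_real (V x) * b x) - ?l * b x) < e / 16" by blast
  note Bb = H2_onD[OF b(1)]
  define N where "N = L2_norm ?U b2 + L2_norm ?U b1 + 1"
  have N: "0 < N" by (simp add: N_def add_nonneg_pos)
  obtain X0 where X0: "1 \<le> X0" "\<And>Y. X0 \<le> Y \<Longrightarrow> L2_norm (lebesgue_on {Y..}) h < e" using L2_half_line_tail[OF h e] by blast
  \<comment> \<open>Two demands: beyond \<open>X0\<close> the tail of h is below e, and sqrt X >= 64
    N / e makes \<open>\<epsilon>\<close> N at most e / 32.\<close>
  define X where "X = max X0 ((64 * N / e)\<^sup>2)"
  have X: "1 \<le> X" "X0 \<le> X" using X0 by (auto simp: X_def)
  have sX: "1 \<le> sqrt X" "64 * N / e \<le> sqrt X" using X N e by (auto simp: X_def intro!: real_le_rsqrt)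
  define \<epsilon> where "\<epsilon> = 2 / sqrt X"
  have ep: "0 < \<epsilon>" "\<epsilon> * N \<le> e / 32" using sX X e N by (auto simp: \<epsilon>_def field_simps)
  obtain m :: nat where m: "(sq X + \<bar>L\<bar>) / p < real m" using reals_Archimedean2 by blast
  \<comment> \<open>So large a multiple of the period that all points x <= X are mapped to the left
    of the support of b.\<close>
  define c where "c = real m * p"
  have c: "sq X + \<bar>L\<bar> \<le> c" using m p by (simp add: c_def field_simps)
  define \<phi> where "\<phi> x = sq x - c" for x
  define y1 where "y1 x = 1 + 1 / (2 * sqrt x)" for x :: real
  define y2 where "y2 x = - 1 / (4 * x * sqrt x)" for x :: real
  have st: "1 \<le> sqrt x" "sqrt X \<le> sqrt x" "1 \<le> x" if "X \<le> x" for x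
  proof -
    show *: "sqrt X \<le> sqrt x" using that by simp
    show "1 \<le> sqrt x" using * sX(1) by linarith
    show "1 \<le> x" using that X(1) by linarith
  qed
  have y1b: "1 \<le> y1 x" "y1 x \<le> 3 / 2" if "X \<le> x" for x using st(1)[OF that] by (auto simp: y1_def field_simps)
  have y1a: "\<bar>y1 x\<bar> \<le> 2" if "X \<le> x" for x using y1b[OF that] by simp
  have y1s: "\<bar>1 - (y1 x)\<^sup>2\<bar> \<le> \<epsilon>" if "X \<le> x" for x
  proof -
    have "(y1 x)\<^sup>2 - 1 = (y1 x - 1) * (1 + y1 x)" by (simp add: power2_eq_square algebra_simps)
    moreover have "0 \<le> (y1 x - 1) * (1 + y1 x)" using y1b[OF that] by simp
    moreover have "(y1 x - 1) * (1 + y1 x) \<le> (y1 x - 1) * 4" using y1b[OF that] by (intro mult_left_mono) auto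
    moreover have "(y1 x - 1) * 4 = 2 / sqrt x" by (simp add: y1_def)
    moreover have "2 / sqrt x \<le> \<epsilon>" unfolding \<epsilon>_def using st[OF that] sX by (intro divide_left_mono) auto
    ultimately show ?thesis by simp
  qed
  have y2s: "\<bar>y2 x\<bar> \<le> \<epsilon>" if "X \<le> x" for x
  proof -
    have "1 * sqrt X \<le> (4 * x) * sqrt x" using st[OF that] X by (intro mult_mono) auto
    then have "1 / (4 * x * sqrt x) \<le> 2 / sqrt X" using sX by (intro frac_le) auto
    moreover have "\<bar>y2 x\<bar> = 1 / (4 * x * sqrt x)" using st[OF that] by (simp add: y2_def)
    ultimately show ?thesis by (simp add: \<epsilon>_def)
  qed
  have cont: "continuous_on {X..} y1" "continuous_on {X..} y2"
    unfolding y1_def y2_def using X by (auto intro!: continuous_intros)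
  have dphi: "(\<phi> has_real_derivative y1 x) (at x)" "(y1 has_real_derivative y2 x) (at x)" if "X \<le> x" for x
    unfolding \<phi>_def[abs_def] y1_def[abs_def] y2_def
    using DERIV_diff[OF sq_derivative[of x] DERIV_const[of c]] sq_derivative2[of x] st(3)[OF that] by auto
  have phi_far: "\<phi> x \<le> - \<bar>L\<bar>" if "x \<le> X" for x using sq_mono[OF that] c by (simp add: \<phi>_def)
  have z: "b (\<phi> x) = 0" "b1 (\<phi> x) = 0" "b2 (\<phi> x) = 0" if "x \<le> X" for x
  proof -
    have "L \<le> \<bar>\<phi> x\<bar>" using phi_far[OF that] by linarith
    then show "b (\<phi> x) = 0" "b1 (\<phi> x) = 0" "b2 (\<phi> x) = 0" using b(2) by auto
  qed
  let ?S = "{X..}" and ?MX = "lebesgue_on {X..} :: real measure"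
  have inv: "xi (\<phi> x + c) = x" if "x \<in> ?S" for x using that X by (simp add: \<phi>_def xi_sq)
  have comp: "(\<lambda>x. k (\<phi> x)) \<in> L2 ?MX" "L2_norm ?MX (\<lambda>x. k (\<phi> x)) \<le> 2 * L2_norm ?U k" "L2_norm (lebesgue_on (\<phi> ` ?S)) k \<le> 2 * L2_norm ?MX (\<lambda>x. k (\<phi> x))"
    if k: "k \<in> L2 ?U" for k
  proof -
    have d: "(\<phi> has_real_derivative y1 t) (at t within ?S)" if "t \<in> ?S" for t
      using dphi(1)[of t] that by (auto intro: has_field_derivative_at_within)
    have ps: "(\<lambda>t. xi (t + c)) differentiable_on \<phi> ` ?S"
      unfolding differentiable_on_def real_differentiable_def
    proof
      fix t assume "t \<in> \<phi> ` ?S"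
      then have "0 \<le> t + c" using X by (auto simp: \<phi>_def sq_def)
      then have "((\<lambda>t. xi (t + c)) has_real_derivative (1 - 1 / (2 * sqrt (t + c + 1 / 4)))) (at t)"
        using DERIV_shift[of xi "1 - 1 / (2 * sqrt (t + c + 1 / 4))" t c] xi_derivative[of "t + c"] by simp
      then show "\<exists>D. ((\<lambda>t. xi (t + c)) has_real_derivative D) (at t within \<phi> ` ?S)"
        using has_field_derivative_at_within by blast
    qed
    have bd: "1 / 2 \<le> y1 t" "y1 t \<le> 2" if "t \<in> ?S" for t using y1b[of t] that by auto
    note * = L2_compose[where \<phi>=\<phi> and ?\<phi>1.0=y1 and \<psi>="\<lambda>t. xi (t + c)" and S="{X..}" and T=UNIV, OF k _ _ d subset_UNIV ps inv bd]
    show "(\<lambda>x. k (\<phi> x)) \<in> L2 ?MX" by (rule *(1)) auto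
    show "L2_norm ?MX (\<lambda>x. k (\<phi> x)) \<le> 2 * L2_norm ?U k" by (rule *(2)) auto
    show "L2_norm (lebesgue_on (\<phi> ` ?S)) k \<le> 2 * L2_norm ?MX (\<lambda>x. k (\<phi> x))" by (rule *(3)) auto
  qed
  define f where "f x = b (\<phi> x)" for x
  define f1 where "f1 x = complex_of_real (y1 x) * b1 (\<phi> x)" for x
  define f2 where "f2 x = complex_of_real (y2 x) * b1 (\<phi> x) + complex_of_real (y1 x) * (complex_of_real (y1 x) * b2 (\<phi> x))" for x
  have fz: "f x = 0" "f1 x = 0" "f2 x = 0" if "x \<le> X" for x using z[OF that] by (auto simp: f_def f1_def f2_def)
  have acb: "ac_deriv_on UNIV b b1" "ac_deriv_on UNIV b1 b2" using Bb by auto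
  have "ac_deriv_on {X..} f f1" "ac_deriv_on {X..} f1 f2"
    unfolding f_def[abs_def] f1_def[abs_def] f2_def[abs_def]
    by (rule ac_transplant[OF acb dphi cont(2)]; (use y1b in force)?)+
  then have acf: "ac_deriv_on UNIV f f1" "ac_deriv_on UNIV f1 f2" by (auto intro!: ac_deriv_on_glue[of X] fz)
  have y1L: "(\<lambda>x. complex_of_real (y1 x) * k x) \<in> L2 ?MX" if "k \<in> L2 ?MX" for k
    by (rule L2_mult_real(1)[where B=2, OF cont(1) _ that]) (use y1a in auto)
  have y2L: "(\<lambda>x. complex_of_real (y2 x) * k x) \<in> L2 ?MX" "L2_norm ?MX (\<lambda>x. complex_of_real (y2 x) * k x) \<le> \<epsilon> * L2_norm ?MX k" if "k \<in> L2 ?MX" for k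
    by (rule L2_mult_real[where B=\<epsilon>, OF cont(2) _ that]; use y2s ep in auto)+
  have y3L: "(\<lambda>x. complex_of_real (1 - (y1 x)\<^sup>2) * k x) \<in> L2 ?MX" "L2_norm ?MX (\<lambda>x. complex_of_real (1 - (y1 x)\<^sup>2) * k x) \<le> \<epsilon> * L2_norm ?MX k" if "k \<in> L2 ?MX" for k
  proof -
    have ct: "continuous_on {X..} (\<lambda>x. 1 - (y1 x)\<^sup>2)" using cont by (intro continuous_intros)
    show "(\<lambda>x. complex_of_real (1 - (y1 x)\<^sup>2) * k x) \<in> L2 ?MX" "L2_norm ?MX (\<lambda>x. complex_of_real (1 - (y1 x)\<^sup>2) * k x) \<le> \<epsilon> * L2_norm ?MX k"
      by (rule L2_mult_real[where B=\<epsilon>, OF ct _ that]; use y1s ep in auto)+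
  qed
  note cb = comp[OF Bb(3)] and cb1 = comp[OF Bb(4)] and cb2 = comp[OF Bb(5)]
  have fX: "f \<in> L2 ?MX" "f1 \<in> L2 ?MX" "f2 \<in> L2 ?MX"
    unfolding f_def[abs_def] f1_def[abs_def] f2_def[abs_def] by (intro L2_add y1L y2L cb cb1 cb2)+
  have ext: "k \<in> L2 ?M \<and> L2_norm ?M k = L2_norm ?MX k" if "k \<in> L2 ?MX" "\<And>x. x \<le> X \<Longrightarrow> k x = 0" for k
  proof -
    have S: "{X..} \<subseteq> {0<..}" using X by auto
    show ?thesis using L2_extend[OF that(1) S] that(2) by auto
  qed
  have Hf: "H2_on {0<..} f f1 f2"
    unfolding H2_on_def using acf ext[OF fX(1) fz(1)] ext[OF fX(2) fz(2)] ext[OF fX(3) fz(3)]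
    by (auto intro: ac_deriv_on_subset)
  have Wm: "(\<lambda>x. complex_of_real (W x)) \<in> borel_measurable ?M"
  proof -
    have "(\<lambda>x. complex_of_real (V (sq x))) \<in> borel_measurable ?M" using sq_compose_measurable[OF V(1)] by measurable
    then show ?thesis by (subst measurable_cong[where g="\<lambda>x. complex_of_real (V (sq x))"]) (auto simp: W)
  qed
  have Wb: "cmod (complex_of_real (W x)) \<le> K" if "x \<in> space ?M" for x using V(2) that by (simp add: W)
  have WfL: "(\<lambda>x. complex_of_real (W x) * f x) \<in> L2 ?M" by (rule L2_mult_bounded[OF Wm Wb H2_onD(3)[OF Hf]])
  define g where "g x = - f2 x + complex_of_real (W x) * f x" for x
  have gL: "g \<in> L2 ?M" unfolding g_def[abs_def] by (intro L2_add L2_minus H2_onD(5)[OF Hf] WfL)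
  \<comment> \<open>f and its derivative vanish up to X, in particular at 0, so the boundary
    condition holds for every \<theta>.\<close>
  have mem: "(f, g) \<in> schroedinger_half_line \<theta> W"
    unfolding schroedinger_half_line_def
    by (rule schroedingerI[OF Hf]) (use fz[of 0] X H2_onD[OF Hf] gL in \<open>auto simp: g_def\<close>)
  define k where "k t = (- b2 t + complex_of_real (V t) * b t) - ?l * b t" for t
  have Vm: "(\<lambda>x. complex_of_real (V x)) \<in> borel_measurable ?U" using V(1) by (simp add: lebesgue_on_UNIV_eq)
  have VbL: "(\<lambda>t. complex_of_real (V t) * b t) \<in> L2 ?U"
    by (rule L2_mult_bounded[OF Vm _ Bb(3), of K]) (use V(2) in simp)
  have kL: "k \<in> L2 ?U" unfolding k_def by (intro L2_diff L2_add L2_minus L2_scale Bb VbL)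
  note ck = comp[OF kL]
  define r where "r x = g x - ?l * f x" for x
  \<comment> \<open>The residual of f is the transplanted residual of b plus two terms with small
    coefficients. Periodicity is used here to shift the argument of V by c.\<close>
  have r_eq: "r x = k (\<phi> x) + (complex_of_real (1 - (y1 x)\<^sup>2) * b2 (\<phi> x) - complex_of_real (y2 x) * b1 (\<phi> x))" if "X \<le> x" for x
  proof -
    have "W x = V (sq x)" using that X by (simp add: W)
    also have "\<dots> = V (\<phi> x)" using periodic_shift[where V=V and p=p and x="sq x" and m=m, OF p(2)] by (simp add: \<phi>_def c_def)
    finally show ?thesis by (simp add: r_def g_def f_def f2_def k_def algebra_simps power2_eq_square)
  qed
  have rL: "r \<in> L2 ?M" unfolding r_def[abs_def] by (intro L2_diff L2_scale gL H2_onD(3)[OF Hf])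
  have rz: "r x = 0" if "x \<le> X" for x using fz[OF that] by (simp add: r_def g_def)
  have SX: "{X..} \<subseteq> {0<..}" using X by auto
  have rX: "r \<in> L2 ?MX" by (rule L2_restrict(1)[OF rL SX]) auto
  have "L2_norm ?MX r = L2_norm ?MX (\<lambda>x. k (\<phi> x) + (complex_of_real (1 - (y1 x)\<^sup>2) * b2 (\<phi> x) - complex_of_real (y2 x) * b1 (\<phi> x)))"
    unfolding L2_norm_def by (intro arg_cong[where f=sqrt] Bochner_Integration.integral_cong refl) (simp add: r_eq)
  also have "\<dots> \<le> L2_norm ?MX (\<lambda>x. k (\<phi> x)) + (\<epsilon> * L2_norm ?MX (\<lambda>x. b2 (\<phi> x)) + \<epsilon> * L2_norm ?MX (\<lambda>x. b1 (\<phi> x)))"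
    by (intro order_trans[OF L2_norm_triangle] order_trans[OF L2_norm_diff_triangle] add_mono order_refl y2L(2) y3L(2) L2_diff y2L(1) y3L(1) ck(1) cb1(1) cb2(1))
  also have "\<dots> \<le> 2 * L2_norm ?U k + (\<epsilon> * (2 * L2_norm ?U b2) + \<epsilon> * (2 * L2_norm ?U b1))"
    using ck(2) cb1(2) cb2(2) ep by (intro add_mono mult_left_mono) auto
  also have "\<dots> \<le> 2 * L2_norm ?U k + 2 * (\<epsilon> * N)" using ep by (simp add: N_def algebra_simps)
  also have "\<dots> < 2 * (e / 16) + 2 * (e / 16)"
    using b(4) ep e by (intro add_less_le_mono mult_strict_left_mono) (auto simp: k_def[abs_def])
  finally have rn: "L2_norm ?M r < e / 4" using ext[OF rX rz] by simp
  \<comment> \<open>The support of b lies inside the image of [X, \<infinity>), so no mass is lost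
    beyond the Jacobian factor: ||f|| >= ||b|| / 2 > 1/4. Normalising then costs a factor below 4,
    which the residual bound e / 4 allows for.\<close>
  have fn: "1 / 4 < L2_norm ?M f"
  proof -
    have S: "\<phi> ` {X..} \<subseteq> UNIV" by simp
    have Sm: "\<phi> ` {X..} \<in> sets lebesgue"
    proof (rule differentiable_image_in_sets_lebesgue)
      show "\<phi> differentiable_on {X..}"
        unfolding differentiable_on_def real_differentiable_def using dphi(1) has_field_derivative_at_within by blast
    qed auto
    have bS: "b \<in> L2 (lebesgue_on (\<phi> ` {X..}))" by (rule L2_restrict(1)[OF Bb(3) S Sm]) auto
    have "L2_norm ?U b = L2_norm (lebesgue_on (\<phi> ` {X..})) b"
    proof (rule L2_extend(2)[OF bS S Sm])
      fix t assume t: "t \<notin> \<phi> ` {X..}"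
      show "b t = 0"
      proof (cases "L \<le> \<bar>t\<bar>")
        case False
        then have "sq X \<le> t + c" "0 \<le> t + c" using c X by (auto simp: sq_def intro: order_trans[of _ "X + sqrt X"])
        moreover have "X \<le> xi (t + c)"
        proof (rule ccontr)
          assume "\<not> X \<le> xi (t + c)"
          then have lt: "xi (t + c) < X" by simp
          then have "sqrt (xi (t + c)) < sqrt X" by simp
          with lt have "sq (xi (t + c)) < sq X" unfolding sq_def by (rule add_strict_mono)
          then show False using sq_xi[OF \<open>0 \<le> t + c\<close>] \<open>sq X \<le> t + c\<close> by simp
        qed
        moreover have "t = \<phi> (xi (t + c))" using \<open>0 \<le> t + c\<close> by (simp add: \<phi>_def sq_xi)
        ultimately have "t \<in> \<phi> ` {X..}" by auto
        with t show ?thesis by simp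
      qed (use b(2) in blast)
    qed simp
    also have "\<dots> \<le> 2 * L2_norm ?MX f" using cb(3) by (simp add: f_def[abs_def])
    finally show ?thesis using b(3) ext[OF fX(1) fz(1)] by simp
  qed
  define n where "n = L2_norm ?M f"
  have n: "1 / 4 < n" using fn by (simp add: n_def)
  let ?c = "complex_of_real (1 / n)"
  interpret HW: selfadjoint_op ?M "schroedinger_half_line \<theta> W"
  proof (rule selfadjoint_half_line[where K=K])
    have "(\<lambda>x. Re (complex_of_real (W x))) \<in> borel_measurable ?M" using Wm by measurable
    then show "W \<in> borel_measurable ?M" by simp
    show "\<bar>W x\<bar> \<le> K" if "0 < x" for x using V(2) that by (simp add: W)
  qed
  have "(\<lambda>x. ?c * f x, \<lambda>x. ?c * g x) \<in> schroedinger_half_line \<theta> W" by (rule HW.graph_scale[OF mem])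
  moreover have cn: "L2_norm ?M (\<lambda>x. ?c * k x) = L2_norm ?M k / n" for k
    using n by (simp only: L2_norm_scale norm_of_real) simp
  then have "L2_norm ?M (\<lambda>x. ?c * f x) = 1" using n by (simp only: n_def[symmetric]) simp
  moreover have "L2_norm ?M (\<lambda>x. ?c * g x - ?l * (?c * f x)) < e"
  proof -
    have "(\<lambda>x. ?c * g x - ?l * (?c * f x)) = (\<lambda>x. ?c * r x)" by (auto simp: r_def algebra_simps)
    then have "L2_norm ?M (\<lambda>x. ?c * g x - ?l * (?c * f x)) = L2_norm ?M r / n" by (simp only: cn)
    also have "\<dots> < (e / 4) / n" using rn n by (intro divide_strict_right_mono) auto
    also have "\<dots> < (e / 4) / (1 / 4)" using n e by (intro divide_strict_left_mono) auto
    finally show ?thesis by simp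
  qed
  \<comment> \<open>f vanishes before X, so only the tail of h on [X, \<infinity>) enters, and its
    norm is below e.\<close>
  moreover have "cmod (ip ?M (\<lambda>x. ?c * f x) h) < e"
  proof -
    let ?F = "\<lambda>x. ?c * f x"
    have S: "{X..} \<subseteq> {0<..}" using X by auto
    have hX: "h \<in> L2 ?MX" by (rule L2_restrict(1)[OF h S]) auto
    have FX: "?F \<in> L2 ?MX" by (intro L2_scale fX)
    have "ip ?M ?F h = ip ?MX ?F h"
    proof -
      have "ip ?M ?F h = (\<integral>x. indicator {0<..} x *\<^sub>R (?F x * cnj (h x)) \<partial>lebesgue)" unfolding ip_def by (rule integral_restrict_space) simp
      also have "\<dots> = (\<integral>x. indicator {X..} x *\<^sub>R (?F x * cnj (h x)) \<partial>lebesgue)"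
        using X fz(1) by (intro Bochner_Integration.integral_cong refl) (auto split: split_indicator)
      also have "\<dots> = ip ?MX ?F h" unfolding ip_def by (rule integral_restrict_space[symmetric]) simp
      finally show ?thesis .
    qed
    then have "cmod (ip ?M ?F h) \<le> L2_norm ?MX ?F * L2_norm ?MX h" using ip_norm_le[OF FX hX] by simp
    also have "L2_norm ?MX ?F = 1" using ext[OF FX] fz(1) \<open>L2_norm ?M ?F = 1\<close> by simp
    finally show ?thesis using X0(2)[OF X(2)] by simp
  qed
  ultimately show ?thesis by (intro bexI[of _ "(\<lambda>x. ?c * f x, \<lambda>x. ?c * g x)"]) auto
qed

section \<open>Compactness of approximate eigenfunctions\<close>

text \<open>Cauchy-Schwarz against the constant 1 on (x, y]. It supplies the equicontinuity for the
  Arzela-Ascoli theorem.\<close>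

lemma ac_Hoelder:
  assumes ac: "ac_deriv_on {0..} u u1" and u1: "u1 \<in> L2 (lebesgue_on {0<..})" and xy: "0 \<le> x" "x \<le> y"
  shows "cmod (u y - u x) \<le> L2_norm (lebesgue_on {0<..}) u1 * sqrt (y - x)"
proof (cases "x = y")
  case False
  let ?M = "lebesgue_on {x<..y} :: real measure"
  have sub: "{x<..y} \<subseteq> {0<..}" using xy by auto
  note r = L2_restrict[OF u1 sub]
  have one: "(\<lambda>_. 1) \<in> L2 ?M"
  proof -
    have "(\<lambda>_. 1 :: complex) \<in> L2 (lebesgue_on {x..y})" by (rule continuous_L2_Icc) (rule continuous_on_const)
    then show ?thesis by (rule L2_restrict(1)) auto
  qed
  have onen: "L2_norm ?M (\<lambda>_. 1) \<le> 1 * sqrt (y - x)" by (rule L2_norm_bounded_Icc[OF one]) (use xy in auto)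
  have eq: "(\<integral>t. u1 t * cnj 1 \<partial>?M) = u y - u x"
  proof -
    have i: "integrable ?M u1" using ip_integrable[OF r(1) one] by simp
    have "(\<integral>t. u1 t \<partial>?M) = integral {x<..y} u1" by (rule lebesgue_integral_eq_integral[OF i]) simp
    also have "\<dots> = integral {x..y} u1"
    proof (rule integral_spike_set)
      have "{t \<in> {x<..y} - {x..y}. u1 t \<noteq> 0} = {}" "{t \<in> {x..y} - {x<..y}. u1 t \<noteq> 0} \<subseteq> {x}" by auto
      then show "negligible {t \<in> {x<..y} - {x..y}. u1 t \<noteq> 0}" "negligible {t \<in> {x..y} - {x<..y}. u1 t \<noteq> 0}"
        by (auto intro: negligible_subset[OF negligible_sing])
    qed
    also have "\<dots> = u y - u x" using ac_deriv_onD(3)[OF ac, of x y] xy by simp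
    finally show ?thesis by simp
  qed
  have "cmod (u y - u x) = cmod (ip ?M u1 (\<lambda>_. 1))" unfolding ip_def eq ..
  also have "\<dots> \<le> L2_norm ?M u1 * L2_norm ?M (\<lambda>_. 1)" by (rule ip_norm_le[OF r(1) one]) auto
  also have "\<dots> \<le> L2_norm (lebesgue_on {0<..}) u1 * sqrt (y - x)" using r(2) onen xy by (intro mult_mono) auto
  finally show ?thesis .
qed simp

text \<open>Bounds on u and u'' control u' by interpolation; then the sup estimate and the
  square-root modulus of continuity hold for both u and u', uniformly in n.\<close>

lemma H2_half_line_compact:
  assumes H: "\<And>n. H2_on {0<..} (u n) (u1 n) (u2 n)" and b: "\<And>n. L2_norm (lebesgue_on {0<..}) (u n) \<le> C" "\<And>n. L2_norm (lebesgue_on {0<..}) (u2 n) \<le> C"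
  shows "\<exists>r :: nat \<Rightarrow> nat. strict_mono r \<and> (\<forall>e>0. \<exists>N. \<forall>m\<ge>N. \<forall>n\<ge>N. \<forall>x\<in>{0..R}. cmod (u (r m) x - u (r n) x) < e \<and> cmod (u1 (r m) x - u1 (r n) x) < e)"
proof -
  let ?M = "lebesgue_on {0<..} :: real measure"
  note D = H2_half_lineD[OF H]
  have C0: "0 \<le> C" using order_trans[OF L2_norm_nonneg b(1)] .
  define E where "E = 4 * C"
  have E: "0 \<le> E" "C \<le> E" using C0 by (auto simp: E_def)
  have b1: "L2_norm ?M (u1 n) \<le> E" for n
  proof -
    have "L2_norm ?M (u1 n) \<le> 2 * (L2_norm ?M (u n) + L2_norm ?M (u2 n))" by (rule H2_half_line_interpolation[OF H])
    also have "\<dots> \<le> 2 * (C + C)" using b[of n] by (intro mult_left_mono add_mono) auto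
    finally show ?thesis by (simp add: E_def)
  qed
  have be: "L2_norm ?M (u n) \<le> E" "L2_norm ?M (u2 n) \<le> E" for n using b[of n] E by auto
  have sup: "cmod (u n x) \<le> 2 * E" "cmod (u1 n x) \<le> 2 * E" if "0 \<le> x" for n x
  proof -
    have "(cmod (u n x))\<^sup>2 \<le> 2 * L2_norm ?M (u n) * L2_norm ?M (u1 n)" by (rule ac_sup_bound[OF D(1,3,4) that])
    also have "\<dots> \<le> 2 * E * E" using be(1) b1 E by (intro mult_mono) auto
    also have "\<dots> \<le> (2 * E)\<^sup>2" by (simp add: power2_eq_square)
    finally show "cmod (u n x) \<le> 2 * E" by (rule power2_le_imp_le) (use E in simp)
    have "(cmod (u1 n x))\<^sup>2 \<le> 2 * L2_norm ?M (u1 n) * L2_norm ?M (u2 n)" by (rule ac_sup_bound[OF D(2,4,5) that])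
    also have "\<dots> \<le> 2 * E * E" using be(2) b1 E by (intro mult_mono) auto
    also have "\<dots> \<le> (2 * E)\<^sup>2" by (simp add: power2_eq_square)
    finally show "cmod (u1 n x) \<le> 2 * E" by (rule power2_le_imp_le) (use E in simp)
  qed
  \<comment> \<open>Function and derivative are paired, so that a single application of
    Arzela-Ascoli yields one subsequence for both.\<close>
  define F where "F n x = (u n x, u1 n x)" for n x
  have pair: "norm (p, q) \<le> norm p + norm q" for p q :: complex
    using norm_triangle_ineq[of "(p, 0)" "(0, q)"] by simp
  have hold: "norm (F n x - F n y) \<le> 2 * E * sqrt \<bar>x - y\<bar>" if "0 \<le> x" "0 \<le> y" for n x y
  proof -
    have le: "norm (F n t - F n s) \<le> 2 * E * sqrt (t - s)" if st: "0 \<le> s" "s \<le> t" for s t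
    proof -
      have "norm (F n t - F n s) \<le> cmod (u n t - u n s) + cmod (u1 n t - u1 n s)" by (simp add: F_def pair)
      also have "\<dots> \<le> L2_norm ?M (u1 n) * sqrt (t - s) + L2_norm ?M (u2 n) * sqrt (t - s)"
        by (intro add_mono ac_Hoelder[OF D(1,4) st] ac_Hoelder[OF D(2,5) st])
      also have "\<dots> \<le> E * sqrt (t - s) + E * sqrt (t - s)" using b1 be st by (intro add_mono mult_right_mono) auto
      finally show ?thesis by simp
    qed
    show ?thesis
    proof (cases "y \<le> x")
      case True then show ?thesis using le[of y x] that by simp
    next
      case False then show ?thesis using le[of x y] that by (simp add: norm_minus_commute)
    qed
  qed
  obtain g k where g: "continuous_on {0..R} g" and k: "strict_mono (k :: nat \<Rightarrow> nat)"
    and conv: "\<And>e. 0 < e \<Longrightarrow> \<exists>N. \<forall>n x. n \<ge> N \<and> x \<in> {0..R} \<longrightarrow> norm (F (k n) x - g x) < e"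
  proof (rule Arzela_Ascoli[of "{0..R}" F "4 * E"])
    show "norm (F n x) \<le> 4 * E" if "x \<in> {0..R}" for n x
      using pair[of "u n x" "u1 n x"] sup[of x n] that by (simp add: F_def)
    show "\<exists>d. 0 < d \<and> (\<forall>n y. y \<in> {0..R} \<and> norm (x - y) < d \<longrightarrow> norm (F n x - F n y) < e)" if "x \<in> {0..R}" "0 < e" for x e
    \<comment> \<open>The inverse of the modulus 2 E sqrt |x - y|; the added 1 avoids a zero
      divisor.\<close>
    proof (intro exI[of _ "(e / (2 * E + 1))\<^sup>2"] conjI allI impI)
      show "0 < (e / (2 * E + 1))\<^sup>2" using that E by simp
      fix n y assume y: "y \<in> {0..R} \<and> norm (x - y) < (e / (2 * E + 1))\<^sup>2"
      have "sqrt \<bar>x - y\<bar> < e / (2 * E + 1)" using y that E by (intro real_less_lsqrt) auto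
      then have "(2 * E + 1) * sqrt \<bar>x - y\<bar> < e" using E by (simp add: field_simps)
      moreover have "2 * E * sqrt \<bar>x - y\<bar> \<le> (2 * E + 1) * sqrt \<bar>x - y\<bar>" by (intro mult_right_mono) auto
      ultimately show "norm (F n x - F n y) < e" using hold[of x y n] y that by simp
    qed
  qed auto
  show ?thesis
  proof (intro exI[of _ k] conjI k allI impI)
    fix e :: real assume e: "0 < e"
    then obtain N where N: "\<And>n x. n \<ge> N \<Longrightarrow> x \<in> {0..R} \<Longrightarrow> norm (F (k n) x - g x) < e / 2" using conv[of "e / 2"] by auto
    show "\<exists>N. \<forall>m\<ge>N. \<forall>n\<ge>N. \<forall>x\<in>{0..R}. cmod (u (k m) x - u (k n) x) < e \<and> cmod (u1 (k m) x - u1 (k n) x) < e"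
    proof (intro exI[of _ N] allI impI ballI)
      fix m n x assume mn: "N \<le> m" "N \<le> n" "x \<in> {0..R}"
      have "norm (F (k m) x - F (k n) x) < e"
        using N[OF mn(1,3)] N[OF mn(2,3)] norm_triangle_ineq4[of "F (k m) x - g x" "F (k n) x - g x"] by simp
      then show "cmod (u (k m) x - u (k n) x) < e \<and> cmod (u1 (k m) x - u1 (k n) x) < e"
        using norm_fst_le[of "u (k m) x - u (k n) x" "u1 (k m) x - u1 (k n) x"] norm_snd_le[of "u1 (k m) x - u1 (k n) x" "u (k m) x - u (k n) x"]
        by (simp add: F_def)
    qed
  qed
qed

text \<open>The a priori estimate is applied to differences of sequence members. Their residuals
  tend to zero by \<open>lim\<close>, and on the compact interval they are uniformly small along the
  subsequence, so the differences tend to zero in L2 of the whole half-line.\<close>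

lemma half_line_sequence_compact:
  fixes V W :: "real \<Rightarrow> real"
  assumes V: "V \<in> borel_measurable lebesgue" "\<And>x. \<bar>V x\<bar> \<le> K" and W: "\<And>x. 0 < x \<Longrightarrow> W x = V (sq x)"
    and l: "complex_of_real l \<in> resolvent_set (lebesgue_on UNIV) (schroedinger_line V)"
    and FG: "\<And>n. (F n, G n) \<in> schroedinger_half_line \<theta> W" and F1: "\<And>n. L2_norm (lebesgue_on {0<..}) (F n) = 1"
    and lim: "(\<lambda>n. L2_norm (lebesgue_on {0<..}) (\<lambda>x. G n x - complex_of_real l * F n x)) \<longlonglongrightarrow> 0"
  shows "\<exists>r :: nat \<Rightarrow> nat. strict_mono r \<and> (\<forall>e>0. \<exists>N. \<forall>m\<ge>N. \<forall>n\<ge>N. L2_norm (lebesgue_on {0<..}) (\<lambda>x. F (r m) x - F (r n) x) < e)"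
proof -
  let ?M = "lebesgue_on {0<..} :: real measure" and ?l = "complex_of_real l"
  interpret HV: selfadjoint_op "lebesgue_on UNIV" "schroedinger_line V" by (rule selfadjoint_line[OF V])
  obtain C0 where C0: "0 < C0" "\<And>f g. (f, g) \<in> schroedinger_line V \<Longrightarrow> L2_norm (lebesgue_on UNIV) f \<le> C0 * L2_norm (lebesgue_on UNIV) (\<lambda>x. g x - ?l * f x)"
    using HV.resolvent_bound[OF l] by blast
  obtain R C where R: "0 < R" and C: "0 < C" and est: "\<And>u u1 u2 s. H2_on {0<..} u u1 u2 \<Longrightarrow> (\<And>x. x \<in> {0..R} \<Longrightarrow> cmod (u x) \<le> s \<and> cmod (u1 x) \<le> s) \<Longrightarrow>
    L2_norm ?M u \<le> C * (L2_norm ?M (\<lambda>x. (- u2 x + complex_of_real (W x) * u x) - ?l * u x) + s)"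
    using half_line_estimate[OF V W C0] by blast
  have K0: "0 \<le> K" using V(2)[of 0] by simp
  have Wm: "(\<lambda>x. complex_of_real (W x)) \<in> borel_measurable ?M"
  proof -
    have "(\<lambda>x. complex_of_real (V (sq x))) \<in> borel_measurable ?M" using sq_compose_measurable[OF V(1)] by measurable
    then show ?thesis by (subst measurable_cong[where g="\<lambda>x. complex_of_real (V (sq x))"]) (auto simp: W)
  qed
  have Wb: "cmod (complex_of_real (W x)) \<le> K" if "x \<in> space ?M" for x using V(2) that by (simp add: W)
  have "\<forall>n. \<exists>u u1 u2. H2_on {0<..} u u1 u2 \<and> (AE x in ?M. F n x = u x) \<and> (AE x in ?M. G n x = - u2 x + complex_of_real (W x) * u x)"
  proof
    fix n
    from FG[of n] obtain u u1 u2 where "H2_on {0<..} u u1 u2" "AE x in ?M. F n x = u x" "AE x in ?M. G n x = - u2 x + complex_of_real (W x) * u x"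
      unfolding schroedinger_half_line_def by (rule schroedingerE)
    then show "\<exists>u u1 u2. H2_on {0<..} u u1 u2 \<and> (AE x in ?M. F n x = u x) \<and> (AE x in ?M. G n x = - u2 x + complex_of_real (W x) * u x)" by blast
  qed
  from choice[OF this] obtain u where "\<forall>n. \<exists>u1 u2. H2_on {0<..} (u n) u1 u2 \<and> (AE x in ?M. F n x = u n x) \<and> (AE x in ?M. G n x = - u2 x + complex_of_real (W x) * u n x)" ..
  from choice[OF this] obtain u1 where "\<forall>n. \<exists>u2. H2_on {0<..} (u n) (u1 n) u2 \<and> (AE x in ?M. F n x = u n x) \<and> (AE x in ?M. G n x = - u2 x + complex_of_real (W x) * u n x)" ..
  from choice[OF this] obtain u2 where H: "\<And>n. H2_on {0<..} (u n) (u1 n) (u2 n)" and Fu: "\<And>n. AE x in ?M. F n x = u n x"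
    and Gu: "\<And>n. AE x in ?M. G n x = - u2 n x + complex_of_real (W x) * u n x" by blast
  note D = H2_half_lineD[OF H]
  have FL: "F n \<in> L2 ?M" "G n \<in> L2 ?M" for n using FG[of n] unfolding schroedinger_half_line_def by (auto elim: schroedingerE)
  have WuL: "(\<lambda>x. complex_of_real (W x) * u n x) \<in> L2 ?M" for n by (rule L2_mult_bounded[OF Wm Wb D(3)])
  define k where "k n x = (- u2 n x + complex_of_real (W x) * u n x) - ?l * u n x" for n x
  have kL: "k n \<in> L2 ?M" for n unfolding k_def by (intro L2_diff L2_add L2_minus L2_scale D WuL)
  have un: "L2_norm ?M (u n) = 1" for n using L2_norm_AE_cong[OF L2_measurable[OF FL(1)] L2_measurable[OF D(3)] Fu] F1 by simp
  have kn: "L2_norm ?M (k n) = L2_norm ?M (\<lambda>x. G n x - ?l * F n x)" for n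
  proof (rule L2_norm_AE_cong)
    show "AE x in ?M. k n x = G n x - ?l * F n x" using Fu[of n] Gu[of n] by eventually_elim (simp add: k_def)
  qed (intro L2_measurable L2_diff L2_scale kL FL)+
  have klim: "(\<lambda>n. L2_norm ?M (k n)) \<longlonglongrightarrow> 0" using lim by (simp add: kn)
  then have "Bseq (\<lambda>n. L2_norm ?M (k n))" by (intro convergent_imp_Bseq convergentI)
  then obtain Bk where Bk: "\<And>n. L2_norm ?M (k n) \<le> Bk" unfolding Bseq_def by (auto intro: order_trans[OF abs_ge_self])
  define E where "E = Bk + (K + \<bar>l\<bar>) + 1"
  have u2n: "L2_norm ?M (u2 n) \<le> E" for n
  proof -
    have "u2 n = (\<lambda>x. (complex_of_real (W x) * u n x - ?l * u n x) - k n x)" by (auto simp: k_def)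
    then have "L2_norm ?M (u2 n) \<le> L2_norm ?M (\<lambda>x. complex_of_real (W x) * u n x - ?l * u n x) + L2_norm ?M (k n)"
      using L2_norm_diff_triangle[of "\<lambda>x. complex_of_real (W x) * u n x - ?l * u n x" ?M "k n"] WuL kL D(3) by simp
    also have "L2_norm ?M (\<lambda>x. complex_of_real (W x) * u n x - ?l * u n x) \<le> L2_norm ?M (\<lambda>x. complex_of_real (W x) * u n x) + L2_norm ?M (\<lambda>x. ?l * u n x)"
      by (intro L2_norm_diff_triangle L2_scale WuL D)
    also have "\<dots> \<le> K * L2_norm ?M (u n) + \<bar>l\<bar> * L2_norm ?M (u n)"
      using L2_norm_mult_bounded[OF Wm Wb D(3) K0, of n] by (simp add: L2_norm_scale)
    finally show ?thesis using Bk[of n] by (simp add: un E_def)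
  qed
  have un': "L2_norm ?M (u n) \<le> E" for n
    using order_trans[OF L2_norm_nonneg Bk[of 0]] K0 by (simp add: un E_def)
  from H2_half_line_compact[where u=u and ?u1.0=u1 and ?u2.0=u2 and C=E and R=R, OF H un' u2n]
  obtain r :: "nat \<Rightarrow> nat" where r: "strict_mono r"
    and cau: "\<forall>e>0. \<exists>N. \<forall>m\<ge>N. \<forall>n\<ge>N. \<forall>x\<in>{0..R}. cmod (u (r m) x - u (r n) x) < e \<and> cmod (u1 (r m) x - u1 (r n) x) < e"
    by (elim exE conjE)
  have "\<exists>N. \<forall>m\<ge>N. \<forall>n\<ge>N. L2_norm ?M (\<lambda>x. F (r m) x - F (r n) x) < e" if e: "0 < e" for e
  proof -
    \<comment> \<open>Two residuals and the compact part contribute at most 3 \<open>\<eta>\<close>,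
      so the estimate gives C (3 \<open>\<eta>\<close>) = 3 e / 4 < e.\<close>
    define \<eta> where "\<eta> = e / (4 * C)"
    have eta: "0 < \<eta>" using e C by (simp add: \<eta>_def)
    obtain N1 where N1: "\<And>m n x. m \<ge> N1 \<Longrightarrow> n \<ge> N1 \<Longrightarrow> x \<in> {0..R} \<Longrightarrow> cmod (u (r m) x - u (r n) x) < \<eta> \<and> cmod (u1 (r m) x - u1 (r n) x) < \<eta>"
      using cau[rule_format, OF eta] by blast
    obtain N2 where N2: "\<And>n. n \<ge> N2 \<Longrightarrow> norm (L2_norm ?M (k n) - 0) < \<eta>" using LIMSEQ_D[OF klim eta] by blast
    have N2': "L2_norm ?M (k (r n)) < \<eta>" if "n \<ge> N2" for n
      using N2[of "r n"] seq_suble[OF r, of n] that by simp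
    show ?thesis
    proof (intro exI[of _ "max N1 N2"] allI impI)
      fix m n assume mn: "max N1 N2 \<le> m" "max N1 N2 \<le> n"
      have Hd: "H2_on {0<..} (\<lambda>x. u (r m) x + (-1) * u (r n) x) (\<lambda>x. u1 (r m) x + (-1) * u1 (r n) x) (\<lambda>x. u2 (r m) x + (-1) * u2 (r n) x)"
        by (rule H2_on_add[OF H H2_on_scale[OF H]])
      have "L2_norm ?M (\<lambda>x. u (r m) x + (-1) * u (r n) x) \<le> C * (L2_norm ?M (\<lambda>x. (- (u2 (r m) x + (-1) * u2 (r n) x)
          + complex_of_real (W x) * (u (r m) x + (-1) * u (r n) x)) - ?l * (u (r m) x + (-1) * u (r n) x)) + \<eta>)"
        by (rule est[OF Hd]) (use N1[of m n] mn in \<open>force simp: less_imp_le\<close>)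
      also have "(\<lambda>x. (- (u2 (r m) x + (-1) * u2 (r n) x) + complex_of_real (W x) * (u (r m) x + (-1) * u (r n) x)) - ?l * (u (r m) x + (-1) * u (r n) x))
         = (\<lambda>x. k (r m) x - k (r n) x)" by (auto simp: k_def algebra_simps)
      also have "C * (L2_norm ?M (\<lambda>x. k (r m) x - k (r n) x) + \<eta>) < C * (2 * \<eta> + \<eta>)"
        using L2_norm_diff_triangle[OF kL kL, of "r m" "r n"] N2'[of m] N2'[of n] mn C by (intro mult_strict_left_mono) auto
      also have "\<dots> < e" using e C by (simp add: \<eta>_def)
      also have "L2_norm ?M (\<lambda>x. u (r m) x + (-1) * u (r n) x) = L2_norm ?M (\<lambda>x. F (r m) x - F (r n) x)"
      proof (rule L2_norm_AE_cong)
        show "AE x in ?M. u (r m) x + (-1) * u (r n) x = F (r m) x - F (r n) x"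
          using Fu[of "r m"] Fu[of "r n"] by eventually_elim simp
      qed (intro L2_measurable L2_add L2_diff L2_scale D FL)+
      finally show "L2_norm ?M (\<lambda>x. F (r m) x - F (r n) x) < e" .
    qed
  qed
  with r show ?thesis by blast
qed

theorem theorem1p2:
  fixes V W :: "real \<Rightarrow> real" and p \<theta> :: real
  assumes "V \<in> borel_measurable lebesgue"
    and "bounded (range V)"
    and "p > 0" and "\<And>x. V (x + p) = V x"
    and "\<And>x. x > 0 \<Longrightarrow> W x = V (x + sqrt x)"
  shows "essential_spectrum (lebesgue_on {0<..}) (schroedinger_half_line \<theta> W) =
    spectrum (lebesgue_on UNIV) (schroedinger_line V)"
proof -
  let ?M = "lebesgue_on {0<..} :: real measure"
  obtain K where K: "\<And>x. \<bar>V x\<bar> \<le> K" using assms(2) by (auto simp: bounded_iff)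
  have W: "W x = V (sq x)" if "0 < x" for x using assms(5)[OF that] by (simp add: sq_def)
  interpret HV: selfadjoint_op "lebesgue_on UNIV" "schroedinger_line V" by (rule selfadjoint_line[OF assms(1) K])
  interpret HW: selfadjoint_op ?M "schroedinger_half_line \<theta> W"
  proof (rule selfadjoint_half_line[where K=K])
    show "W \<in> borel_measurable ?M"
      using sq_compose_measurable[OF assms(1)] by (subst measurable_cong[where g="\<lambda>x. V (sq x)"]) (auto simp: W)
    show "\<bar>W x\<bar> \<le> K" if "0 < x" for x using K that by (simp add: W)
  qed
  have WK: "\<bar>W x\<bar> \<le> K" if "0 < x" for x using K that by (simp add: W)
  have one: "\<exists>a b. (a \<noteq> 0 \<or> b \<noteq> 0) \<and> (AE x in ?M. a * f x + b * g x = 0)"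
    if "f \<in> eigenspace ?M (schroedinger_half_line \<theta> W) (complex_of_real l)" "g \<in> eigenspace ?M (schroedinger_half_line \<theta> W) (complex_of_real l)" for l f g
    by (rule half_line_solutions_one_dim[OF WK that])
  \<comment> \<open>The spectra of both operators are real, so each spectral point is handled as
    \<open>complex_of_real\<close> of its real part, the form used by the two criteria.\<close>
  have real: "complex_of_real (Re z) = z" if "Im z = 0" for z using that by (simp add: complex_eq_iff)
  show ?thesis
  proof
    show "essential_spectrum ?M (schroedinger_half_line \<theta> W) \<subseteq> spectrum (lebesgue_on UNIV) (schroedinger_line V)"
    proof
      fix z assume z: "z \<in> essential_spectrum ?M (schroedinger_half_line \<theta> W)"
      then have "Im z = 0" by (intro HW.spectrum_real) (simp add: essential_spectrum_def)
      then have zl: "complex_of_real (Re z) = z" by (rule real)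
      show "z \<in> spectrum (lebesgue_on UNIV) (schroedinger_line V)"
      proof (rule ccontr)
        assume "z \<notin> spectrum (lebesgue_on UNIV) (schroedinger_line V)"
        then have res: "complex_of_real (Re z) \<in> resolvent_set (lebesgue_on UNIV) (schroedinger_line V)" by (simp add: spectrum_def zl)
        have "complex_of_real (Re z) \<notin> essential_spectrum ?M (schroedinger_half_line \<theta> W)"
        proof (rule HW.not_essential_spectrumI)
          show "L2_finite_dim ?M (eigenspace ?M (schroedinger_half_line \<theta> W) (complex_of_real (Re z)))"
          proof (rule L2_finite_dim_one_dim)
            show "eigenspace ?M (schroedinger_half_line \<theta> W) (complex_of_real (Re z)) \<subseteq> L2 ?M"
              using HW.graph_L2 by (auto simp: eigenspace_def)
          qed (rule one)
        qed (rule half_line_sequence_compact[OF assms(1) K W res])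
        then show False using z zl by simp
      qed
    qed
    show "spectrum (lebesgue_on UNIV) (schroedinger_line V) \<subseteq> essential_spectrum ?M (schroedinger_half_line \<theta> W)"
    proof
      fix z assume z: "z \<in> spectrum (lebesgue_on UNIV) (schroedinger_line V)"
      have zl: "complex_of_real (Re z) = z" by (rule real[OF HV.spectrum_real[OF z]])
      have "complex_of_real (Re z) \<in> essential_spectrum ?M (schroedinger_half_line \<theta> W)"
      proof (rule HW.essential_spectrumI[OF one])
        fix e :: real and h assume e: "0 < e" and h: "h \<in> L2 ?M"
        show "\<exists>(f, g)\<in>schroedinger_half_line \<theta> W. L2_norm ?M f = 1 \<and> L2_norm ?M (\<lambda>x. g x - complex_of_real (Re z) * f x) < e \<and> cmod (ip ?M f h) < e"
          by (rule transplanted_approx[OF assms(1) K W assms(3,4) _ e h]) (use z zl in auto)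
      qed
      then show "z \<in> essential_spectrum ?M (schroedinger_half_line \<theta> W)" by (simp add: zl)
    qed
  qed
qed

end
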